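(* Let $\delta<3/392$. Let $C\subset\mathbb{P}^3$ be a non-singular complete intersection defined by two simultaneously diagonal quadratic forms $$q=a_0x_0^2+a_1x_1^2+a_2x_2^2+a_3x_3^2,\qquad r=b_0x_0^2+b_1x_1^2+b_2x_2^2+b_3x_3^2$$ with integral coefficients $a_i,b_i$. Then for $B\geq 1$, $$N(B)\ll B^{1/2-\delta},$$ where the implied constant depends solely on $\delta$ and not on the coefficients of $q$ and $r$.
   Context: For $P=[x_0,x_1,x_2,x_3]\in\mathbb{P}^3(\mathbb{Q})$ with coprime integer coordinates, $H(P)=\max_i|x_i|$, and $N(B)=\#\{P\in C(\mathbb{Q}): H(P)\leq B\}$. *)

theory Defs
  imports "HOL-Analysis.Analysis"
begin

text \<open>
  Vectors are indexed by the four-element type \<^typ>\<open>4\<close>, whose elements \<open>0, 1, 2, 3\<close> are the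
  indices of the homogeneous coordinates.
\<close>

definition diag_form :: "int ^ 4 \<Rightarrow> 'a::comm_ring_1 ^ 4 \<Rightarrow> 'a" where
  "diag_form a x = (\<Sum>i\<in>UNIV. of_int (a $ i) * (x $ i)\<^sup>2)"

definition partial_deriv :: "(complex ^ 4 \<Rightarrow> complex) \<Rightarrow> 4 \<Rightarrow> complex ^ 4 \<Rightarrow> complex" where
  "partial_deriv f i x = deriv (\<lambda>t. f (\<chi> j. if j = i then t else x $ j)) (x $ i)"

definition jacobian_matrix ::
    "(complex ^ 4 \<Rightarrow> complex) \<Rightarrow> (complex ^ 4 \<Rightarrow> complex) \<Rightarrow> complex ^ 4 \<Rightarrow> complex ^ 4 ^ 2" where
  "jacobian_matrix f g x =
     (\<chi> k. if k = 1 then (\<chi> i. partial_deriv f i x) else (\<chi> i. partial_deriv g i x))"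

text \<open>
  The Jacobian criterion for the scheme cut out in complex projective 3-space by two forms. Rank 2
  at every geometric point also forces every component of the common zero locus to have
  codimension 2, so that \<open>f = g = 0\<close> is a complete intersection of the two surfaces; dependent
  forms and forms with a common factor are thereby excluded.
\<close>

definition nonsingular_complete_intersection ::
    "(complex ^ 4 \<Rightarrow> complex) \<Rightarrow> (complex ^ 4 \<Rightarrow> complex) \<Rightarrow> bool" where
  "nonsingular_complete_intersection f g \<longleftrightarrow>
     (\<forall>x. x \<noteq> 0 \<longrightarrow> f x = 0 \<longrightarrow> g x = 0 \<longrightarrow> rank (jacobian_matrix f g x) = 2)"

lemma partial_deriv_diag_form:
  "partial_deriv (diag_form a) i x = 2 * of_int (a $ i) * x $ i"
proof -
  have eq: "diag_form a (\<chi> j. if j = i then t else x $ j) =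
      of_int (a $ i) * t\<^sup>2 + (\<Sum>j\<in>UNIV - {i}. of_int (a $ j) * (x $ j)\<^sup>2)" for t :: complex
    by (simp add: diag_form_def sum.remove[of UNIV i])
  show ?thesis
    unfolding partial_deriv_def eq
    by (rule DERIV_imp_deriv) (auto intro!: derivative_eq_intros)
qed

definition proj_rel :: "(rat ^ 4) rel" where
  "proj_rel = {(x, y). x \<noteq> 0 \<and> y \<noteq> 0 \<and> (\<exists>c. y = c *s x)}"

definition proj_space :: "(rat ^ 4) set set" where
  "proj_space = (UNIV - {0}) // proj_rel"

definition proj_point :: "rat ^ 4 \<Rightarrow> (rat ^ 4) set" where
  "proj_point x = proj_rel `` {x}"

definition rat_vec :: "int ^ 4 \<Rightarrow> rat ^ 4" where
  "rat_vec x = (\<chi> i. of_int (x $ i))"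

definition coprime_coords :: "int ^ 4 \<Rightarrow> bool" where
  "coprime_coords x \<longleftrightarrow> Gcd (range (($) x)) = 1"

definition max_abs :: "int ^ 4 \<Rightarrow> int" where
  "max_abs x = (MAX i. \<bar>x $ i\<bar>)"

text \<open>
  The coprime integral representative of a point is unique up to sign, so that the height does not
  depend on its choice; see \<open>height_proj_point\<close> below.
\<close>

definition height :: "(rat ^ 4) set \<Rightarrow> int" where
  "height P = (THE h. \<exists>x. coprime_coords x \<and> P = proj_point (rat_vec x) \<and> h = max_abs x)"

definition rational_points :: "int ^ 4 \<Rightarrow> int ^ 4 \<Rightarrow> (rat ^ 4) set set" where
  "rational_points a b = {P \<in> proj_space. \<forall>x\<in>P. diag_form a x = 0 \<and> diag_form b x = 0}"

definition num_points :: "int ^ 4 \<Rightarrow> int ^ 4 \<Rightarrow> real \<Rightarrow> nat" where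
  "num_points a b B = card {P \<in> rational_points a b. of_int (height P) \<le> B}"

lemma equiv_proj_rel: "equiv (UNIV - {0}) proj_rel"
proof (rule equivI)
  show "proj_rel \<subseteq> (UNIV - {0}) \<times> (UNIV - {0})"
    by (auto simp: proj_rel_def)
  show "refl_on (UNIV - {0}) proj_rel"
    by (auto simp: proj_rel_def refl_on_def intro: exI[of _ 1])
  show "sym proj_rel"
  proof (rule symI)
    fix x y assume "(x, y) \<in> proj_rel"
    then obtain c where c: "x \<noteq> 0" "y \<noteq> 0" "y = c *s x" by (auto simp: proj_rel_def)
    then have "c \<noteq> 0" by auto
    then have "x = inverse c *s y" using c(3) by (simp add: vector_smult_assoc)
    then have "\<exists>d. x = d *s y" by blast
    then show "(y, x) \<in> proj_rel" using c(1,2) by (simp add: proj_rel_def)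
  qed
  show "trans proj_rel"
    by (rule transI) (auto simp: proj_rel_def vector_smult_assoc)
qed

lemma coprime_coords_nonzero: "coprime_coords x \<Longrightarrow> rat_vec x \<noteq> 0"
proof
  assume "coprime_coords x" "rat_vec x = 0"
  then have "Gcd (range (($) x)) = 1" "\<And>i. x $ i = 0"
    by (simp_all add: coprime_coords_def rat_vec_def vec_eq_iff)
  then show False by (simp add: image_constant_conv)
qed

lemma Gcd_range_scale:
  fixes x :: "int ^ 4"
  assumes "coprime_coords x"
  shows "Gcd (range (\<lambda>i. c * x $ i)) = \<bar>c\<bar>"
proof -
  have "range (\<lambda>i. c * x $ i) = (*) c ` range (($) x)" by auto
  then show ?thesis using assms by (simp add: Gcd_mult coprime_coords_def)
qed

lemma coprime_coords_unique:
  assumes "coprime_coords x" "coprime_coords y"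
    and "proj_point (rat_vec x) = proj_point (rat_vec y)"
  shows "\<bar>x $ i\<bar> = \<bar>y $ i\<bar>"
proof -
  have "(rat_vec x, rat_vec y) \<in> proj_rel"
    using assms(3) eq_equiv_class_iff[OF equiv_proj_rel, of "rat_vec x" "rat_vec y"]
      coprime_coords_nonzero[OF assms(1)] coprime_coords_nonzero[OF assms(2)]
    by (simp add: proj_point_def)
  then obtain c where c: "rat_vec y = c *s rat_vec x" by (auto simp: proj_rel_def)
  obtain p q :: int where pq: "c = of_int p / of_int q" "q \<noteq> 0"
    by (metis Fract_of_int_quotient Rat_cases less_irrefl)
  have e: "q * y $ j = p * x $ j" for j
  proof -
    have "of_int (y $ j) = c * of_int (x $ j)"
      using c by (simp add: rat_vec_def vec_eq_iff)
    then have "of_int (q * y $ j) = (of_int (p * x $ j) :: rat)"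
      using pq by (simp add: field_simps)
    then show ?thesis by (simp only: of_int_eq_iff)
  qed
  have "\<bar>q\<bar> = \<bar>p\<bar>"
    using Gcd_range_scale[OF assms(1), of p] Gcd_range_scale[OF assms(2), of q] by (simp add: e)
  moreover have "\<bar>q\<bar> * \<bar>y $ i\<bar> = \<bar>p\<bar> * \<bar>x $ i\<bar>"
    using e[of i] by (metis abs_mult)
  ultimately show ?thesis using pq(2) by auto
qed

lemma height_proj_point:
  assumes "coprime_coords x"
  shows "height (proj_point (rat_vec x)) = max_abs x"
  unfolding height_def
proof (rule the_equality)
  fix h assume "\<exists>y. coprime_coords y \<and> proj_point (rat_vec x) = proj_point (rat_vec y) \<and> h = max_abs y"
  then show "h = max_abs x"
    using coprime_coords_unique[OF assms] by (auto simp: max_abs_def)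
qed (use assms in blast)

lemma ex_coprime_coords:
  assumes "P \<in> proj_space"
  obtains x where "coprime_coords x" "P = proj_point (rat_vec x)"
proof -
  from assms obtain v where v: "v \<noteq> 0" "P = proj_point v"
    by (auto simp: proj_space_def proj_point_def elim!: quotientE)
  define d where "d = (\<Prod>i\<in>UNIV. snd (quotient_of (v $ i)))"
  have d: "d > 0" by (auto simp: d_def intro!: prod_pos quotient_of_denom_pos')
  have "\<exists>z::int. of_int z = of_int d * v $ i" for i
  proof -
    define n m where "n = fst (quotient_of (v $ i))" and "m = snd (quotient_of (v $ i))"
    have m: "m > 0" "v $ i = of_int n / of_int m"
      by (auto simp: m_def n_def quotient_of_denom_pos' quotient_of_div)
    have "m dvd d" unfolding d_def m_def by (rule dvd_prodI) auto
    then obtain k where "d = m * k" by blast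
    then have "of_int (k * n) = of_int d * v $ i" using m by simp
    then show ?thesis by blast
  qed
  then obtain z where z: "\<And>i. of_int (z i) = of_int d * v $ i" by metis
  define g where "g = Gcd (range z)"
  from v(1) obtain i where "v $ i \<noteq> 0" by (auto simp: vec_eq_iff)
  then have "z i \<noteq> 0" using z[of i] d by auto
  then have g: "g \<noteq> 0" by (auto simp: g_def)
  define x :: "int ^ 4" where "x = (\<chi> i. z i div g)"
  have gx: "g * x $ i = z i" for i
    by (simp add: x_def g_def)
  have "range z = (*) g ` range (($) x)" by (auto simp: gx image_image)
  then have "g = \<bar>g\<bar> * Gcd (range (($) x))"
    unfolding g_def[symmetric] using Gcd_mult[of g "range (($) x)"] g_def by (simp add: abs_mult)
  moreover have "g > 0" using g by (simp add: g_def order_less_le)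
  ultimately have cop: "coprime_coords x" by (simp add: coprime_coords_def)
  have "rat_vec x = (of_int d / of_int g) *s v"
  proof -
    have "of_int (x $ i) = of_int d / of_int g * v $ i" for i
      using z[of i] g by (simp flip: gx add: field_simps)
    then show ?thesis by (simp add: rat_vec_def vec_eq_iff)
  qed
  then have "(v, rat_vec x) \<in> proj_rel"
    using v(1) coprime_coords_nonzero[OF cop] by (auto simp: proj_rel_def)
  then have "P = proj_point (rat_vec x)"
    using v(2) equiv_class_eq[OF equiv_proj_rel] by (simp add: proj_point_def)
  with cop show ?thesis by (rule that)
qed

text \<open>The set counted by \<^const>\<open>num_points\<close> is finite, so that its cardinality is meaningful.\<close>

lemma finite_bounded_height: "finite {P \<in> rational_points a b. of_int (height P) \<le> (B::real)}"
proof (rule finite_subset)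
  define S where "S = {x :: int ^ 4. \<forall>i. x $ i \<in> {-\<lfloor>B\<rfloor>..\<lfloor>B\<rfloor>}}"
  have "S \<subseteq> vec_lambda ` (UNIV \<rightarrow>\<^sub>E {-\<lfloor>B\<rfloor>..\<lfloor>B\<rfloor>})"
    by (auto simp: S_def image_iff intro!: bexI[of _ "vec_nth _"])
  moreover have "finite (vec_lambda ` ((UNIV :: 4 set) \<rightarrow>\<^sub>E {-\<lfloor>B\<rfloor>..\<lfloor>B\<rfloor>}))"
    by (intro finite_imageI finite_PiE) auto
  ultimately have "finite S" by (rule finite_subset)
  then show "finite ((\<lambda>x. proj_point (rat_vec x)) ` S)" by (rule finite_imageI)
  show "{P \<in> rational_points a b. of_int (height P) \<le> B} \<subseteq> (\<lambda>x. proj_point (rat_vec x)) ` S"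
  proof safe
    fix P assume P: "P \<in> rational_points a b" "of_int (height P) \<le> B"
    then obtain x where x: "coprime_coords x" "P = proj_point (rat_vec x)"
      using ex_coprime_coords by (auto simp: rational_points_def)
    have "\<bar>x $ i\<bar> \<le> \<lfloor>B\<rfloor>" for i
    proof -
      have "\<bar>x $ i\<bar> \<le> max_abs x" by (simp add: max_abs_def)
      also have "max_abs x \<le> \<lfloor>B\<rfloor>" using P(2) x height_proj_point by (simp add: le_floor_iff)
      finally show ?thesis .
    qed
    then have "x \<in> S" by (auto simp: S_def abs_le_iff minus_le_iff)
    then show "P \<in> (\<lambda>x. proj_point (rat_vec x)) ` S" using x(2) by blast
  qed
qed

end

theory Submission
  imports Defs "HOL-Computational_Algebra.Squarefree"
begin

text \<open>
  Writing \<open>X i = (x $ i)\<^sup>2\<close>, the points of the curve correspond to points \<open>X\<close> of a line in \<open>\<P>\<^sup>3\<close> all of whose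
  coordinates are squares. For two points \<open>x\<close>, \<open>y\<close> the minors \<open>X i * Y j - X j * Y i\<close> are proportional to
  a fixed vector, and each of them factors as
  \<open>(x $ i * y $ j - x $ j * y $ i) * (x $ i * y $ j + x $ j * y $ i)\<close>. Away from the primes dividing
  this fixed vector, both factors split further: up to factors that take only \<open>B powr \<epsilon>\<close> values in
  total, they are products of coordinates of two integer points \<open>z\<close> and \<open>w\<close>. These are the halves of
  \<open>x + y\<close> and \<open>x - y\<close> in the group law, and they lie on curves of the same shape as the original one
  (the classical theta relations). If \<open>D\<close> is the largest bad part of a minor, then the product of all
  eight coordinates is at most \<open>B ^ 4 / D\<close>.

  The squared number of points is therefore at most \<open>B powr \<epsilon>\<close> times the number of such pairs \<open>(z, w)\<close>.
  Since a conic has only \<open>B powr \<epsilon>\<close> points with a given coordinate, and the smallest coordinates of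
  \<open>z\<close> and \<open>w\<close> have product at most \<open>(B ^ 4 / D) powr (1 / 4)\<close>, the number of pairs is at most
  \<open>B powr (1 + \<epsilon>) * D powr (- 1 / 4)\<close>; already for \<open>D = 1\<close> this gives the exponent \<open>1 / 2 + \<epsilon>\<close>,
  uniformly in the curve. For small \<open>D\<close> the curves carrying \<open>z\<close> and \<open>w\<close> have small coefficients, so that
  three coordinates of each point are of comparable size, and the largest coordinates have product
  about \<open>D * B powr (4 / 3)\<close>; inserting the exponent \<open>1 / 2 + \<epsilon>\<close> for these two curves bounds the number
  of pairs by \<open>B powr (2 / 3 + \<epsilon>) * D powr (1 / 2)\<close>. The worst case \<open>D = B powr (4 / 9)\<close> of the two
  bounds yields the exponent \<open>4 / 9 + \<epsilon>\<close>, which is smaller than \<open>1 / 2 - 3 / 392\<close>.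
\<close>

section \<open>Smooth numbers and divisors\<close>

text \<open>The obstacle is uniformity: the coefficients of the curve may be arbitrarily large
  compared with B, so neither its bad primes nor a divisor bound for its own conics can be used
  directly. Both difficulties disappear for pairs. The bad primes are read off from the minors of
  one reference pair of points of height at most B, so that they divide a number \<open>Q\<close>
  bounded by a power of B, and Rankin's bound for smooth numbers then controls the possible bad
  parts. The divisor bound is applied only to the curves carrying the half points: their
  coefficients are products of two bad parts, hence also bounded by a power of B. The resulting
  count for the original curve contains no trace of its coefficients, and this is what allows the
  count to be fed back into the curves carrying the half points. For the same reason the proof works
  with sets of integer points satisfying three-term relations between squares rather than with a
  fixed pair of forms.\<close>

definition smooth_upto :: "nat set \<Rightarrow> real \<Rightarrow> nat set" where
  "smooth_upto P X = {n. n > 0 \<and> real n \<le> X \<and> prime_factors n \<subseteq> P}"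

lemma finite_smooth_upto [simp]: "finite (smooth_upto P X)"
proof (rule finite_subset)
  show "smooth_upto P X \<subseteq> {..nat \<lfloor>X\<rfloor>}"
    by (auto simp: smooth_upto_def le_nat_floor)
qed auto

text \<open>Rankin's trick, one prime at a time. Writing n = p^j * m with p not dividing m, the
  inductive bound for X / p^j carries the factor p^(- j * \<open>\<epsilon>\<close>), and the
  geometric series over j is at most the Euler factor of p.\<close>

lemma card_smooth_upto_le:
  fixes \<epsilon> X :: real
  assumes "finite P" "\<And>p. p \<in> P \<Longrightarrow> prime p" "\<epsilon> > 0" "X > 0"
  shows "real (card (smooth_upto P X)) \<le> X powr \<epsilon> * (\<Prod>p\<in>P. 1 / (1 - real p powr - \<epsilon>))"
  using assms(1,2,4)
proof (induction P arbitrary: X rule: finite_induct)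
  case empty
  show ?case
  proof (cases "X \<ge> 1")
    case True
    have "n = 1" if "n > 0" "prime_factors n \<subseteq> {}" for n :: nat
      using that prime_factorization_empty_iff[of n] by simp
    then have "smooth_upto {} X \<subseteq> {1}"
      unfolding smooth_upto_def by blast
    then have "card (smooth_upto {} X) \<le> 1"
      using card_mono[of "{1::nat}"] by simp
    then show ?thesis using True assms(3) by (simp add: ge_one_powr_ge_zero order_trans[of _ 1])
  next
    case False
    then have "smooth_upto {} X = {}" by (auto simp: smooth_upto_def)
    then show ?thesis by simp
  qed
next
  case (insert p P)
  have p: "prime p" using insert.prems(1) by simp
  then have p1: "p > 1" by (rule prime_gt_1_nat)
  define t where "t = real p powr - \<epsilon>"
  have t: "0 < t" "t < 1"
    using p1 assms(3) by (auto simp: t_def powr_minus_divide)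
  define M where "M = (\<Prod>p\<in>P. 1 / (1 - real p powr - \<epsilon>))"
  have "M \<ge> 0" unfolding M_def
  proof (rule prod_nonneg)
    fix r assume "r \<in> P"
    then have "r > 1" using insert.prems(1) prime_gt_1_nat by auto
    then have "real r powr - \<epsilon> < 1" using assms(3) by (auto simp: powr_minus_divide)
    then show "0 \<le> 1 / (1 - real r powr - \<epsilon>)" by simp
  qed
  \<comment> \<open>\<open>J\<close> only has to bound the exponents that occur: j < p^j <= n <=
    X.\<close>
  define J where "J = nat \<lfloor>X\<rfloor>"
  have "smooth_upto (insert p P) X \<subseteq> (\<Union>j\<in>{..J}. (\<lambda>n. p ^ j * n) ` smooth_upto P (X / p ^ j))"
  proof
    fix n assume "n \<in> smooth_upto (insert p P) X"
    then have n: "n > 0" "real n \<le> X" "prime_factors n \<subseteq> insert p P"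
      by (auto simp: smooth_upto_def)
    obtain m where m: "n = p ^ multiplicity p n * m" "\<not> p dvd m"
      using multiplicity_decompose'[of n p] n(1) p1 by auto
    let ?j = "multiplicity p n"
    have m0: "m > 0" using m n by (cases m) auto
    have "prime_factors m \<subseteq> P"
    proof
      fix r assume r: "r \<in> prime_factors m"
      then have "r \<noteq> p" using m(2) by auto
      moreover have "r dvd n" using r m(1) by (metis dvd_mult in_prime_factors_iff)
      then have "r \<in> prime_factors n" using r n(1) by (auto simp: in_prime_factors_iff)
      ultimately show "r \<in> P" using n(3) by auto
    qed
    moreover have "real m \<le> X / p ^ ?j"
    proof -
      have "real m * p ^ ?j = real n" using m(1) by (metis mult.commute of_nat_mult of_nat_power)
      then show ?thesis using n(2) p1 by (simp add: field_simps)
    qed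
    ultimately have "m \<in> smooth_upto P (X / p ^ ?j)" using m0 by (auto simp: smooth_upto_def)
    moreover have "?j \<le> J"
    proof -
      have "?j < p ^ ?j" using p1 by (simp add: power_gt_expt)
      also have "p ^ ?j \<le> n" using m(1) m0 by (metis dvd_imp_le dvd_triv_left n(1))
      finally show ?thesis using n(2) unfolding J_def by (simp add: le_nat_floor)
    qed
    ultimately show "n \<in> (\<Union>j\<in>{..J}. (\<lambda>n. p ^ j * n) ` smooth_upto P (X / p ^ j))"
      using m(1) by blast
  qed
  then have "card (smooth_upto (insert p P) X)
      \<le> card (\<Union>j\<in>{..J}. (\<lambda>n. p ^ j * n) ` smooth_upto P (X / p ^ j))"
    by (intro card_mono) auto
  also have "\<dots> \<le> (\<Sum>j\<le>J. card ((\<lambda>n. p ^ j * n) ` smooth_upto P (X / p ^ j)))"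
    by (rule card_UN_le) auto
  also have "\<dots> \<le> (\<Sum>j\<le>J. card (smooth_upto P (X / p ^ j)))"
    by (intro sum_mono card_image_le) auto
  finally have "real (card (smooth_upto (insert p P) X)) \<le> (\<Sum>j\<le>J. real (card (smooth_upto P (X / p ^ j))))"
    by (metis of_nat_mono of_nat_sum)
  also have "\<dots> \<le> (\<Sum>j\<le>J. X powr \<epsilon> * M * t ^ j)"
  proof (rule sum_mono)
    fix j
    have "real (card (smooth_upto P (X / p ^ j))) \<le> (X / p ^ j) powr \<epsilon> * M"
      unfolding M_def using insert.prems p1 by (intro insert.IH) auto
    also have "(X / p ^ j) powr \<epsilon> = X powr \<epsilon> * t ^ j"
    proof -
      have "(real p ^ j) powr \<epsilon> = real p powr (real j * \<epsilon>)"
        using p1 by (simp add: powr_powr flip: powr_realpow)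
      moreover have "t ^ j = real p powr (- (real j * \<epsilon>))"
        using p1 t by (simp add: t_def powr_powr mult.commute flip: powr_realpow)
      moreover have "(X / p ^ j) powr \<epsilon> = X powr \<epsilon> / (real p ^ j) powr \<epsilon>"
        using insert.prems(2) p1 by (simp add: powr_divide)
      ultimately show ?thesis by (simp add: powr_minus divide_inverse)
    qed
    finally show "real (card (smooth_upto P (X / p ^ j))) \<le> X powr \<epsilon> * M * t ^ j"
      by (simp add: mult_ac)
  qed
  also have "\<dots> = X powr \<epsilon> * M * (\<Sum>j\<le>J. t ^ j)" by (simp add: sum_distrib_left)
  also have "(\<Sum>j\<le>J. t ^ j) \<le> 1 / (1 - t)"
    using t by (simp add: sum_gp0 divide_right_mono)
  finally have "real (card (smooth_upto (insert p P) X)) \<le> X powr \<epsilon> * M * (1 / (1 - t))"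
    using \<open>M \<ge> 0\<close> by (simp add: mult_left_mono)
  moreover have "(\<Prod>r\<in>insert p P. 1 / (1 - real r powr - \<epsilon>)) = 1 / (1 - t) * M"
    using insert.hyps by (simp add: t_def M_def)
  ultimately show ?case by (simp only: mult_ac)
qed

text \<open>With t = p powr \<open>\<epsilon>\<close> the factor is 1 / (1 - 1 / t), which is at
  most t as soon as t >= 2, that is for p >= 2 powr (1 / \<open>\<epsilon>\<close>). The finitely
  many smaller primes go into \<open>C\<close>.\<close>

lemma prod_euler_factor_le:
  fixes \<epsilon> :: real
  assumes "\<epsilon> > 0"
  obtains C where "C > 0"
    "\<And>P. finite P \<Longrightarrow> (\<And>p. p \<in> P \<Longrightarrow> prime p) \<Longrightarrow>
       (\<Prod>p\<in>P. 1 / (1 - real p powr - \<epsilon>)) \<le> C * real (\<Prod>P) powr \<epsilon>"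
proof -
  define N where "N = nat \<lceil>2 powr (1 / \<epsilon>)\<rceil>"
  define c where "c p = (if p < N then 1 / (1 - real p powr - \<epsilon>) else 1)" for p :: nat
  have lt1: "0 < real p powr - \<epsilon> \<and> real p powr - \<epsilon> < 1" if "p \<ge> 2" for p :: nat
    using that assms by (auto simp: powr_minus_divide)
  have c1: "c p \<ge> 1" if "p \<ge> 2" for p
    using lt1[OF that] by (auto simp: c_def)
  define C where "C = (\<Prod>p\<in>{2..<N}. c p)"
  have C1: "C \<ge> 1" unfolding C_def by (intro prod_ge_1) (auto intro: c1)
  have main: "1 / (1 - real p powr - \<epsilon>) \<le> c p * real p powr \<epsilon>" if "prime p" for p
  proof -
    have p2: "p \<ge> 2" using that by (rule prime_ge_2_nat)
    have ge1: "real p powr \<epsilon> \<ge> 1" using p2 assms by (simp add: ge_one_powr_ge_zero)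
    show ?thesis
    proof (cases "p < N")
      case True
      have "c p * 1 \<le> c p * real p powr \<epsilon>" using ge1 c1[OF p2] by (intro mult_left_mono) auto
      moreover have "c p = 1 / (1 - real p powr - \<epsilon>)" using True by (simp add: c_def)
      ultimately show ?thesis by linarith
    next
      case False
      then have "2 powr (1 / \<epsilon>) \<le> real p" unfolding N_def by linarith
      then have "(2 powr (1 / \<epsilon>)) powr \<epsilon> \<le> real p powr \<epsilon>"
        using assms by (intro powr_mono2) auto
      then have t2: "2 \<le> real p powr \<epsilon>" using assms by (simp add: powr_powr)
      define t where "t = real p powr \<epsilon>"
      have "1 / (1 - 1 / t) \<le> t"
        using t2 unfolding t_def[symmetric] by (simp add: field_simps)
      then show ?thesis using False by (simp add: c_def t_def powr_minus_divide)
    qed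
  qed
  show thesis
  proof (rule that[of C])
    show "C > 0" using C1 by simp
    fix P :: "nat set" assume P: "finite P" "\<And>p. p \<in> P \<Longrightarrow> prime p"
    have "(\<Prod>p\<in>P. 1 / (1 - real p powr - \<epsilon>)) \<le> (\<Prod>p\<in>P. c p * real p powr \<epsilon>)"
    proof (rule prod_mono)
      fix p assume p: "p \<in> P"
      then have "p \<ge> 2" using P prime_ge_2_nat by auto
      then show "0 \<le> 1 / (1 - real p powr - \<epsilon>) \<and> 1 / (1 - real p powr - \<epsilon>) \<le> c p * real p powr \<epsilon>"
        using main[OF P(2)[OF p]] lt1[of p] by auto
    qed
    also have "\<dots> = (\<Prod>p\<in>P. c p) * real (\<Prod>P) powr \<epsilon>"
      by (simp add: prod.distrib prod_powr_distrib)
    also have "(\<Prod>p\<in>P. c p) = (\<Prod>p\<in>P \<inter> {2..<N}. c p)"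
    proof (rule prod.mono_neutral_right)
      show "\<forall>i\<in>P - P \<inter> {2..<N}. c i = 1"
      proof
        fix i assume i: "i \<in> P - P \<inter> {2..<N}"
        then have "2 \<le> i" using P(2) prime_ge_2_nat by blast
        then show "c i = 1" using i by (simp add: c_def)
      qed
    qed (use P in auto)
    also have "\<dots> \<le> C"
      unfolding C_def
      by (rule prod_mono2) (auto intro: c1 order_trans[OF _ c1])
    finally show "(\<Prod>p\<in>P. 1 / (1 - real p powr - \<epsilon>)) \<le> C * real (\<Prod>P) powr \<epsilon>"
      by (simp add: mult_right_mono)
  qed
qed

text \<open>The Euler product runs over the primes dividing \<open>Q\<close>, whose product is at
  most \<open>Q\<close>. When \<open>X\<close> and \<open>Q\<close> are bounded by fixed powers of
  the height, the count is therefore below any given small power of the height, which is why bad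
  factors cost almost nothing.\<close>

lemma smooth_count:
  fixes \<epsilon> :: real
  assumes "\<epsilon> > 0"
  obtains C where "C > 0"
    "\<And>Q X. Q > 0 \<Longrightarrow> X > 0 \<Longrightarrow> real (card (smooth_upto (prime_factors Q) X)) \<le> C * (X * real Q) powr \<epsilon>"
proof -
  obtain C where C: "C > 0"
    "\<And>P. finite P \<Longrightarrow> (\<And>p. p \<in> P \<Longrightarrow> prime p) \<Longrightarrow>
       (\<Prod>p\<in>P. 1 / (1 - real p powr - \<epsilon>)) \<le> C * real (\<Prod>P) powr \<epsilon>"
    using prod_euler_factor_le[OF assms] by blast
  show thesis
  proof (rule that[OF C(1)])
    fix Q :: nat and X :: real assume Q: "Q > 0" and X: "X > 0"
    have "\<Prod>(prime_factors Q) dvd Q"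
    proof -
      have "(\<Prod>p\<in>prime_factors Q. p ^ 1) dvd (\<Prod>p\<in>prime_factors Q. p ^ multiplicity p Q)"
        by (intro prod_dvd_prod le_imp_power_dvd) (simp add: prime_factors_multiplicity)
      then show ?thesis using prod_prime_factors[of Q] Q by simp
    qed
    then have le: "\<Prod>(prime_factors Q) \<le> Q" using Q by (intro dvd_imp_le)
    have "real (card (smooth_upto (prime_factors Q) X))
        \<le> X powr \<epsilon> * (\<Prod>p\<in>prime_factors Q. 1 / (1 - real p powr - \<epsilon>))"
      by (intro card_smooth_upto_le assms X) auto
    also have "\<dots> \<le> X powr \<epsilon> * (C * real (\<Prod>(prime_factors Q)) powr \<epsilon>)"
      by (intro mult_left_mono C(2)) auto
    also have "\<dots> \<le> X powr \<epsilon> * (C * real Q powr \<epsilon>)"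
      using C(1) le assms by (intro mult_left_mono powr_mono2) (auto simp del: of_nat_prod)
    finally show "real (card (smooth_upto (prime_factors Q) X)) \<le> C * (X * real Q) powr \<epsilon>"
      using X by (simp add: powr_mult mult_ac)
  qed
qed

text \<open>The case X = Q = n, since a divisor of n is composed of primes of n; X * Q = n^2
  explains the halved exponent.\<close>

lemma divisor_count:
  fixes \<epsilon> :: real
  assumes "\<epsilon> > 0"
  obtains C where "C > 0" "\<And>n. n > 0 \<Longrightarrow> real (card {d::nat. d dvd n}) \<le> C * real n powr \<epsilon>"
proof -
  obtain C where C: "C > 0"
    "\<And>Q X. Q > 0 \<Longrightarrow> X > 0 \<Longrightarrow> real (card (smooth_upto (prime_factors Q) X)) \<le> C * (X * real Q) powr (\<epsilon> / 2)"
    using smooth_count[of "\<epsilon> / 2"] assms by auto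
  show thesis
  proof (rule that[OF C(1)])
    fix n :: nat assume n: "n > 0"
    have "{d. d dvd n} \<subseteq> smooth_upto (prime_factors n) n"
      using n by (auto simp: smooth_upto_def dvd_imp_le dvd_pos_nat in_prime_factors_iff intro: dvd_trans)
    then have "card {d. d dvd n} \<le> card (smooth_upto (prime_factors n) n)"
      by (intro card_mono) auto
    then have "real (card {d. d dvd n}) \<le> real (card (smooth_upto (prime_factors n) n))" by simp
    also have "\<dots> \<le> C * (real n * real n) powr (\<epsilon> / 2)" using n by (intro C) auto
    also have "(real n * real n) powr (\<epsilon> / 2) = real n powr \<epsilon>"
      using n by (simp add: powr_mult flip: powr_add)
    finally show "real (card {d. d dvd n}) \<le> C * real n powr \<epsilon>" .
  qed
qed

section \<open>Representations by binary quadratic forms\<close>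

definition quad_sols :: "int \<Rightarrow> int \<Rightarrow> real \<Rightarrow> (int \<times> int) set" where
  "quad_sols D m M = {(x, y). x\<^sup>2 + D * y\<^sup>2 = m \<and> \<bar>of_int x\<bar> \<le> M \<and> \<bar>of_int y\<bar> \<le> M}"

lemma finite_int_abs_le [simp]: "finite {x::int. \<bar>of_int x\<bar> \<le> (M::real)}"
proof (rule finite_subset)
  show "{x::int. \<bar>of_int x\<bar> \<le> M} \<subseteq> {-\<lfloor>M\<rfloor>..\<lfloor>M\<rfloor>}"
    by (auto simp: abs_le_iff le_floor_iff) linarith
qed auto

lemma finite_quad_sols [simp]: "finite (quad_sols D m M)"
  by (rule finite_subset[of _ "{x::int. \<bar>of_int x\<bar> \<le> M} \<times> {x::int. \<bar>of_int x\<bar> \<le> M}"])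
    (auto simp: quad_sols_def)

text \<open>In terms of x + y * sqrt (- D), the pair (\<open>A s\<close>, \<open>N s\<close>) is the
  product of s with the conjugate of a fixed solution. Its norm is m^2, and j = 2 *
  \<open>N s\<close> / m is an integer with D * j^2 <= 4, so that j takes at most five values;
  together with the sign of \<open>A s\<close> this gives 10.\<close>

lemma card_definite_class:
  fixes D m :: int
  assumes "D > 0" "m \<noteq> 0"
    and sol: "\<And>x y. (x, y) \<in> S \<Longrightarrow> x\<^sup>2 + D * y\<^sup>2 = m"
    and cls: "\<And>x y x' y'. (x, y) \<in> S \<Longrightarrow> (x', y') \<in> S \<Longrightarrow> m dvd 2 * (x * y' - x' * y)"
  shows "card S \<le> 10"
proof (cases "S = {}")
  case False
  then obtain x0 y0 where s0: "(x0, y0) \<in> S" by auto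
  define N where "N = (\<lambda>(x, y). x0 * y - x * y0)"
  define A where "A = (\<lambda>(x, y). x0 * x + D * y0 * y)"
  define \<phi> where "\<phi> s = (2 * N s div m, A s \<ge> 0)" for s
  have norm: "(A s)\<^sup>2 + D * (N s)\<^sup>2 = m\<^sup>2" if "s \<in> S" for s
  proof -
    obtain x y where s: "s = (x, y)" by (cases s)
    have "(A s)\<^sup>2 + D * (N s)\<^sup>2 = (x0\<^sup>2 + D * y0\<^sup>2) * (x\<^sup>2 + D * y\<^sup>2)"
      unfolding s A_def N_def by (simp add: power2_eq_square algebra_simps)
    also have "\<dots> = m\<^sup>2"
      using sol[OF s0] sol[of x y] that s by (simp add: power2_eq_square)
    finally show ?thesis .
  qed
  have Nm: "2 * N s = m * (2 * N s div m)" if "s \<in> S" for s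
    using cls[OF s0, of "fst s" "snd s"] that by (simp add: N_def case_prod_beta)
  have "inj_on \<phi> S"
  proof (rule inj_onI)
    fix s t assume st: "s \<in> S" "t \<in> S" "\<phi> s = \<phi> t"
    have N: "N s = N t" using Nm[OF st(1)] Nm[OF st(2)] st(3) by (simp add: \<phi>_def)
    have "(A s)\<^sup>2 = (A t)\<^sup>2" using norm[OF st(1)] norm[OF st(2)] N by simp
    then have A: "A s = A t" using st(3) by (auto simp: \<phi>_def power2_eq_iff)
    \<comment> \<open>Multiplying by the fixed solution undoes the multiplication by its conjugate,
      up to the factor m.\<close>
    have rec: "m * fst u = x0 * A u - D * y0 * N u \<and> m * snd u = y0 * A u + x0 * N u" for u
      unfolding sol[OF s0, symmetric] A_def N_def by (cases u) (simp add: power2_eq_square algebra_simps)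
    have "m * fst s = m * fst t" "m * snd s = m * snd t"
      using rec[of s] rec[of t] N A by simp_all
    then show "s = t" using assms(2) by (simp add: prod_eq_iff)
  qed
  moreover have "\<phi> ` S \<subseteq> {-2..2} \<times> UNIV"
  proof
    fix u assume "u \<in> \<phi> ` S"
    then obtain s where s: "s \<in> S" "u = \<phi> s" by auto
    define j where "j = 2 * N s div m"
    have "(m * j)\<^sup>2 = (2 * N s)\<^sup>2" unfolding j_def by (simp only: Nm[OF s(1), symmetric])
    then have "m\<^sup>2 * (D * j\<^sup>2) = 4 * (D * (N s)\<^sup>2)"
      by (simp add: power_mult_distrib)
    also have "\<dots> \<le> m\<^sup>2 * 4" using norm[OF s(1)] by (smt (verit) zero_le_power2)
    finally have "D * j\<^sup>2 \<le> 4" using assms(2) by simp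
    moreover have "1 * j\<^sup>2 \<le> D * j\<^sup>2" using assms(1) by (intro mult_right_mono) auto
    ultimately have "j\<^sup>2 \<le> 2\<^sup>2" by simp
    then have "\<bar>j\<bar> \<le> 2" using abs_le_square_iff[of j 2] by simp
    then show "u \<in> {-2..2} \<times> UNIV" using s(2) by (auto simp: \<phi>_def j_def)
  qed
  ultimately have "card S \<le> card ({-2..2::int} \<times> (UNIV :: bool set))"
    by (intro card_inj_on_le) auto
  also have "\<dots> = 10" by (simp add: card_cartesian_product)
  finally show ?thesis .
qed auto

text \<open>
  Two solutions of the same class differ by a unit \<open>\<rho>\<close> of norm 1 with \<open>\<rho> - 1 / \<rho> = j * sqrt E\<close> and
  \<open>j\<close> an integer, so that their sizes differ by a factor of at least \<open>3 / 2\<close>.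
\<close>

lemma card_indefinite_class:
  fixes E m :: int and M :: real
  assumes E: "E > 0" and m: "m \<noteq> 0" and M: "M \<ge> 1"
    and sol: "\<And>x y. (x, y) \<in> S \<Longrightarrow> (x, y) \<in> quad_sols (- E) m M"
    and cls: "\<And>x y x' y'. (x, y) \<in> S \<Longrightarrow> (x', y') \<in> S \<Longrightarrow> m dvd 2 * (x * y' - x' * y)"
    and pos: "\<And>x y. (x, y) \<in> S \<Longrightarrow> of_int x + of_int y * sqrt E > 0"
  shows "real (card S) \<le> 2 * ln (M * (1 + E)) / ln (3 / 2) + 3"
proof -
  define \<theta> where "\<theta> = (\<lambda>(x, y). of_int x + of_int y * sqrt E :: real)"
  define \<eta> where "\<eta> = (\<lambda>(x, y). of_int x - of_int y * sqrt E :: real)"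
  have sqE: "sqrt E * sqrt E = E" "sqrt E \<ge> 1" using E by auto
  have norm: "\<theta> s * \<eta> s = m" if "s \<in> S" for s
  proof -
    obtain x y where s: "s = (x, y)" by (cases s)
    have "\<theta> s * \<eta> s = of_int x * of_int x - of_int y * of_int y * (sqrt E * sqrt E)"
      by (simp add: s \<theta>_def \<eta>_def algebra_simps)
    also have "\<dots> = of_int (x\<^sup>2 + (- E) * y\<^sup>2)" using E by (simp add: power2_eq_square)
    also have "x\<^sup>2 + (- E) * y\<^sup>2 = m" using sol[of x y] that s by (simp add: quad_sols_def)
    finally show ?thesis .
  qed
  have pos': "\<theta> s > 0" if "s \<in> S" for s using pos[of "fst s" "snd s"] that by (simp add: \<theta>_def case_prod_beta)
  have gap: "\<theta> t \<ge> 3 / 2 * \<theta> s" if st: "s \<in> S" "t \<in> S" "\<theta> s < \<theta> t" for s t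
  proof -
    obtain x y x' y' where s: "s = (x, y)" "t = (x', y')" by (cases s, cases t)
    obtain j where j: "2 * (x * y' - x' * y) = m * j" using cls[of x y x' y'] st s by auto
    define \<rho> where "\<rho> = \<theta> t / \<theta> s"
    have \<rho>: "\<rho> > 1" using st(3) pos'[OF st(1)] by (simp add: \<rho>_def)
    have e: "\<eta> s = m / \<theta> s" "\<eta> t = m / \<theta> t"
      using norm[OF st(1)] norm[OF st(2)] pos'[OF st(1)] pos'[OF st(2)] by (auto simp: field_simps)
    have "\<theta> t * \<eta> s - \<theta> s * \<eta> t = of_int (2 * (x * y' - x' * y)) * sqrt E"
      by (simp add: s \<theta>_def \<eta>_def algebra_simps)
    also have "\<dots> = m * (j * sqrt E)" unfolding j by simp
    finally have "m * (\<rho> - 1 / \<rho>) = m * (j * sqrt E)"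
      by (simp add: e \<rho>_def right_diff_distrib mult.commute)
    then have *: "\<rho> - 1 / \<rho> = j * sqrt E" using m by simp
    have "1 / \<rho> < 1" using \<rho> by simp
    then have "j * sqrt E > 0" using * \<rho> by linarith
    then have "j > 0" using sqE(2) by (simp add: zero_less_mult_iff)
    then have "1 * 1 \<le> j * sqrt E" using sqE(2) by (intro mult_mono) auto
    then have r1: "\<rho> - 1 / \<rho> \<ge> 1" using * by simp
    \<comment> \<open>Otherwise \<open>\<rho> - 1 / \<rho>\<close> would be below 3 / 2 - 2 / 3 = 5
      / 6.\<close>
    have "\<rho> \<ge> 3 / 2"
    proof (rule ccontr)
      assume "\<not> \<rho> \<ge> 3 / 2"
      then have "\<rho> < 3 / 2" by simp
      then have "1 / \<rho> > 2 / 3" using \<rho> by (simp add: field_simps)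
      then show False using r1 \<open>\<rho> < 3 / 2\<close> by linarith
    qed
    then show ?thesis using pos'[OF st(1)] by (simp add: \<rho>_def field_simps)
  qed
  define \<phi> where "\<phi> s = \<lfloor>ln (\<theta> s) / ln (3 / 2)\<rfloor>" for s
  have l: "ln (3 / 2 :: real) > 0" by simp
  have lt: "\<phi> s < \<phi> t" if st: "s \<in> S" "t \<in> S" "\<theta> s < \<theta> t" for s t
  proof -
    have "ln (3 / 2 * \<theta> s) \<le> ln (\<theta> t)" using gap[OF st] pos'[OF st(1)] by (intro ln_mono) auto
    then have "ln (3 / 2) + ln (\<theta> s) \<le> ln (\<theta> t)"
      using pos'[OF st(1)] by (subst (asm) ln_mult) auto
    then have "(ln (3 / 2) + ln (\<theta> s)) / ln (3 / 2) \<le> ln (\<theta> t) / ln (3 / 2)"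
      using l by (intro divide_right_mono) auto
    then have "1 + ln (\<theta> s) / ln (3 / 2) \<le> ln (\<theta> t) / ln (3 / 2)"
      using l by (simp add: add_divide_distrib)
    then show ?thesis unfolding \<phi>_def by linarith
  qed
  have inj: "inj_on \<phi> S"
  proof (rule inj_onI)
    fix s t assume st: "s \<in> S" "t \<in> S" "\<phi> s = \<phi> t"
    then have "\<theta> s = \<theta> t" using lt[of s t] lt[of t s] by (cases "\<theta> s" "\<theta> t" rule: linorder_cases) auto
    moreover from this have "\<theta> t * \<eta> s = \<theta> t * \<eta> t" using norm[OF st(1)] norm[OF st(2)] by simp
    then have "\<eta> s = \<eta> t" using pos'[OF st(2)] by simp
    ultimately have eq: "\<theta> s = \<theta> t" "\<eta> s = \<eta> t" by auto
    obtain x y x' y' where xy: "s = (x, y)" "t = (x', y')" by (cases s, cases t)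
    have "of_int y * sqrt E = of_int y' * sqrt E" "real_of_int x = of_int x'"
      using eq unfolding \<theta>_def \<eta>_def xy prod.case by linarith+
    then show "s = t" using E by (simp add: xy)
  qed
  define L where "L = M * (1 + E)"
  have L1: "L \<ge> 1" using M E mult_mono[of 1 M 1 "1 + real_of_int E"] by (simp add: L_def)
  have sqE_le: "sqrt E \<le> E" using E real_sqrt_le_mono[of E "E * E"] by simp
  have bd: "\<bar>\<theta> s\<bar> \<le> L \<and> \<bar>\<eta> s\<bar> \<le> L" if "s \<in> S" for s
  proof -
    obtain x y where s: "s = (x, y)" by (cases s)
    have xy: "\<bar>of_int x\<bar> \<le> M" "\<bar>of_int y\<bar> \<le> M" using sol[of x y] that s by (auto simp: quad_sols_def)
    have "\<bar>of_int y * sqrt E\<bar> \<le> M * E"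
      unfolding abs_mult using xy(2) sqE_le M sqE(2) by (intro mult_mono) auto
    then show ?thesis using xy(1) by (auto simp: s \<theta>_def \<eta>_def L_def algebra_simps)
  qed
  define R where "R = ln L / ln (3 / 2)"
  have "\<phi> ` S \<subseteq> {\<lfloor>-R\<rfloor>..\<lfloor>R\<rfloor>}"
  proof
    fix u assume "u \<in> \<phi> ` S"
    then obtain s where s: "s \<in> S" "u = \<phi> s" by auto
    have "ln (\<theta> s) \<le> ln L" using bd[OF s(1)] pos'[OF s(1)] by (intro ln_mono) auto
    then have "ln (\<theta> s) / ln (3 / 2) \<le> R" unfolding R_def using l by (intro divide_right_mono) auto
    \<comment> \<open>The lower bound for \<open>\<theta> s\<close> comes from its conjugate: their
      product is m, of absolute value at least 1, while the conjugate is at most L in absolute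
      value.\<close>
    moreover have "1 \<le> \<bar>real_of_int m\<bar>" using m by linarith
    then have "1 \<le> \<theta> s * \<bar>\<eta> s\<bar>" using norm[OF s(1)] pos'[OF s(1)] by (metis abs_mult abs_of_pos)
    then have "1 \<le> \<theta> s * L"
      using bd[OF s(1)] pos'[OF s(1)] mult_left_mono[of "\<bar>\<eta> s\<bar>" L "\<theta> s"] by linarith
    then have "1 / L \<le> \<theta> s" using L1 by (simp add: field_simps)
    then have "ln (1 / L) \<le> ln (\<theta> s)" using L1 by (intro ln_mono) auto
    then have "- ln L \<le> ln (\<theta> s)" using L1 by (simp add: ln_div)
    then have "- R \<le> ln (\<theta> s) / ln (3 / 2)" unfolding R_def minus_divide_left
      using l by (intro divide_right_mono) auto
    ultimately show "u \<in> {\<lfloor>-R\<rfloor>..\<lfloor>R\<rfloor>}" by (auto simp: s(2) \<phi>_def intro: floor_mono)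
  qed
  then have "card S \<le> card {\<lfloor>-R\<rfloor>..\<lfloor>R\<rfloor>}"
    by (intro card_inj_on_le[OF inj]) auto
  moreover have "R \<ge> 0" using L1 l by (simp add: R_def)
  then have "real (card {\<lfloor>-R\<rfloor>..\<lfloor>R\<rfloor>}) \<le> 2 * R + 3" by (simp, linarith)
  ultimately show ?thesis unfolding R_def L_def by linarith
qed

text \<open>For negative D = - E the solutions are split by the sign of x + y * sqrt E, and one half
  is negated. The value zero is impossible since it would give m = 0; this argument also covers
  square E.\<close>

lemma card_quad_class:
  fixes D m :: int and M :: real
  assumes "D \<noteq> 0" "m \<noteq> 0" "M \<ge> 1" "S \<subseteq> quad_sols D m M"
    and cls: "\<And>x y x' y'. (x, y) \<in> S \<Longrightarrow> (x', y') \<in> S \<Longrightarrow> m dvd 2 * (x * y' - x' * y)"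
  shows "real (card S) \<le> 4 * ln (M * (1 + \<bar>D\<bar>)) / ln (3 / 2) + 10"
proof (cases "D > 0")
  case True
  have "card S \<le> 10"
    using True assms by (intro card_definite_class[of D m]) (auto simp: quad_sols_def)
  moreover have "1 \<le> M * (1 + \<bar>D\<bar>)"
    using assms mult_mono[of 1 M 1 "1 + \<bar>real_of_int D\<bar>"] by simp
  then have "0 \<le> 4 * ln (M * (1 + \<bar>D\<bar>)) / ln (3 / 2)" by simp
  ultimately show ?thesis by linarith
next
  case False
  define E where "E = - D"
  have E: "E > 0" "D = - E" "\<bar>D\<bar> = E" using False assms(1) by (auto simp: E_def)
  define \<theta> where "\<theta> = (\<lambda>(x, y). of_int x + of_int y * sqrt E :: real)"
  define n where "n = (\<lambda>(x::int, y::int). (- x, - y))"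
  define S1 where "S1 = {s \<in> S. \<theta> s > 0}"
  define S2 where "S2 = {s \<in> S. \<theta> s < 0}"
  have fin: "finite S" using assms(4) finite_quad_sols by (rule finite_subset)
  have "S \<subseteq> S1 \<union> S2"
  proof
    fix s assume s: "s \<in> S"
    obtain x y where xy: "s = (x, y)" by (cases s)
    have "\<theta> s \<noteq> 0"
    proof
      assume "\<theta> s = 0"
      then have "of_int x = - (of_int y * sqrt E)" by (simp add: \<theta>_def xy)
      then have "(of_int x :: real)\<^sup>2 = of_int y ^ 2 * E"
        using E(1) by (simp add: power_mult_distrib)
      then have "real_of_int (x\<^sup>2) = real_of_int (y\<^sup>2 * E)" by simp
      then have "x\<^sup>2 = y\<^sup>2 * E" by (simp only: of_int_eq_iff)
      then show False using s xy assms(2,4) E by (auto simp: quad_sols_def)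
    qed
    then show "s \<in> S1 \<union> S2" using s by (auto simp: S1_def S2_def)
  qed
  then have "card S \<le> card (S1 \<union> S2)"
    using fin by (intro card_mono) (auto simp: S1_def S2_def)
  also have "\<dots> \<le> card S1 + card S2" by (rule card_Un_le)
  finally have "card S \<le> card S1 + card S2" .
  moreover have "card (n ` S2) = card S2"
    by (intro card_image) (auto simp: inj_on_def n_def)
  moreover have "real (card S1) \<le> 2 * ln (M * (1 + E)) / ln (3 / 2) + 3"
    using assms E by (intro card_indefinite_class[of E m M S1]) (auto simp: S1_def \<theta>_def)
  moreover have "real (card (n ` S2)) \<le> 2 * ln (M * (1 + E)) / ln (3 / 2) + 3"
  proof (rule card_indefinite_class[of E m M "n ` S2"])
    show "m dvd 2 * (x * y' - x' * y)" if "(x, y) \<in> n ` S2" "(x', y') \<in> n ` S2" for x y x' y'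
    proof -
      have "(- x, - y) \<in> S" "(- x', - y') \<in> S" using that by (auto simp: n_def S2_def)
      then show ?thesis using cls[of "- x" "- y" "- x'" "- y'"] by simp
    qed
    show "(x, y) \<in> quad_sols (- E) m M" if "(x, y) \<in> n ` S2" for x y
    proof -
      have "(- x, - y) \<in> S" using that by (auto simp: n_def S2_def)
      then have "(- x, - y) \<in> quad_sols D m M" using assms(4) by auto
      then show ?thesis using E(2) by (simp add: quad_sols_def)
    qed
  qed (use assms E in \<open>auto simp: S2_def \<theta>_def n_def\<close>)
  ultimately show ?thesis unfolding E(3) by simp
qed

lemma card_le_card_keys:
  fixes c :: real
  assumes "finite S" "key ` S \<subseteq> K" "finite K"
    and "\<And>k. k \<in> K \<Longrightarrow> real (card {s \<in> S. key s = k}) \<le> c"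
  shows "real (card S) \<le> real (card K) * c"
proof -
  have "S = (\<Union>k\<in>K. {s \<in> S. key s = k})" using assms(2) by auto
  then have "card S \<le> (\<Sum>k\<in>K. card {s \<in> S. key s = k})"
    using card_UN_le[OF assms(3), of "\<lambda>k. {s \<in> S. key s = k}"] by simp
  then have "real (card S) \<le> (\<Sum>k\<in>K. real (card {s \<in> S. key s = k}))"
    by (metis of_nat_mono of_nat_sum)
  also have "\<dots> \<le> (\<Sum>k\<in>K. c)" by (intro sum_mono assms)
  finally show ?thesis by simp
qed

text \<open>The lcm of d and e divides N, and up to sign d * e is their lcm times their gcd.\<close>

lemma dvd_double_of_common:
  fixes d e N :: int
  assumes "d dvd N" "e dvd N" "gcd d e dvd 2"
  shows "d * e dvd 2 * N"
proof -
  have "e * d dvd N * d" "d * e dvd N * e" using assms(1,2) by (auto intro: mult_dvd_mono)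
  then have "d * e dvd gcd (N * d) (N * e)" by (simp add: mult.commute)
  also have "\<dots> = gcd d e * \<bar>N\<bar>" by (simp add: gcd_mult_distrib_int[symmetric] mult.commute)
  also have "\<dots> dvd gcd d e * N" by (rule mult_dvd_mono) auto
  finally have "d * e dvd gcd d e * N" .
  also have "\<dots> dvd 2 * N" using assms(3) by (rule mult_dvd_mono) simp
  finally show ?thesis .
qed

text \<open>
  Fixing one solution \<open>(x0, y0)\<close>, the class of a solution \<open>(x, y)\<close> is \<open>gcd (x * y0 - x0 * y) m\<close>, which plays
  the role of the ideal generated by \<open>x + y * sqrt (- D)\<close> and \<open>m\<close>.
\<close>

lemma card_coprime_quad_sols:
  fixes D m :: int and M :: real
  assumes D: "squarefree D" and m: "m \<noteq> 0" and M: "M \<ge> 1"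
  defines "S \<equiv> {s \<in> quad_sols D m M. coprime (fst s) (snd s)}"
  shows "real (card S) \<le> real (card {d. d dvd nat \<bar>m\<bar>}) * (4 * ln (M * (1 + \<bar>D\<bar>)) / ln (3 / 2) + 10)"
proof (cases "S = {}")
  case True
  have "1 \<le> M * (1 + \<bar>D\<bar>)"
    using M mult_mono[of 1 M 1 "1 + \<bar>real_of_int D\<bar>"] by simp
  then show ?thesis using True by simp
next
  case False
  have D0: "D \<noteq> 0" using D by auto
  from False obtain x0 y0 where s0: "(x0, y0) \<in> S" by auto
  have sol: "x\<^sup>2 + D * y\<^sup>2 = m" "coprime x y" if "(x, y) \<in> S" for x y
    using that by (auto simp: S_def quad_sols_def)
  have cop: "coprime y m" if "(x, y) \<in> S" for x y
  proof (rule coprimeI)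
    fix c assume c: "c dvd y" "c dvd m"
    then have "c dvd D * y\<^sup>2" by (simp add: power2_eq_square)
    then have "c dvd m - D * y\<^sup>2" using c(2) by (rule dvd_diff[rotated])
    also have "m - D * y\<^sup>2 = x\<^sup>2" using sol(1)[OF that] by simp
    finally have "c dvd x\<^sup>2" .
    moreover have "coprime (x\<^sup>2) y" using sol(2)[OF that] by simp
    ultimately show "is_unit c" using c(1) by (meson coprime_common_divisor)
  qed
  define u where "u = (\<lambda>(x, y). x * y0 - x0 * y)"
  define v where "v = (\<lambda>(x, y). x * y0 + x0 * y)"
  define key where "key s = nat (gcd (u s) m)" for s
  \<comment> \<open>Subtracting the equations of the two solutions gives u * v = m * (y0^2 - y^2).
    The cofactor of \<open>gcd (u s) m\<close> in m is coprime to u divided by this gcd, so it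
    divides v: thus m splits into a part dividing u and a part dividing v.\<close>
  have fac: "m = int (key s) * (m div int (key s))" "int (key s) dvd u s" "m div int (key s) dvd v s"
    if "s \<in> S" for s
  proof -
    have k: "int (key s) = gcd (u s) m" by (simp add: key_def)
    show "m = int (key s) * (m div int (key s))" "int (key s) dvd u s" by (simp_all add: k)
    obtain x y where s: "s = (x, y)" by (cases s)
    have "u s * v s = x\<^sup>2 * y0\<^sup>2 - x0\<^sup>2 * y\<^sup>2" by (simp add: s u_def v_def power2_eq_square algebra_simps)
    also have "x\<^sup>2 = m - D * y\<^sup>2" using sol(1)[of x y] that s by simp
    also have "x0\<^sup>2 = m - D * y0\<^sup>2" using sol(1)[OF s0] by simp
    also have "(m - D * y\<^sup>2) * y0\<^sup>2 - (m - D * y0\<^sup>2) * y\<^sup>2 = m * (y0\<^sup>2 - y\<^sup>2)" by (simp add: algebra_simps)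
    finally have "m dvd u s * v s" by simp
    moreover have g0: "gcd (u s) m \<noteq> 0" using m by simp
    ultimately have "gcd (u s) m * (m div gcd (u s) m) dvd gcd (u s) m * (u s div gcd (u s) m * v s)"
      by (simp add: mult.assoc[symmetric])
    then have "m div gcd (u s) m dvd u s div gcd (u s) m * v s" using g0 dvd_mult_cancel_left by blast
    moreover have "coprime (m div gcd (u s) m) (u s div gcd (u s) m)"
      using div_gcd_coprime[of "u s" m] m by (metis coprime_commute)
    ultimately show "m div int (key s) dvd v s" unfolding k by (simp add: coprime_dvd_mult_right_iff)
  qed
  \<comment> \<open>Here squarefreeness enters. A common factor g of the two parts divides v - u = 2
    * x0 * y and is prime to y, so it divides 2 * x0, and its square divides m. A factor h of x0
    with h^2 dividing m has h^2 dividing D * y0^2 with h prime to y0, hence h^2 divides D and h is a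
    unit. Only a factor 2 can survive.\<close>
  have g2: "gcd (int (key s)) (m div int (key s)) dvd 2" if "s \<in> S" for s
  proof -
    obtain x y where s: "s = (x, y)" by (cases s)
    define g where "g = gcd (int (key s)) (m div int (key s))"
    have gg: "g * g dvd m"
      by (subst fac(1)[OF that]) (auto simp: g_def intro: mult_dvd_mono)
    then have gm: "g dvd m" by (metis dvd_mult_left)
    have gu: "g dvd u s" "g dvd v s"
      using fac[OF that] by (auto simp: g_def intro: dvd_trans[OF gcd_dvd1] dvd_trans[OF gcd_dvd2])
    have "g dvd v s - u s" using gu by simp
    then have "g dvd 2 * x0 * y" by (simp add: u_def v_def s algebra_simps)
    moreover have "coprime g y" using cop[of x y] gm that s by (metis coprime_commute coprime_divisors dvd_refl)
    ultimately have g2x: "g dvd 2 * x0" by (simp add: coprime_dvd_mult_left_iff)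
    have key: "is_unit h" if h: "h dvd x0" "h * h dvd m" for h
    proof -
      have "h * h dvd x0\<^sup>2" using h(1) by (simp add: power2_eq_square mult_dvd_mono)
      then have "h * h dvd m - x0\<^sup>2" using h(2) by simp
      also have "m - x0\<^sup>2 = D * y0\<^sup>2" using sol(1)[OF s0] by simp
      finally have "h * h dvd D * y0\<^sup>2" .
      moreover have "h dvd m" using h(2) by (metis dvd_mult_left)
      then have "coprime h y0" using cop[OF s0] by (metis coprime_commute coprime_divisors dvd_refl)
      then have "coprime (h * h) (y0\<^sup>2)" by simp
      ultimately have "h\<^sup>2 dvd D" by (simp add: coprime_dvd_mult_left_iff power2_eq_square)
      then show ?thesis using D by (simp add: squarefree_def)
    qed
    have "g dvd 2"
    proof (cases "even g")
      case True
      then obtain h where h: "g = 2 * h" by auto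
      then have "h dvd x0" using g2x by simp
      moreover have "h * h dvd m" using gg h by (metis dvd_mult_left dvd_trans dvd_triv_right mult.assoc mult.commute)
      ultimately have "is_unit h" by (rule key)
      then show ?thesis using h by (metis dvd_refl mult.right_neutral mult_dvd_mono)
    next
      case False
      then have "coprime g 2" by simp
      then have "g dvd x0" using g2x by (simp add: coprime_dvd_mult_right_iff)
      then have "is_unit g" using gg by (rule key)
      then show ?thesis by (metis dvd_trans one_dvd)
    qed
    then show ?thesis by (simp add: g_def)
  qed
  show ?thesis
  proof (rule card_le_card_keys)
    show "finite S" by (simp add: S_def)
    show "finite {d. d dvd nat \<bar>m\<bar>}" using m by (intro finite_divisors_nat) simp
    show "key ` S \<subseteq> {d. d dvd nat \<bar>m\<bar>}"
    proof
      fix k assume "k \<in> key ` S"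
      then obtain s where "s \<in> S" "k = key s" by auto
      then have "int k dvd m" using fac(1) by (metis dvd_triv_left)
      then show "k \<in> {d. d dvd nat \<bar>m\<bar>}" by (simp add: int_dvd_int_iff[symmetric])
    qed
    fix k assume "k \<in> {d. d dvd nat \<bar>m\<bar>}"
    show "real (card {s \<in> S. key s = k}) \<le> 4 * ln (M * (1 + \<bar>D\<bar>)) / ln (3 / 2) + 10"
    proof (rule card_quad_class[OF D0 m M])
      show "{s \<in> S. key s = k} \<subseteq> quad_sols D m M" by (auto simp: S_def)
      fix x1 y1 x2 y2 assume "(x1, y1) \<in> {s \<in> S. key s = k}" "(x2, y2) \<in> {s \<in> S. key s = k}"
      then have s: "(x1, y1) \<in> S" "(x2, y2) \<in> S" and k: "key (x1, y1) = k" "key (x2, y2) = k" by auto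
      let ?N = "x1 * y2 - x2 * y1"
      let ?e = "m div int k"
      have mk: "m = int k * ?e" using fac(1)[OF s(1)] k by simp
      then have cop': "coprime (int k) y0" "coprime ?e y0"
        using cop[OF s0] by (metis coprime_commute coprime_mult_right_iff)+
      \<comment> \<open>The determinant of two solutions, times y0, is a combination of their values
        of u, which vanish modulo k, and also of their values of v, which vanish modulo the
        cofactor; y0 is a unit modulo both.\<close>
      have "y0 * ?N = y2 * u (x1, y1) - y1 * u (x2, y2)" by (simp add: u_def algebra_simps)
      then have "int k dvd y0 * ?N" using fac(2)[OF s(1)] fac(2)[OF s(2)] k by simp
      then have "int k dvd ?N" using cop'(1) by (simp add: coprime_dvd_mult_right_iff)
      moreover have "y0 * ?N = y2 * v (x1, y1) - y1 * v (x2, y2)" by (simp add: v_def algebra_simps)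
      then have "?e dvd y0 * ?N" using fac(3)[OF s(1)] fac(3)[OF s(2)] k by simp
      then have "?e dvd ?N" using cop'(2) by (simp add: coprime_dvd_mult_right_iff)
      moreover have "gcd (int k) ?e dvd 2" using g2[OF s(1)] k by simp
      ultimately have "int k * ?e dvd 2 * ?N" by (rule dvd_double_of_common)
      then show "m dvd 2 * ?N" using mk by simp
    qed
  qed
qed

text \<open>The square of k = gcd x y divides m, and division by k leaves a coprime solution for m /
  k^2. One factor t counts the k, the other the classes; t bounds the divisor function on a whole
  range because m / k^2 varies.\<close>

lemma card_squarefree_quad_sols:
  fixes D m :: int and M :: real
  assumes D: "squarefree D" and m: "m \<noteq> 0" and M: "M \<ge> 1"
    and \<tau>: "\<And>n. n > 0 \<Longrightarrow> n \<le> nat \<bar>m\<bar> \<Longrightarrow> real (card {d. d dvd n}) \<le> t"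
  shows "real (card (quad_sols D m M)) \<le> t * (t * (4 * ln (M * (1 + \<bar>D\<bar>)) / ln (3 / 2) + 10))"
proof -
  define L where "L = 4 * ln (M * (1 + \<bar>D\<bar>)) / ln (3 / 2) + 10"
  have "1 \<le> M * (1 + \<bar>D\<bar>)"
    using M mult_mono[of 1 M 1 "1 + \<bar>real_of_int D\<bar>"] by simp
  then have L: "L \<ge> 0" by (simp add: L_def)
  define key where "key s = nat (gcd (fst s) (snd s))" for s :: "int \<times> int"
  have "real (card (quad_sols D m M)) \<le> real (card {d. d dvd nat \<bar>m\<bar>}) * (t * L)"
  proof (rule card_le_card_keys)
    show "finite {d. d dvd nat \<bar>m\<bar>}" using m by (intro finite_divisors_nat) simp
    have dd: "int (key s) * int (key s) dvd m" if "s \<in> quad_sols D m M" for s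
    proof -
      obtain x y where s: "s = (x, y)" by (cases s)
      have "int (key s) * int (key s) dvd x * x" "int (key s) * int (key s) dvd y * y"
        by (auto simp: key_def s intro: mult_dvd_mono)
      then have "int (key s) * int (key s) dvd x * x + D * (y * y)" by simp
      then show ?thesis using that by (simp add: s quad_sols_def power2_eq_square)
    qed
    show "key ` quad_sols D m M \<subseteq> {d. d dvd nat \<bar>m\<bar>}"
    proof
      fix k assume "k \<in> key ` quad_sols D m M"
      then have "int k dvd m" using dd by (metis (no_types, lifting) dvd_mult_left imageE)
      then show "k \<in> {d. d dvd nat \<bar>m\<bar>}" by (simp add: int_dvd_int_iff[symmetric])
    qed
    fix k assume k: "k \<in> {d. d dvd nat \<bar>m\<bar>}"
    let ?T = "{s \<in> quad_sols D m M. key s = k}"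
    show "real (card ?T) \<le> t * L"
    proof (cases "?T = {}")
      case True
      have "1 \<le> nat \<bar>m\<bar>" using m by linarith
      then have "t \<ge> 0" using \<tau>[of 1] by simp
      then show ?thesis using L unfolding True by simp
    next
      case False
      then obtain s0 where s0: "s0 \<in> quad_sols D m M" "key s0 = k" by auto
      have kk: "int k * int k dvd m" using dd[OF s0(1)] s0(2) by simp
      then have k0: "k > 0" using m by (cases k) auto
      define m' where "m' = m div (int k * int k)"
      have m': "m = int k * int k * m'" using kk by (simp add: m'_def)
      then have m'0: "m' \<noteq> 0" using m by auto
      define S where "S = {s \<in> quad_sols D m' M. coprime (fst s) (snd s)}"
      have "?T \<subseteq> (\<lambda>(x, y). (int k * x, int k * y)) ` S"
      proof
        fix s assume s: "s \<in> ?T"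
        obtain x y where xy: "s = (x, y)" by (cases s)
        have g: "gcd x y = int k" using s xy k0 by (auto simp: key_def)
        define x' y' where "x' = x div int k" and "y' = y div int k"
        have e: "x = int k * x'" "y = int k * y'" using gcd_dvd1[of x y] gcd_dvd2[of x y] unfolding g by (auto simp: x'_def y'_def)
        have "coprime x' y'" using g k0 unfolding x'_def y'_def by (metis div_gcd_coprime gcd_eq_0_iff of_nat_0_eq_iff less_irrefl)
        moreover have "int k * int k * (x'\<^sup>2 + D * y'\<^sup>2) = int k * int k * m'"
        proof -
          have "int k * int k * (x'\<^sup>2 + D * y'\<^sup>2) = x\<^sup>2 + D * y\<^sup>2"
            unfolding e by (simp add: power2_eq_square algebra_simps)
          also have "\<dots> = m" using s by (simp add: xy quad_sols_def)
          also note m'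
          finally show ?thesis .
        qed
        then have "x'\<^sup>2 + D * y'\<^sup>2 = m'" using k0 by simp
        moreover have "\<bar>real_of_int x'\<bar> \<le> M" "\<bar>real_of_int y'\<bar> \<le> M"
        proof -
          have "\<bar>z\<bar> \<le> \<bar>int k * z\<bar>" for z using k0 mult_right_mono[of 1 "int k" "\<bar>z\<bar>"] by (simp add: abs_mult)
          then have "\<bar>x'\<bar> \<le> \<bar>x\<bar>" "\<bar>y'\<bar> \<le> \<bar>y\<bar>" using e by auto
          then have "real_of_int \<bar>x'\<bar> \<le> real_of_int \<bar>x\<bar>" "real_of_int \<bar>y'\<bar> \<le> real_of_int \<bar>y\<bar>"
            by (simp_all only: of_int_le_iff)
          moreover have "\<bar>real_of_int x\<bar> \<le> M" "\<bar>real_of_int y\<bar> \<le> M" using s xy by (auto simp: quad_sols_def)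
          ultimately show "\<bar>real_of_int x'\<bar> \<le> M" "\<bar>real_of_int y'\<bar> \<le> M"
            by auto
        qed
        ultimately have "(x', y') \<in> S" by (simp add: S_def quad_sols_def)
        then show "s \<in> (\<lambda>(x, y). (int k * x, int k * y)) ` S" using xy e by force
      qed
      then have "card ?T \<le> card S"
        by (intro surj_card_le) (auto simp: S_def)
      also have "real (card S) \<le> real (card {d. d dvd nat \<bar>m'\<bar>}) * L"
        unfolding S_def L_def by (intro card_coprime_quad_sols D M m'0)
      also have "\<dots> \<le> t * L"
      proof (intro mult_right_mono \<tau> L)
        have "\<bar>m'\<bar> \<le> \<bar>m\<bar>" using m' m by (metis dvd_imp_le_int dvd_triv_right)
        then show "nat \<bar>m'\<bar> \<le> nat \<bar>m\<bar>" by simp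
      qed (use m'0 in auto)
      finally show ?thesis by simp
    qed
  qed auto
  also have "\<dots> \<le> t * (t * L)"
  proof (intro mult_right_mono \<tau>)
    have "1 \<le> nat \<bar>m\<bar>" using m by linarith
    then have "t \<ge> 0" using \<tau>[of 1] by simp
    then show "0 \<le> t * L" using L by simp
  qed (use m in auto)
  finally show ?thesis by (simp add: L_def)
qed

lemma int_square_times_squarefree:
  fixes D :: int
  assumes "D \<noteq> 0"
  obtains s D' where "D = s\<^sup>2 * D'" "squarefree D'" "s > 0"
proof -
  define A where "A = {s::nat. int s ^ 2 dvd D}"
  have "A \<subseteq> {..nat \<bar>D\<bar>}"
  proof
    fix s assume "s \<in> A"
    then have "int s dvd D" by (auto simp: A_def power2_eq_square intro: dvd_mult_left)
    then have "int s \<le> \<bar>D\<bar>" using assms by (metis dvd_imp_le_int abs_of_nat)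
    then show "s \<in> {..nat \<bar>D\<bar>}" by simp
  qed
  then have fin: "finite A" using finite_subset by blast
  have "1 \<in> A" by (simp add: A_def)
  define s where "s = Max A"
  have s: "s \<in> A" "\<And>r. r \<in> A \<Longrightarrow> r \<le> s" using fin \<open>1 \<in> A\<close> by (auto simp: s_def intro: Max_in)
  have s1: "s \<ge> 1" using s(2)[OF \<open>1 \<in> A\<close>] .
  obtain D' where D': "D = int s ^ 2 * D'" using s(1) by (auto simp: A_def)
  have "squarefree D'"
  proof (rule squarefreeI)
    fix h assume "h\<^sup>2 dvd D'"
    then have "(int s)\<^sup>2 * h\<^sup>2 dvd D" unfolding D' by simp
    then have "int (s * nat \<bar>h\<bar>) ^ 2 dvd D" by (simp add: power_mult_distrib)
    then have "s * nat \<bar>h\<bar> \<in> A" by (simp add: A_def)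
    then have "s * nat \<bar>h\<bar> \<le> s * 1" using s(2) by simp
    then have "nat \<bar>h\<bar> \<le> 1" using s1 by (subst (asm) mult_le_cancel1) auto
    moreover have "h \<noteq> 0" using \<open>h\<^sup>2 dvd D'\<close> D' assms by auto
    ultimately show "is_unit h" by auto
  qed
  then show thesis using that[of "int s" D'] D' s1 by simp
qed

text \<open>Multiplication by a turns the equation into (a * x)^2 + a * b * y^2 = a * n, and the
  square part of a * b is absorbed into y. The point is the uniformity in the coefficients up to M,
  which enter only through divisor functions and a logarithm.\<close>

lemma quad_form_count:
  fixes \<epsilon> :: real
  assumes "\<epsilon> > 0"
  obtains C where "C > 0"
    "\<And>a b n M. a \<noteq> 0 \<Longrightarrow> b \<noteq> 0 \<Longrightarrow> n \<noteq> 0 \<Longrightarrow> M \<ge> 1 \<Longrightarrow> \<bar>of_int a\<bar> \<le> M \<Longrightarrow> \<bar>of_int b\<bar> \<le> M \<Longrightarrow> \<bar>of_int n\<bar> \<le> M \<Longrightarrow>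
      real (card {(x::int, y::int). a * x\<^sup>2 + b * y\<^sup>2 = n \<and> \<bar>of_int x\<bar> \<le> M \<and> \<bar>of_int y\<bar> \<le> M}) \<le> C * M powr \<epsilon>"
proof -
  \<comment> \<open>The two divisor bounds cost the exponent 2 * \<open>\<eta>\<close> each and the
    logarithm 5 * \<open>\<eta>\<close>, together 9 * \<open>\<eta>\<close>.\<close>
  define \<eta> where "\<eta> = \<epsilon> / 20"
  have \<eta>: "\<eta> > 0" using assms by (simp add: \<eta>_def)
  obtain C where C: "C > 0" "\<And>n. n > 0 \<Longrightarrow> real (card {d::nat. d dvd n}) \<le> C * real n powr \<eta>"
    using divisor_count[OF \<eta>] by blast
  define c where "c = 4 / ln (3 / 2 :: real)"
  have c: "c > 0" by (simp add: c_def)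
  define C' where "C' = C * (C * (c * 8 powr \<eta> / \<eta> + 10))"
  show thesis
  proof (rule that[of C'])
    show "C' > 0" using C(1) c \<eta> by (auto simp: C'_def intro!: mult_pos_pos add_pos_pos)
    fix a b n :: int and M :: real
    assume ab: "a \<noteq> 0" "b \<noteq> 0" and n: "n \<noteq> 0" and M: "M \<ge> 1"
      and le: "\<bar>of_int a\<bar> \<le> M" "\<bar>of_int b\<bar> \<le> M" "\<bar>of_int n\<bar> \<le> M"
    define D m where "D = a * b" and "m = a * n"
    have D: "D \<noteq> 0" "\<bar>of_int D\<bar> \<le> M ^ 2"
      using ab le by (auto simp: D_def abs_mult power2_eq_square intro!: mult_mono)
    have m: "m \<noteq> 0" "\<bar>of_int m\<bar> \<le> M ^ 2"
      using ab n le by (auto simp: m_def abs_mult power2_eq_square intro!: mult_mono)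
    obtain s D' where sD: "D = s\<^sup>2 * D'" "squarefree D'" "s > 0"
      using int_square_times_squarefree[OF D(1)] .
    have D'0: "D' \<noteq> 0" using sD D(1) by auto
    have "\<bar>D'\<bar> \<le> \<bar>D\<bar>" using sD D(1) by (metis dvd_imp_le_int dvd_triv_right)
    then have D'le: "\<bar>of_int D'\<bar> \<le> M ^ 2" using D(2) by (metis of_int_abs of_int_le_iff order_trans)
    have "s dvd D" using sD(1) by (simp add: power2_eq_square)
    then have "\<bar>s\<bar> \<le> \<bar>D\<bar>" using D(1) by (simp add: dvd_imp_le_int)
    then have sle: "\<bar>of_int s\<bar> \<le> M ^ 2" using D(2) by (metis of_int_abs of_int_le_iff order_trans)
    let ?A = "{(x::int, y::int). a * x\<^sup>2 + b * y\<^sup>2 = n \<and> \<bar>of_int x\<bar> \<le> M \<and> \<bar>of_int y\<bar> \<le> M}"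
    let ?f = "\<lambda>(x, y). (a * x, s * y)"
    have "card ?A \<le> card (quad_sols D' m (M ^ 3))"
    proof (rule card_inj_on_le)
      show "inj_on ?f ?A" using ab sD(3) by (auto simp: inj_on_def)
      show "?f ` ?A \<subseteq> quad_sols D' m (M ^ 3)"
      proof clarify
        fix x y :: int
        assume xy: "n = a * x\<^sup>2 + b * y\<^sup>2" "\<bar>of_int x\<bar> \<le> M" "\<bar>of_int y\<bar> \<le> M"
        have "(a * x)\<^sup>2 + D' * (s * y)\<^sup>2 = (a * x)\<^sup>2 + D * y\<^sup>2" by (simp add: sD(1) power_mult_distrib)
        also have "\<dots> = m" by (simp add: D_def m_def xy(1) power2_eq_square algebra_simps)
        finally have "(a * x)\<^sup>2 + D' * (s * y)\<^sup>2 = m" .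
        moreover have "\<bar>of_int a\<bar> * \<bar>of_int x\<bar> \<le> M * M" using le xy M by (intro mult_mono) auto
        then have "\<bar>of_int (a * x)\<bar> \<le> M ^ 3"
          using power_increasing[of 2 3 M] M by (simp add: abs_mult power2_eq_square)
        moreover have "\<bar>of_int s\<bar> * \<bar>of_int y\<bar> \<le> M\<^sup>2 * M" using sle xy M by (intro mult_mono) auto
        then have "\<bar>of_int (s * y)\<bar> \<le> M ^ 3" by (simp add: abs_mult power2_eq_square power3_eq_cube)
        ultimately show "(a * x, s * y) \<in> quad_sols D' m (M ^ 3)" by (simp add: quad_sols_def)
      qed
    qed auto
    also define t where "t = C * (M ^ 2) powr \<eta>"
    have M3: "M ^ 3 \<ge> 1" using M by simp
    have "real (card (quad_sols D' m (M ^ 3))) \<le> t * (t * (4 * ln (M ^ 3 * (1 + \<bar>D'\<bar>)) / ln (3 / 2) + 10))"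
    proof (rule card_squarefree_quad_sols[OF sD(2) m(1) M3])
      fix k :: nat assume k: "k > 0" "k \<le> nat \<bar>m\<bar>"
      have "real k \<le> \<bar>of_int m\<bar>" using k(2) by linarith
      then have "real k \<le> M ^ 2" using m(2) by simp
      then have "C * real k powr \<eta> \<le> C * (M ^ 2) powr \<eta>" using C(1) \<eta> by (intro mult_left_mono powr_mono2) auto
      then show "real (card {d. d dvd k}) \<le> t" unfolding t_def using C(2)[OF k(1)] by linarith
    qed
    also have "\<dots> = t * (t * (c * ln (M ^ 3 * (1 + \<bar>D'\<bar>)) + 10))" by (simp add: c_def)
    also have "\<dots> \<le> t * (t * ((c * 8 powr \<eta> / \<eta> + 10) * M powr (5 * \<eta>)))"
    proof (intro mult_left_mono)
      have "1 \<le> M ^ 2" using M by simp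
      then have "1 + \<bar>of_int D'\<bar> \<le> 2 * M ^ 2" using D'le by linarith
      then have "M ^ 3 * (1 + \<bar>of_int D'\<bar>) \<le> M ^ 3 * (8 * M ^ 2)" using M \<open>1 \<le> M ^ 2\<close> by (intro mult_left_mono) auto
      then have b: "M ^ 3 * (1 + \<bar>of_int D'\<bar>) \<le> 8 * M ^ 5" by (simp add: power_add[symmetric] mult_ac)
      have p: "1 \<le> M ^ 3 * (1 + \<bar>of_int D'\<bar>)" using M3 M mult_mono[of 1 "M ^ 3" 1 "1 + \<bar>real_of_int D'\<bar>"] by simp
      have "ln (M ^ 3 * (1 + \<bar>of_int D'\<bar>)) \<le> (M ^ 3 * (1 + \<bar>of_int D'\<bar>)) powr \<eta> / \<eta>"
        using p \<eta> by (rule ln_powr_bound)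
      also have "\<dots> \<le> (8 * M ^ 5) powr \<eta> / \<eta>" using b p \<eta> by (intro divide_right_mono powr_mono2) auto
      also have "(8 * M ^ 5) powr \<eta> = 8 powr \<eta> * M powr (5 * \<eta>)"
      proof -
        have "M ^ 5 = M powr 5" using M by simp
        then show ?thesis using M by (simp only: powr_mult powr_powr)
      qed
      finally have "c * ln (M ^ 3 * (1 + \<bar>D'\<bar>)) \<le> c * (8 powr \<eta> * M powr (5 * \<eta>) / \<eta>)"
        using c by (intro mult_left_mono) auto
      moreover have "1 \<le> M powr (5 * \<eta>)" using M \<eta> by (simp add: ge_one_powr_ge_zero)
      ultimately show "c * ln (M ^ 3 * (1 + \<bar>D'\<bar>)) + 10 \<le> (c * 8 powr \<eta> / \<eta> + 10) * M powr (5 * \<eta>)"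
        by (simp add: algebra_simps)
    qed (use C(1) in \<open>auto simp: t_def\<close>)
    also have "\<dots> = C' * M powr (9 * \<eta>)"
    proof -
      have "M ^ 2 = M powr 2" using M by simp
      then have "(M ^ 2) powr \<eta> = M powr (2 * \<eta>)" by (simp only: powr_powr)
      then have "t * t * M powr (5 * \<eta>) = C * C * (M powr (2 * \<eta>) * M powr (2 * \<eta>) * M powr (5 * \<eta>))"
        by (simp add: t_def)
      also have "M powr (2 * \<eta>) * M powr (2 * \<eta>) * M powr (5 * \<eta>) = M powr (9 * \<eta>)"
        by (simp flip: powr_add)
      finally show ?thesis by (simp add: C'_def mult_ac)
    qed
    also have "\<dots> \<le> C' * M powr \<epsilon>"
      using M \<open>C' > 0\<close> assms by (intro mult_left_mono powr_mono) (auto simp: \<eta>_def)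
    finally show "real (card ?A) \<le> C' * M powr \<epsilon>" by simp
  qed
qed

section \<open>Halving a pair of points\<close>

definition minor :: "int ^ 4 \<Rightarrow> int ^ 4 \<Rightarrow> 4 \<Rightarrow> 4 \<Rightarrow> int" where
  "minor x y i j = x $ i * y $ j - x $ j * y $ i"

definition perm2 :: "int ^ 4 \<Rightarrow> int ^ 4 \<Rightarrow> 4 \<Rightarrow> 4 \<Rightarrow> int" where
  "perm2 x y i j = x $ i * y $ j + x $ j * y $ i"

definition flip1 :: "int ^ 4 \<Rightarrow> int ^ 4" where
  "flip1 y = (\<chi> i. if i = 1 then - y $ i else y $ i)"

section \<open>Separating the primes of \<open>Q\<close> from the others\<close>

definition good_part :: "nat \<Rightarrow> nat \<Rightarrow> nat" where
  "good_part Q n = prod_mset (filter_mset (\<lambda>p. \<not> p dvd Q) (prime_factorization n))"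

definition bad_part :: "nat \<Rightarrow> nat \<Rightarrow> nat" where
  "bad_part Q n = prod_mset (filter_mset (\<lambda>p. p dvd Q) (prime_factorization n))"

lemma bad_part_times_good_part: "n > 0 \<Longrightarrow> bad_part Q n * good_part Q n = n"
  unfolding good_part_def bad_part_def
  by (subst prod_mset.union[symmetric], subst multiset_partition[symmetric])
    (simp add: prod_mset_prime_factorization_nat)

lemma good_part_pos [simp]: "good_part Q n > 0"
  unfolding good_part_def by (rule Nat.gr0I) (auto simp: prod_mset_zero_iff)

lemma multiplicity_good_part:
  assumes "prime p"
  shows "multiplicity p (good_part Q n) = (if p dvd Q then 0 else multiplicity p n)"
proof -
  have "prime_factorization (good_part Q n) = filter_mset (\<lambda>p. \<not> p dvd Q) (prime_factorization n)"
    unfolding good_part_def by (rule prime_factorization_prod_mset_primes) auto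
  then have "count (prime_factorization (good_part Q n)) p = (if p dvd Q then 0 else count (prime_factorization n) p)"
    by simp
  then show ?thesis using assms by (simp add: count_prime_factorization_prime)
qed

lemma multiplicity_gcd_nat:
  fixes a b p :: nat
  assumes "prime p" "a > 0" "b > 0"
  shows "multiplicity p (gcd a b) = min (multiplicity p a) (multiplicity p b)"
proof -
  have "\<not> is_unit p" using assms(1) by auto
  then have *: "n \<le> multiplicity p c \<longleftrightarrow> p ^ n dvd c" if "c > 0" for n c
    using that power_dvd_iff_le_multiplicity[of c p n] by simp
  have "n \<le> multiplicity p (gcd a b) \<longleftrightarrow> n \<le> min (multiplicity p a) (multiplicity p b)" for n
    using assms by (simp add: *)
  then show ?thesis by (meson le_antisym order_refl)
qed

definition gcd6 :: "nat \<Rightarrow> nat \<Rightarrow> nat \<Rightarrow> nat \<Rightarrow> nat \<Rightarrow> nat \<Rightarrow> nat" where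
  "gcd6 a b c d e f = gcd a (gcd b (gcd c (gcd d (gcd e f))))"

definition min6 :: "nat \<Rightarrow> nat \<Rightarrow> nat \<Rightarrow> nat \<Rightarrow> nat \<Rightarrow> nat \<Rightarrow> nat" where
  "min6 a b c d e f = min a (min b (min c (min d (min e f))))"

lemma multiplicity_gcd6:
  assumes "prime p" "a > 0" "b > 0" "c > 0" "d > 0" "e > 0" "f > 0"
  shows "multiplicity p (gcd6 a b c d e f) =
    min6 (multiplicity p a) (multiplicity p b) (multiplicity p c)
      (multiplicity p d) (multiplicity p e) (multiplicity p f)"
  using assms by (simp add: gcd6_def min6_def multiplicity_gcd_nat)

definition gminor :: "nat \<Rightarrow> int ^ 4 \<Rightarrow> int ^ 4 \<Rightarrow> 4 \<Rightarrow> 4 \<Rightarrow> nat" where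
  "gminor Q x y i j = good_part Q (nat \<bar>minor x y i j\<bar>)"

definition gperm :: "nat \<Rightarrow> int ^ 4 \<Rightarrow> int ^ 4 \<Rightarrow> 4 \<Rightarrow> 4 \<Rightarrow> nat" where
  "gperm Q x y i j = good_part Q (nat \<bar>perm2 x y i j\<bar>)"

text \<open>
  Up to signs and bad factors, the coordinates of the half of \<open>x + y\<close>. A prime outside \<open>Q\<close> divides
  \<open>half_coord Q x y i\<close> only if \<open>x\<close> and \<open>y\<close> become projectively equal modulo it after a change of sign of the
  \<open>i\<close>-th coordinate.
  Replacing \<open>y\<close> by \<open>flip1 y\<close> gives the half of \<open>x - y\<close>, since changing one sign is, up to a translation
  by a point of order two, the negation of the group law.
\<close>

definition half_coord :: "nat \<Rightarrow> int ^ 4 \<Rightarrow> int ^ 4 \<Rightarrow> 4 \<Rightarrow> nat" where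
  "half_coord Q x y i =
    (let F = gminor Q x y; G = gperm Q x y in
     if i = 1 then gcd6 (F 2 3) (F 2 4) (F 3 4) (G 1 2) (G 1 3) (G 1 4)
     else if i = 2 then gcd6 (F 1 3) (F 1 4) (F 3 4) (G 1 2) (G 2 3) (G 2 4)
     else if i = 3 then gcd6 (F 1 2) (F 1 4) (F 2 4) (G 1 3) (G 2 3) (G 3 4)
     else gcd6 (F 1 2) (F 1 3) (F 2 3) (G 1 4) (G 2 4) (G 3 4))"

lemma minor_flip1: "minor x (flip1 y) i j =
    (if i = j then 0 else if i = 1 then perm2 x y i j else if j = 1 then - perm2 x y i j else minor x y i j)"
  by (auto simp: minor_def perm2_def flip1_def)

lemma perm2_flip1: "i \<noteq> j \<Longrightarrow> perm2 x (flip1 y) i j =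
    (if i = 1 then minor x y i j else if j = 1 then - minor x y i j else perm2 x y i j)"
  by (auto simp: minor_def perm2_def flip1_def)

lemma flip1_flip1 [simp]: "flip1 (flip1 y) = y"
  by (simp add: flip1_def vec_eq_iff)

lemma minor_commute: "minor x y j i = - minor x y i j"
  by (simp add: minor_def)

lemma perm2_commute: "perm2 x y j i = perm2 x y i j"
  by (simp add: perm2_def)

lemma gminor_commute: "gminor Q x y j i = gminor Q x y i j"
  unfolding gminor_def by (subst minor_commute) simp

lemma gperm_commute: "gperm Q x y j i = gperm Q x y i j"
  unfolding gperm_def by (subst perm2_commute) simp

lemma gminor_flip1: "i \<noteq> j \<Longrightarrow> gminor Q x (flip1 y) i j = (if i = 1 \<or> j = 1 then gperm Q x y i j else gminor Q x y i j)"
  by (auto simp: gminor_def gperm_def minor_flip1)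

lemma gperm_flip1: "i \<noteq> j \<Longrightarrow> gperm Q x (flip1 y) i j = (if i = 1 \<or> j = 1 then gminor Q x y i j else gperm Q x y i j)"
  by (auto simp: gminor_def gperm_def perm2_flip1)

text \<open>
  The last clause says that modulo a prime outside \<open>Q\<close> the only coincidences between the points
  \<open>x\<close> and \<open>y\<close>, up to signs of the coordinates, take place where at most one coordinate vanishes.
\<close>

definition compat_pair :: "nat \<Rightarrow> int ^ 4 \<Rightarrow> int ^ 4 \<Rightarrow> bool" where
  "compat_pair Q x y \<longleftrightarrow> even Q \<and> (\<forall>i j. i \<noteq> j \<longrightarrow> minor x y i j \<noteq> 0 \<and> perm2 x y i j \<noteq> 0) \<and>
    (\<forall>p. prime p \<longrightarrow> \<not> p dvd Q \<longrightarrow>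
      (\<exists>e. (\<forall>i j. i \<noteq> j \<longrightarrow> multiplicity p (nat \<bar>minor x y i j\<bar>) + multiplicity p (nat \<bar>perm2 x y i j\<bar>) = e) \<and>
        (e > 0 \<longrightarrow> (\<exists>m. \<forall>i. i \<noteq> m \<longrightarrow> \<not> int p dvd x $ i \<and> \<not> int p dvd y $ i))))"

lemma compat_pair_flip1:
  assumes "compat_pair Q x y"
  shows "compat_pair Q x (flip1 y)"
proof -
  have "multiplicity p (nat \<bar>minor x (flip1 y) i j\<bar>) + multiplicity p (nat \<bar>perm2 x (flip1 y) i j\<bar>) =
      multiplicity p (nat \<bar>minor x y i j\<bar>) + multiplicity p (nat \<bar>perm2 x y i j\<bar>)" if "i \<noteq> j" for p i j
    using that by (simp add: minor_flip1 perm2_flip1)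
  moreover have "int p dvd flip1 y $ i \<longleftrightarrow> int p dvd y $ i" for p i by (simp add: flip1_def)
  moreover have "minor x (flip1 y) i j \<noteq> 0 \<and> perm2 x (flip1 y) i j \<noteq> 0" if "i \<noteq> j" for i j
    using that assms by (simp add: minor_flip1 perm2_flip1 compat_pair_def)
  ultimately show ?thesis using assms unfolding compat_pair_def by simp
qed

text \<open>
  The possible valuations of the minors \<open>minor x y\<close>, for the indices \<open>m\<close>, \<open>i\<close>, \<open>j\<close>, \<open>k\<close>, where \<open>m\<close> is the
  only coordinate that may be divisible by the prime: the four alternatives are the four patterns of
  relative signs of the remaining coordinates.
\<close>

definition val_pattern :: "nat \<Rightarrow> nat \<Rightarrow> nat \<Rightarrow> nat \<Rightarrow> nat \<Rightarrow> nat \<Rightarrow> nat \<Rightarrow> bool" where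
  "val_pattern e mi mj mk ij ik jk \<longleftrightarrow> (\<exists>a b. a + b = e \<and>
     ((ij = e \<and> ik = e \<and> jk = e \<and> mi = a \<and> mj = a \<and> mk = a) \<or>
      (ij = e \<and> ik = 0 \<and> jk = 0 \<and> mi = a \<and> mj = a \<and> mk = b) \<or>
      (ij = 0 \<and> ik = e \<and> jk = 0 \<and> mi = a \<and> mj = b \<and> mk = a) \<or>
      (ij = 0 \<and> ik = 0 \<and> jk = e \<and> mi = b \<and> mj = a \<and> mk = a)))"

text \<open>If p divided both the minor and \<open>perm2\<close> for indices r, s other than m, it
  would divide their sum 2 * x r * y s, a unit modulo p. So the whole e sits on one of them: x and y
  agree modulo p^e in the coordinates r, s up to a common factor and a relative sign. Such a sign
  transports the valuations from r to s (\<open>e1\<close>, \<open>e2\<close>), and consistency of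
  the signs of i, j, k leaves four cases.\<close>

lemma val_pattern_exists:
  fixes p :: nat and x y :: "int ^ 4"
  defines "A \<equiv> \<lambda>i j. multiplicity p (nat \<bar>minor x y i j\<bar>)"
    and "B \<equiv> \<lambda>i j. multiplicity p (nat \<bar>perm2 x y i j\<bar>)"
  assumes p: "prime p" "odd p"
    and nz: "\<And>i j. i \<noteq> j \<Longrightarrow> minor x y i j \<noteq> 0 \<and> perm2 x y i j \<noteq> 0"
    and AB: "\<And>i j. i \<noteq> j \<Longrightarrow> A i j + B i j = e"
    and un: "\<And>i. i \<noteq> m \<Longrightarrow> \<not> int p dvd x $ i \<and> \<not> int p dvd y $ i"
    and dist: "m \<noteq> i" "m \<noteq> j" "m \<noteq> k" "i \<noteq> j" "i \<noteq> k" "j \<noteq> k"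
  shows "val_pattern e (A m i) (A m j) (A m k) (A i j) (A i k) (A j k)"
proof -
  have pp: "prime (int p)" using p by simp
  have nu: "\<not> is_unit p" using p by auto
  have Aiff: "n \<le> A r s \<longleftrightarrow> int p ^ n dvd minor x y r s" if "r \<noteq> s" for n r s
    using nz[OF that] nu power_dvd_iff_le_multiplicity[of "nat \<bar>minor x y r s\<bar>" p n]
    by (simp add: A_def nat_abs_dvd_iff flip: of_nat_power)
  have Biff: "n \<le> B r s \<longleftrightarrow> int p ^ n dvd perm2 x y r s" if "r \<noteq> s" for n r s
    using nz[OF that] nu power_dvd_iff_le_multiplicity[of "nat \<bar>perm2 x y r s\<bar>" p n]
    by (simp add: B_def nat_abs_dvd_iff flip: of_nat_power)
  have zero: "A r s = 0 \<or> A r s = e" if rs: "r \<noteq> m" "s \<noteq> m" "r \<noteq> s" for r s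
  proof (rule ccontr)
    assume "\<not> (A r s = 0 \<or> A r s = e)"
    then have "1 \<le> A r s" "1 \<le> B r s" using AB[OF rs(3)] by auto
    then have "int p dvd minor x y r s" "int p dvd perm2 x y r s"
      using Aiff[OF rs(3), of 1] Biff[OF rs(3), of 1] by auto
    then have "int p dvd minor x y r s + perm2 x y r s" by simp
    also have "minor x y r s + perm2 x y r s = 2 * (x $ r * y $ s)" by (simp add: minor_def perm2_def)
    finally have "int p dvd 2 \<or> int p dvd x $ r \<or> int p dvd y $ s"
      using pp by (simp add: prime_dvd_mult_iff)
    moreover have "\<not> int p dvd 2"
    proof
      assume "int p dvd 2"
      then have "p dvd 2" by presburger
      then show False using p by (metis dvd_refl nu two_is_prime_nat prime_nat_iff)
    qed
    ultimately show False using un rs by auto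
  qed
  \<comment> \<open>The hypothesis is a three-term relation between minors in which y r and y s are
    units modulo p.\<close>
  have dvd_iff: "int p ^ n dvd u \<longleftrightarrow> int p ^ n dvd v"
    if "y $ s * u - y $ r * v = y $ t * w" "int p ^ n dvd w" "r \<noteq> m" "s \<noteq> m" for n u v w r s t
  proof -
    have cop: "coprime (int p ^ n) (y $ r)" "coprime (int p ^ n) (y $ s)"
      using un that pp by (auto simp: prime_imp_coprime)
    have "int p ^ n dvd y $ s * u - y $ r * v" using that by simp
    then have "int p ^ n dvd y $ s * u \<longleftrightarrow> int p ^ n dvd y $ r * v" 
      by (metis dvd_diff_commute dvd_diff_right_iff dvd_minus_iff diff_0_right dvd_add_right_iff diff_add_cancel)
    then show ?thesis using cop by (simp add: coprime_dvd_mult_right_iff)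
  qed
  have eqI: "a = b" if "\<And>n. n \<le> e \<Longrightarrow> n \<le> a \<longleftrightarrow> n \<le> b" "a \<le> e" "b \<le> e" for a b :: nat
    using that by (meson le_antisym order_refl)
  have AleE: "A r s \<le> e" "B r s \<le> e" if "r \<noteq> s" for r s
    using AB[OF that] by auto
  have e1: "A t r = A t s" if "A r s = e" "r \<noteq> m" "s \<noteq> m" "r \<noteq> s" "t \<noteq> r" "t \<noteq> s" for r s t
  proof (rule eqI)
    fix n assume n: "n \<le> e"
    have "y $ s * minor x y t r - y $ r * minor x y t s = y $ t * - minor x y r s"
      by (simp add: minor_def algebra_simps)
    moreover have "int p ^ n dvd - minor x y r s" using Aiff[of r s n] n that by simp
    ultimately have "int p ^ n dvd minor x y t r \<longleftrightarrow> int p ^ n dvd minor x y t s"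
      using that by (intro dvd_iff)
    then show "n \<le> A t r \<longleftrightarrow> n \<le> A t s" using that by (simp add: Aiff)
  qed (use AleE that in auto)
  have e2: "A t r + A t s = e" if "A r s = 0" "r \<noteq> m" "s \<noteq> m" "r \<noteq> s" "t \<noteq> r" "t \<noteq> s" for r s t
  proof -
    have Be: "B r s = e" using AB[of r s] that by simp
    have "A t r = B t s"
    proof (rule eqI)
      fix n assume n: "n \<le> e"
      have "y $ s * minor x y t r - y $ r * perm2 x y t s = y $ t * - perm2 x y r s"
        by (simp add: minor_def perm2_def algebra_simps)
      moreover have "int p ^ n dvd - perm2 x y r s" using Biff[of r s n] n that Be by simp
      ultimately have "int p ^ n dvd minor x y t r \<longleftrightarrow> int p ^ n dvd perm2 x y t s"
        using that by (intro dvd_iff)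
      then show "n \<le> A t r \<longleftrightarrow> n \<le> B t s" using that by (simp add: Aiff Biff)
    qed (use AleE that in auto)
    then show ?thesis using AB[of t s] that by simp
  qed
  have sym: "A r s = A s r" for r s unfolding A_def by (subst minor_commute) simp
  have le: "A m i \<le> e" using AleE[of m i] dist by simp
  have tri: "A i j = e \<Longrightarrow> A i k = A j k" "A i j = 0 \<Longrightarrow> A i k + A j k = e"
    "A i k = e \<Longrightarrow> A i j = A j k" "A i k = 0 \<Longrightarrow> A i j + A j k = e"
    using e1[of i j k] e2[of i j k] e1[of i k j] e2[of i k j] dist sym by metis+
  have mm: "A i j = e \<Longrightarrow> A m i = A m j" "A i j = 0 \<Longrightarrow> A m i + A m j = e"
    "A i k = e \<Longrightarrow> A m i = A m k" "A i k = 0 \<Longrightarrow> A m i + A m k = e"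
    "A j k = e \<Longrightarrow> A m j = A m k" "A j k = 0 \<Longrightarrow> A m j + A m k = e"
    using e1[of i j m] e2[of i j m] e1[of i k m] e2[of i k m] e1[of j k m] e2[of j k m] dist by metis+
  have z: "A i j = 0 \<or> A i j = e" "A i k = 0 \<or> A i k = e" "A j k = 0 \<or> A j k = e"
    using zero dist by metis+
  show ?thesis
  proof (cases "e = 0")
    case True
    have "A r s = 0" if "r \<noteq> s" for r s using AleE[OF that] True by simp
    then show ?thesis using True dist by (simp add: val_pattern_def)
  next
    case False
    consider "A i j = e" "A i k = e" | "A i j = e" "A i k = 0" | "A i j = 0" "A i k = e" | "A i j = 0" "A i k = 0"
      using z(1,2) by metis
    then show ?thesis
    proof cases
      case 1
      then show ?thesis unfolding val_pattern_def using tri mm le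
        by (intro exI[of _ "A m i"] exI[of _ "e - A m i"]) simp
    next
      case 2
      then show ?thesis unfolding val_pattern_def using tri mm le
        by (intro exI[of _ "A m i"] exI[of _ "e - A m i"]) auto
    next
      case 3
      then show ?thesis unfolding val_pattern_def using tri mm le
        by (intro exI[of _ "A m i"] exI[of _ "e - A m i"]) auto
    next
      case 4
      then show ?thesis unfolding val_pattern_def using tri mm le
        \<comment> \<open>In this pattern i is the index with the exceptional sign, so that its
          minor with m has the valuation b rather than a.\<close>
        by (intro exI[of _ "e - A m i"] exI[of _ "A m i"]) auto
    qed
  qed
qed

text \<open>Up to a global sign there are eight patterns of relative signs of x and y at a prime:
  the four with a single sign changed are measured by the z, the four with none or two by the w.
  Changing the sign of the coordinate m alone passes from one kind to the other, so e = a + b is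
  shared between one z and one w, and all the others vanish. The identities are then checked pattern
  by pattern.\<close>

lemma val_identities:
  fixes a12 a13 a14 a23 a24 a34 b12 b13 b14 b23 b24 b34 e :: nat
  assumes sums: "a12 + b12 = e" "a13 + b13 = e" "a14 + b14 = e" "a23 + b23 = e" "a24 + b24 = e" "a34 + b34 = e"
    and pat: "val_pattern e a12 a13 a14 a23 a24 a34 \<or> val_pattern e a12 a23 a24 a13 a14 a34 \<or>
      val_pattern e a13 a23 a34 a12 a14 a24 \<or> val_pattern e a14 a24 a34 a12 a13 a23"
  defines "z1 \<equiv> min6 a23 a24 a34 b12 b13 b14" and "z2 \<equiv> min6 a13 a14 a34 b12 b23 b24"
    and "z3 \<equiv> min6 a12 a14 a24 b13 b23 b34" and "z4 \<equiv> min6 a12 a13 a23 b14 b24 b34"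
    and "w1 \<equiv> min6 a23 a24 a34 a12 a13 a14" and "w2 \<equiv> min6 b13 b14 a34 a12 b23 b24"
    and "w3 \<equiv> min6 b12 b14 a24 a13 b23 b34" and "w4 \<equiv> min6 b12 b13 a23 a14 b24 b34"
  shows "b12 + a34 = 2 * z1 + 2 * z2 + (w1 + w2 + w3 + w4) \<and>
    b13 + a24 = 2 * z1 + 2 * z3 + (w1 + w2 + w3 + w4) \<and>
    b14 + a23 = 2 * z1 + 2 * z4 + (w1 + w2 + w3 + w4) \<and>
    b23 + a14 = 2 * z2 + 2 * z3 + (w1 + w2 + w3 + w4) \<and>
    b24 + a13 = 2 * z2 + 2 * z4 + (w1 + w2 + w3 + w4) \<and>
    b34 + a12 = 2 * z3 + 2 * z4 + (w1 + w2 + w3 + w4) \<and>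
    e = (z1 + z2 + z3 + z4) + (w1 + w2 + w3 + w4) \<and> (z1 = 0 \<or> z2 = 0)"
proof -
  have b: "b12 = e - a12" "b13 = e - a13" "b14 = e - a14" "b23 = e - a23" "b24 = e - a24" "b34 = e - a34"
    using sums by auto
  show ?thesis
    using pat unfolding val_pattern_def z1_def z2_def z3_def z4_def w1_def w2_def w3_def w4_def b min6_def
    by (elim disjE exE conjE) (simp_all, (intro conjI; linarith)+)
qed

lemma gminor_gperm_pos [simp]: "gminor Q x y i j > 0" "gperm Q x y i j > 0"
  by (simp_all add: gminor_def gperm_def)

lemma half_coord_pos [simp]: "half_coord Q x y i > 0"
  by (simp add: half_coord_def Let_def gcd6_def)

text \<open>At the primes of \<open>Q\<close> all good parts have valuation 0, which is the pattern
  with e = 0; the other primes are odd because \<open>Q\<close> is even. Hence a pattern is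
  available at every prime.\<close>

lemma val_pattern_at_prime:
  assumes "compat_pair Q x y" "prime p"
  defines "A \<equiv> \<lambda>i j. multiplicity p (gminor Q x y i j)" and "B \<equiv> \<lambda>i j. multiplicity p (gperm Q x y i j)"
  shows "\<exists>e. (\<forall>i j. i \<noteq> j \<longrightarrow> A i j + B i j = e) \<and>
    (val_pattern e (A 1 2) (A 1 3) (A 1 4) (A 2 3) (A 2 4) (A 3 4) \<or>
     val_pattern e (A 1 2) (A 2 3) (A 2 4) (A 1 3) (A 1 4) (A 3 4) \<or>
     val_pattern e (A 1 3) (A 2 3) (A 3 4) (A 1 2) (A 1 4) (A 2 4) \<or>
     val_pattern e (A 1 4) (A 2 4) (A 3 4) (A 1 2) (A 1 3) (A 2 3))"
proof (cases "p dvd Q")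
  case True
  then have "A i j = 0" "B i j = 0" for i j
    using assms(2) by (simp_all add: A_def B_def gminor_def gperm_def multiplicity_good_part)
  then show ?thesis by (intro exI[of _ 0]) (simp add: val_pattern_def)
next
  case False
  have A: "A = (\<lambda>i j. multiplicity p (nat \<bar>minor x y i j\<bar>))"
    and B: "B = (\<lambda>i j. multiplicity p (nat \<bar>perm2 x y i j\<bar>))"
    using assms(2) False by (simp_all add: A_def B_def gminor_def gperm_def multiplicity_good_part)
  have "\<exists>e. (\<forall>i j. i \<noteq> j \<longrightarrow> A i j + B i j = e) \<and>
      (e > 0 \<longrightarrow> (\<exists>m. \<forall>i. i \<noteq> m \<longrightarrow> \<not> int p dvd x $ i \<and> \<not> int p dvd y $ i))"
    using conjunct2[OF conjunct2[OF assms(1)[unfolded compat_pair_def]]] assms(2) False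
    unfolding A B by blast
  then obtain e where e: "\<And>i j. i \<noteq> j \<Longrightarrow> A i j + B i j = e"
    and m: "e > 0 \<Longrightarrow> \<exists>m. \<forall>i. i \<noteq> m \<longrightarrow> \<not> int p dvd x $ i \<and> \<not> int p dvd y $ i"
    by auto
  have odd: "odd p" using assms(1,2) False unfolding compat_pair_def
    by (metis dvd_trans primes_dvd_imp_eq two_is_prime_nat)
  have nz: "minor x y i j \<noteq> 0 \<and> perm2 x y i j \<noteq> 0" if "i \<noteq> j" for i j
    using assms(1) that by (auto simp: compat_pair_def)
  have sym: "A i j = A j i" for i j unfolding A by (subst minor_commute) simp
  show ?thesis
  proof (cases "e = 0")
    case True
    then have "A i j = 0" if "i \<noteq> j" for i j using e[OF that] by simp
    then show ?thesis using e True by (intro exI[of _ 0]) (simp add: val_pattern_def)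
  next
    case False
    then obtain m where m: "\<And>i. i \<noteq> m \<Longrightarrow> \<not> int p dvd x $ i \<and> \<not> int p dvd y $ i" using m by auto
    have pat: "val_pattern e (A m i) (A m j) (A m k) (A i j) (A i k) (A j k)"
      if "m \<noteq> i" "m \<noteq> j" "m \<noteq> k" "i \<noteq> j" "i \<noteq> k" "j \<noteq> k" for i j k
      using val_pattern_exists[OF assms(2) odd nz, of e m i j k] e m that unfolding A B by blast
    consider "m = 1" | "m = 2" | "m = 3" | "m = 4" using exhaust_4 by blast
    then show ?thesis
    proof cases
      case 1
      then show ?thesis using e pat[of 2 3 4] by (intro exI[of _ e]) simp
    next
      case 2
      then show ?thesis using e pat[of 1 3 4] sym[of 2 1] by (intro exI[of _ e]) simp
    next
      case 3
      then show ?thesis using e pat[of 1 2 4] sym[of 3 1] sym[of 3 2] by (intro exI[of _ e]) simp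
    next
      case 4
      then show ?thesis using e pat[of 1 2 3] sym[of 4 1] sym[of 4 2] sym[of 4 3] by (intro exI[of _ e]) simp
    qed
  qed
qed

text \<open>The identities of \<open>val_identities\<close> hold at every prime, and positive
  integers with the same multiplicities are equal. Each of the six mixed products carries the square
  of two half coordinates, and \<open>W\<close> is common to all of them.\<close>

lemma factor_identities_aux:
  assumes "compat_pair Q x y"
  defines "F \<equiv> gminor Q x y" and "G \<equiv> gperm Q x y" and "z \<equiv> half_coord Q x y" and "w \<equiv> half_coord Q x (flip1 y)"
  defines "W \<equiv> w 1 * w 2 * w 3 * w 4"
  shows "G 1 2 * F 3 4 = (z 1)\<^sup>2 * (z 2)\<^sup>2 * W" "G 1 3 * F 2 4 = (z 1)\<^sup>2 * (z 3)\<^sup>2 * W"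
    "G 1 4 * F 2 3 = (z 1)\<^sup>2 * (z 4)\<^sup>2 * W" "G 2 3 * F 1 4 = (z 2)\<^sup>2 * (z 3)\<^sup>2 * W"
    "G 2 4 * F 1 3 = (z 2)\<^sup>2 * (z 4)\<^sup>2 * W" "G 3 4 * F 1 2 = (z 3)\<^sup>2 * (z 4)\<^sup>2 * W"
    "i \<noteq> j \<Longrightarrow> F i j * G i j = z 1 * z 2 * z 3 * z 4 * W"
    "coprime (z 1) (z 2)"
proof -
  have pos: "F i j > 0" "G i j > 0" "z i > 0" "w i > 0" for i j
    by (simp_all add: F_def G_def z_def w_def)
  have W: "W > 0" using pos by (simp add: W_def)
  note dist = prime_elem_multiplicity_mult_distrib prime_elem_multiplicity_power_distrib
  have key: "(let v = multiplicity p in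
      v (G 1 2) + v (F 3 4) = 2 * v (z 1) + 2 * v (z 2) + v W \<and>
      v (G 1 3) + v (F 2 4) = 2 * v (z 1) + 2 * v (z 3) + v W \<and>
      v (G 1 4) + v (F 2 3) = 2 * v (z 1) + 2 * v (z 4) + v W \<and>
      v (G 2 3) + v (F 1 4) = 2 * v (z 2) + 2 * v (z 3) + v W \<and>
      v (G 2 4) + v (F 1 3) = 2 * v (z 2) + 2 * v (z 4) + v W \<and>
      v (G 3 4) + v (F 1 2) = 2 * v (z 3) + 2 * v (z 4) + v W \<and>
      (i \<noteq> j \<longrightarrow> v (F i j) + v (G i j) = v (z 1) + v (z 2) + v (z 3) + v (z 4) + v W) \<and>
      (v (z 1) = 0 \<or> v (z 2) = 0))" if p: "prime p" for p
  proof -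
    define A where "A i j = multiplicity p (F i j)" for i j
    define B where "B i j = multiplicity p (G i j)" for i j
    obtain e where e: "\<And>i j. i \<noteq> j \<Longrightarrow> A i j + B i j = e"
      and pat: "val_pattern e (A 1 2) (A 1 3) (A 1 4) (A 2 3) (A 2 4) (A 3 4) \<or>
       val_pattern e (A 1 2) (A 2 3) (A 2 4) (A 1 3) (A 1 4) (A 3 4) \<or>
       val_pattern e (A 1 3) (A 2 3) (A 3 4) (A 1 2) (A 1 4) (A 2 4) \<or>
       val_pattern e (A 1 4) (A 2 4) (A 3 4) (A 1 2) (A 1 3) (A 2 3)"
      using val_pattern_at_prime[OF assms(1) p] unfolding A_def B_def F_def G_def by auto
    have z: "multiplicity p (z 1) = min6 (A 2 3) (A 2 4) (A 3 4) (B 1 2) (B 1 3) (B 1 4)"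
      "multiplicity p (z 2) = min6 (A 1 3) (A 1 4) (A 3 4) (B 1 2) (B 2 3) (B 2 4)"
      "multiplicity p (z 3) = min6 (A 1 2) (A 1 4) (A 2 4) (B 1 3) (B 2 3) (B 3 4)"
      "multiplicity p (z 4) = min6 (A 1 2) (A 1 3) (A 2 3) (B 1 4) (B 2 4) (B 3 4)"
      using p by (simp_all add: z_def half_coord_def Let_def multiplicity_gcd6 A_def B_def F_def G_def)
    have w: "multiplicity p (w 1) = min6 (A 2 3) (A 2 4) (A 3 4) (A 1 2) (A 1 3) (A 1 4)"
      "multiplicity p (w 2) = min6 (B 1 3) (B 1 4) (A 3 4) (A 1 2) (B 2 3) (B 2 4)"
      "multiplicity p (w 3) = min6 (B 1 2) (B 1 4) (A 2 4) (A 1 3) (B 2 3) (B 3 4)"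
      "multiplicity p (w 4) = min6 (B 1 2) (B 1 3) (A 2 3) (A 1 4) (B 2 4) (B 3 4)"
      using p by (simp_all add: w_def half_coord_def Let_def multiplicity_gcd6 A_def B_def F_def G_def gminor_flip1 gperm_flip1)
    have vW: "multiplicity p W = multiplicity p (w 1) + multiplicity p (w 2) + multiplicity p (w 3) + multiplicity p (w 4)"
      using pos p by (simp add: W_def dist)
    have e': "A 1 2 + B 1 2 = e" "A 1 3 + B 1 3 = e" "A 1 4 + B 1 4 = e"
      "A 2 3 + B 2 3 = e" "A 2 4 + B 2 4 = e" "A 3 4 + B 3 4 = e"
      by (simp_all add: e)
    show ?thesis unfolding Let_def
      using val_identities[OF e' pat, folded z w] e unfolding vW by (auto simp: A_def B_def)
  qed
  have pw: "prime p \<Longrightarrow> multiplicity p (a * b) = multiplicity p a + multiplicity p b" if "a > 0" "b > 0" for a b p :: nat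
    using that by (simp add: dist)
  have psq: "prime p \<Longrightarrow> multiplicity p (a\<^sup>2) = 2 * multiplicity p a" if "a > 0" for a p :: nat
    using that by (simp add: dist)
  have eqI: "a * b = c\<^sup>2 * d\<^sup>2 * W" if "a > 0" "b > 0" "c > 0" "d > 0" "\<And>p. prime p \<Longrightarrow>
    multiplicity p a + multiplicity p b = 2 * multiplicity p c + 2 * multiplicity p d + multiplicity p W" for a b c d
    using that W by - (rule multiplicity_eq_nat, simp_all add: pw psq)
  show "G 1 2 * F 3 4 = (z 1)\<^sup>2 * (z 2)\<^sup>2 * W" "G 1 3 * F 2 4 = (z 1)\<^sup>2 * (z 3)\<^sup>2 * W"
    "G 1 4 * F 2 3 = (z 1)\<^sup>2 * (z 4)\<^sup>2 * W" "G 2 3 * F 1 4 = (z 2)\<^sup>2 * (z 3)\<^sup>2 * W"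
    "G 2 4 * F 1 3 = (z 2)\<^sup>2 * (z 4)\<^sup>2 * W" "G 3 4 * F 1 2 = (z 3)\<^sup>2 * (z 4)\<^sup>2 * W"
    by (rule eqI[OF pos(2) pos(1) pos(3) pos(3)], drule key, simp only: Let_def)+
  show "F i j * G i j = z 1 * z 2 * z 3 * z 4 * W" if "i \<noteq> j"
  proof (rule multiplicity_eq_nat)
    fix p :: nat assume p: "prime p"
    show "multiplicity p (F i j * G i j) = multiplicity p (z 1 * z 2 * z 3 * z 4 * W)"
      using key[OF p] p pos W that by (simp add: pw Let_def)
  qed (use pos W in auto)
  show "coprime (z 1) (z 2)"
  proof (rule ccontr)
    assume "\<not> coprime (z 1) (z 2)"
    then have "gcd (z 1) (z 2) \<noteq> 1" by (simp only: coprime_iff_gcd_eq_1 not_False_eq_True)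
    then obtain p where "prime p" "p dvd gcd (z 1) (z 2)" using prime_factor_nat by blast
    then have p: "prime p" "p dvd z 1" "p dvd z 2" by auto
    then have "multiplicity p (z 1) > 0" "multiplicity p (z 2) > 0"
      using pos by (simp_all add: prime_multiplicity_gt_zero_iff)
    then show False using key[OF p(1)] by (simp add: Let_def)
  qed
qed

lemma factor_identities:
  assumes "compat_pair Q x y"
  defines "z \<equiv> half_coord Q x y" and "w \<equiv> half_coord Q x (flip1 y)"
  shows "distinct [i, j, k, l] \<Longrightarrow> gperm Q x y i j * gminor Q x y k l = (z i)\<^sup>2 * (z j)\<^sup>2 * (w 1 * w 2 * w 3 * w 4)"
    and "i \<noteq> j \<Longrightarrow> gminor Q x y i j * gperm Q x y i j = (z 1 * z 2 * z 3 * z 4) * (w 1 * w 2 * w 3 * w 4)"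
    and "coprime (z 1) (z 2)"
proof -
  note * = factor_identities_aux[OF assms(1), folded z_def w_def]
  have c: "gperm Q x y 2 1 = gperm Q x y 1 2" "gperm Q x y 3 1 = gperm Q x y 1 3" "gperm Q x y 4 1 = gperm Q x y 1 4"
    "gperm Q x y 3 2 = gperm Q x y 2 3" "gperm Q x y 4 2 = gperm Q x y 2 4" "gperm Q x y 4 3 = gperm Q x y 3 4"
    "gminor Q x y 2 1 = gminor Q x y 1 2" "gminor Q x y 3 1 = gminor Q x y 1 3" "gminor Q x y 4 1 = gminor Q x y 1 4"
    "gminor Q x y 3 2 = gminor Q x y 2 3" "gminor Q x y 4 2 = gminor Q x y 2 4" "gminor Q x y 4 3 = gminor Q x y 3 4"
    by (rule gminor_commute gperm_commute)+
  show "gperm Q x y i j * gminor Q x y k l = (z i)\<^sup>2 * (z j)\<^sup>2 * (w 1 * w 2 * w 3 * w 4)" if "distinct [i, j, k, l]"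
    using that exhaust_4[of i] exhaust_4[of j] exhaust_4[of k] exhaust_4[of l]
    by (elim disjE) (simp_all add: c *(1-6))
  show "i \<noteq> j \<Longrightarrow> gminor Q x y i j * gperm Q x y i j = (z 1 * z 2 * z 3 * z 4) * (w 1 * w 2 * w 3 * w 4)"
    by (rule *(7))
  show "coprime (z 1) (z 2)" by (rule *(8))
qed

section \<open>Families of points on conics\<close>

text \<open>Eliminating one variable from two diagonal forms relates the squares of the other three.
  Recording only these relations, with a bound for their coefficients, treats the original curve and
  the curves carrying the half points alike.\<close>

definition conic_family :: "real \<Rightarrow> (int ^ 4) set \<Rightarrow> bool" where
  "conic_family T P \<longleftrightarrow> (\<forall>i j k. distinct [i, j, k] \<longrightarrow>
     (\<exists>a b c. a \<noteq> 0 \<and> b \<noteq> 0 \<and> c \<noteq> 0 \<and> \<bar>of_int a\<bar> \<le> T \<and> \<bar>of_int b\<bar> \<le> T \<and> \<bar>of_int c\<bar> \<le> T \<and>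
        (\<forall>x\<in>P. a * (x $ i)\<^sup>2 + b * (x $ j)\<^sup>2 + c * (x $ k)\<^sup>2 = 0)))"

definition height_family :: "real \<Rightarrow> real \<Rightarrow> (int ^ 4) set \<Rightarrow> bool" where
  "height_family T B P \<longleftrightarrow> conic_family T P \<and> (\<forall>x\<in>P. coprime_coords x \<and> (\<forall>i. \<bar>of_int (x $ i)\<bar> \<le> B))"

definition positive_family :: "real \<Rightarrow> (int ^ 4) set \<Rightarrow> bool" where
  "positive_family T P \<longleftrightarrow> conic_family T P \<and> (\<forall>x\<in>P. coprime_coords x \<and> (\<forall>i. 1 \<le> x $ i))"

lemma ex_distinct_4:
  fixes i :: 4
  obtains j k l where "distinct [i, j, k, l]"
proof -
  have "card (UNIV - {i}) = 3" by simp
  then obtain S where "UNIV - {i} = S" "card S = 3" by simp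
  then obtain j k l where "UNIV - {i} = {j, k, l}" "j \<noteq> k" "j \<noteq> l" "k \<noteq> l"
    by (auto simp: card_3_iff)
  then show thesis by (intro that[of j k l]) auto
qed

lemma ex_fourth:
  fixes i j k :: 4
  assumes "distinct [i, j, k]"
  obtains l where "distinct [l, i, j, k]"
proof -
  have "card {i, j, k} \<le> 3" by (simp add: card_insert_if)
  moreover have "card (UNIV :: 4 set) = 4" by simp
  ultimately have "{i, j, k} \<noteq> UNIV" by (intro notI) simp
  then show thesis using assms that by auto
qed

lemma UNIV_distinct_4:
  fixes i j k l :: 4
  assumes "distinct [i, j, k, l]"
  shows "UNIV = {i, j, k, l}"
proof -
  have "card {i, j, k, l} = card (UNIV :: 4 set)" using assms by simp
  then show ?thesis by (intro card_subset_eq[symmetric]) auto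
qed

text \<open>Dyadic hyperbola method: for \<open>\<mu>\<close> between 2^k and 2^(k + 1) the other
  weight is at most U / 2^k, so each block contributes at most c^2 * (2 * U)^s whatever k is, and
  there are at most 1 + log 2 U blocks.\<close>

lemma card_weighted_pairs_le:
  fixes \<mu> :: "'a \<Rightarrow> real" and \<nu> :: "'b \<Rightarrow> real" and c s U :: real
  assumes fin: "finite X" "finite Y"
    and ge1: "\<And>a. a \<in> X \<Longrightarrow> \<mu> a \<ge> 1" "\<And>b. b \<in> Y \<Longrightarrow> \<nu> b \<ge> 1"
    and s: "c \<ge> 0" and U: "U \<ge> 1"
    and X: "\<And>t. t \<ge> 1 \<Longrightarrow> real (card {a \<in> X. \<mu> a \<le> t}) \<le> c * t powr s"
    and Y: "\<And>t. t \<ge> 1 \<Longrightarrow> real (card {b \<in> Y. \<nu> b \<le> t}) \<le> c * t powr s"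
  shows "real (card {(a, b) \<in> X \<times> Y. \<mu> a * \<nu> b \<le> U}) \<le> c\<^sup>2 * 2 powr s * U powr s * (1 + log 2 U)"
proof -
  define R where "R = {(a, b) \<in> X \<times> Y. \<mu> a * \<nu> b \<le> U}"
  define key where "key ab = nat \<lfloor>log 2 (\<mu> (fst ab))\<rfloor>" for ab :: "'a \<times> 'b"
  have finR: "finite R" unfolding R_def by (rule finite_subset[of _ "X \<times> Y"]) (use fin in auto)
  have le: "2 ^ key ab \<le> \<mu> (fst ab)" "\<mu> (fst ab) \<le> 2 ^ (key ab + 1)" if "ab \<in> R" for ab
  proof -
    have m: "\<mu> (fst ab) \<ge> 1" using that ge1 by (auto simp: R_def)
    then have "log 2 (\<mu> (fst ab)) \<ge> 0" by simp
    then have k: "real (key ab) \<le> log 2 (\<mu> (fst ab))" "log 2 (\<mu> (fst ab)) \<le> real (key ab + 1)"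
      unfolding key_def by linarith+
    show "2 ^ key ab \<le> \<mu> (fst ab)"
      using k(1) m by (simp add: le_log_iff powr_realpow)
    show "\<mu> (fst ab) \<le> 2 ^ (key ab + 1)"
      using k(2) m by (simp add: log_le_iff powr_realpow powr_add)
  qed
  have "real (card R) \<le> real (card {..nat \<lfloor>log 2 U\<rfloor>}) * (c\<^sup>2 * 2 powr s * U powr s)"
  proof (rule card_le_card_keys[OF finR])
    have kU: "2 ^ key ab \<le> U" if "ab \<in> R" for ab
    proof -
      have "\<mu> (fst ab) * 1 \<le> \<mu> (fst ab) * \<nu> (snd ab)"
        using that ge1 by (intro mult_left_mono) (force simp: R_def)+
      also have "\<dots> \<le> U" using that by (auto simp: R_def)
      finally show ?thesis using le(1)[OF that] by simp
    qed
    show "key ` R \<subseteq> {..nat \<lfloor>log 2 U\<rfloor>}"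
    proof
      fix k assume "k \<in> key ` R"
      then have "2 ^ k \<le> U" using kU by auto
      then have "real k \<le> log 2 U" using U by (simp add: le_log_iff powr_realpow)
      then show "k \<in> {..nat \<lfloor>log 2 U\<rfloor>}" by (simp add: le_nat_floor)
    qed
    fix k assume "k \<in> {..nat \<lfloor>log 2 U\<rfloor>}"
    show "real (card {ab \<in> R. key ab = k}) \<le> c\<^sup>2 * 2 powr s * U powr s"
    proof (cases "{ab \<in> R. key ab = k} = {}")
      case True
      then show ?thesis unfolding True by simp
    next
      case False
      then have kU': "2 ^ k \<le> U" using kU by auto
      have "{ab \<in> R. key ab = k} \<subseteq> {a \<in> X. \<mu> a \<le> 2 ^ (k + 1)} \<times> {b \<in> Y. \<nu> b \<le> U / 2 ^ k}"
      proof
        fix ab assume ab: "ab \<in> {ab \<in> R. key ab = k}"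
        then have "2 ^ k * \<nu> (snd ab) \<le> \<mu> (fst ab) * \<nu> (snd ab)"
          using le(1)[of ab] ge1 by (intro mult_right_mono) (force simp: R_def)+
        also have "\<dots> \<le> U" using ab by (auto simp: R_def)
        finally have "\<nu> (snd ab) \<le> U / 2 ^ k" by (simp add: field_simps)
        then show "ab \<in> {a \<in> X. \<mu> a \<le> 2 ^ (k + 1)} \<times> {b \<in> Y. \<nu> b \<le> U / 2 ^ k}"
          using ab le(2)[of ab] by (auto simp: R_def)
      qed
      then have "card {ab \<in> R. key ab = k} \<le> card ({a \<in> X. \<mu> a \<le> 2 ^ (k + 1)} \<times> {b \<in> Y. \<nu> b \<le> U / 2 ^ k})"
        using fin by (intro card_mono) auto
      also have "\<dots> = card {a \<in> X. \<mu> a \<le> 2 ^ (k + 1)} * card {b \<in> Y. \<nu> b \<le> U / 2 ^ k}"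
        by (rule card_cartesian_product)
      finally have "real (card {ab \<in> R. key ab = k}) \<le>
          real (card {a \<in> X. \<mu> a \<le> 2 ^ (k + 1)}) * real (card {b \<in> Y. \<nu> b \<le> U / 2 ^ k})"
        by (simp flip: of_nat_mult)
      also have "\<dots> \<le> (c * (2 ^ (k + 1)) powr s) * (c * (U / 2 ^ k) powr s)"
      proof (intro mult_mono X Y)
        show "1 \<le> U / 2 ^ k" using kU' by (simp add: field_simps)
        show "(1::real) \<le> 2 ^ (k + 1)" by (rule one_le_power) simp
      qed (use s in auto)
      also have "\<dots> = c\<^sup>2 * (2 ^ (k + 1) * (U / 2 ^ k)) powr s"
        using U by (subst powr_mult) (auto simp: power2_eq_square)
      also have "2 ^ (k + 1) * (U / 2 ^ k) = 2 * U" by simp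
      also have "(2 * U) powr s = 2 powr s * U powr s" using U by (subst powr_mult) auto
      finally show ?thesis by simp
    qed
  qed auto
  also have "\<dots> \<le> (1 + log 2 U) * (c\<^sup>2 * 2 powr s * U powr s)"
  proof (rule mult_right_mono)
    have "log 2 U \<ge> 0" using U by simp
    then show "real (card {..nat \<lfloor>log 2 U\<rfloor>}) \<le> 1 + log 2 U" by simp
  qed simp
  finally show ?thesis by (simp add: R_def mult_ac)
qed

text \<open>Once the coordinate i has a fixed value, one relation becomes a binary quadratic
  equation with non-zero right-hand side for two further coordinates, and a second relation
  determines the last one, whose sign is positive. The factor 4 counts the choices of i, and U the
  values.\<close>

lemma card_small_coordinate:
  fixes \<epsilon> :: real
  assumes "\<epsilon> > 0"
  obtains C where "C > 0"
    "\<And>Z T M U. conic_family T Z \<Longrightarrow> (\<And>z i. z \<in> Z \<Longrightarrow> 1 \<le> z $ i \<and> of_int (z $ i) \<le> M) \<Longrightarrow> finite Z \<Longrightarrow>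
      T \<ge> 1 \<Longrightarrow> M \<ge> 1 \<Longrightarrow> U \<ge> 1 \<Longrightarrow>
      real (card {z \<in> Z. \<exists>i. of_int (z $ i) \<le> U}) \<le> C * (T * M ^ 2) powr \<epsilon> * U"
proof -
  obtain C where C: "C > 0"
    "\<And>a b n M. a \<noteq> 0 \<Longrightarrow> b \<noteq> 0 \<Longrightarrow> n \<noteq> 0 \<Longrightarrow> M \<ge> 1 \<Longrightarrow> \<bar>of_int a\<bar> \<le> M \<Longrightarrow> \<bar>of_int b\<bar> \<le> M \<Longrightarrow> \<bar>of_int n\<bar> \<le> M \<Longrightarrow>
      real (card {(x::int, y::int). a * x\<^sup>2 + b * y\<^sup>2 = n \<and> \<bar>of_int x\<bar> \<le> M \<and> \<bar>of_int y\<bar> \<le> M}) \<le> C * M powr \<epsilon>"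
    using quad_form_count[OF assms] by blast
  show thesis
  proof (rule that[of "4 * C"])
    show "4 * C > 0" using C by simp
    fix Z :: "(int ^ 4) set" and T M U :: real
    assume cf: "conic_family T Z" and zM: "\<And>z i. z \<in> Z \<Longrightarrow> 1 \<le> z $ i \<and> of_int (z $ i) \<le> M"
      and fin: "finite Z" and T: "T \<ge> 1" and M: "M \<ge> 1" and U: "U \<ge> 1"
    define X where "X = T * M ^ 2"
    have M2: "M ^ 2 \<ge> 1" "M \<le> M ^ 2" using M one_le_power[of M 2] self_le_power[of M 2] by auto
    have X: "X \<ge> 1" "T \<le> X" "M \<le> X"
      using T M2 mult_mono[of 1 T 1 "M ^ 2"] mult_mono[of T T 1 "M ^ 2"] mult_mono[of 1 T M "M ^ 2"] M
      by (auto simp: X_def)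
    have one: "real (card {z \<in> Z. z $ i = m}) \<le> C * X powr \<epsilon>" if m: "1 \<le> m" "of_int m \<le> M" for i m
    proof -
      obtain j k l where d: "distinct [i, j, k, l]" using ex_distinct_4 .
      have "distinct [i, j, k]" "distinct [i, j, l]" using d by auto
      obtain a b c where abc: "a \<noteq> 0" "b \<noteq> 0" "c \<noteq> 0" "\<bar>of_int a\<bar> \<le> T" "\<bar>of_int b\<bar> \<le> T" "\<bar>of_int c\<bar> \<le> T"
        "\<And>x. x \<in> Z \<Longrightarrow> a * (x $ i)\<^sup>2 + b * (x $ j)\<^sup>2 + c * (x $ k)\<^sup>2 = 0"
        using cf \<open>distinct [i, j, k]\<close> unfolding conic_family_def by metis
      obtain a' b' c' where abc': "c' \<noteq> 0"
        "\<And>x. x \<in> Z \<Longrightarrow> a' * (x $ i)\<^sup>2 + b' * (x $ j)\<^sup>2 + c' * (x $ l)\<^sup>2 = 0"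
        using cf \<open>distinct [i, j, l]\<close> unfolding conic_family_def by metis
      define n where "n = - (a * m\<^sup>2)"
      have n0: "n \<noteq> 0" using abc(1) m by (simp add: n_def)
      have "(of_int m)\<^sup>2 \<le> M ^ 2" using m by (intro power_mono) auto
      then have "\<bar>of_int a\<bar> * (of_int m)\<^sup>2 \<le> X" unfolding X_def using abc(4) T by (intro mult_mono) auto
      then have nX: "\<bar>of_int n\<bar> \<le> X" by (simp add: n_def abs_mult)
      let ?S = "{(x::int, y::int). b * x\<^sup>2 + c * y\<^sup>2 = n \<and> \<bar>of_int x\<bar> \<le> X \<and> \<bar>of_int y\<bar> \<le> X}"
      have finS: "finite ?S"
        by (rule finite_subset[of _ "{x::int. \<bar>of_int x\<bar> \<le> X} \<times> {x::int. \<bar>of_int x\<bar> \<le> X}"]) auto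
      have "card {z \<in> Z. z $ i = m} \<le> card ?S"
      proof (rule card_inj_on_le)
        show "inj_on (\<lambda>z. (z $ j, z $ k)) {z \<in> Z. z $ i = m}"
        proof (rule inj_onI)
          fix z z' assume z: "z \<in> {z \<in> Z. z $ i = m}" "z' \<in> {z \<in> Z. z $ i = m}"
            "(z $ j, z $ k) = (z' $ j, z' $ k)"
          have "a' * (z $ i)\<^sup>2 + b' * (z $ j)\<^sup>2 + c' * (z $ l)\<^sup>2 = a' * (z' $ i)\<^sup>2 + b' * (z' $ j)\<^sup>2 + c' * (z' $ l)\<^sup>2"
            using abc'(2)[of z] abc'(2)[of z'] z by simp
          then have "(z $ l)\<^sup>2 = (z' $ l)\<^sup>2" using z abc'(1) by simp
          moreover have "1 \<le> z $ l" "1 \<le> z' $ l" using zM z by auto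
          ultimately have "z $ l = z' $ l" by (simp add: power2_eq_iff)
          then have "z $ r = z' $ r" if "r \<in> {i, j, k, l}" for r using that z by auto
          then show "z = z'" using UNIV_distinct_4[OF d] by (simp add: vec_eq_iff)
        qed
        show "(\<lambda>z. (z $ j, z $ k)) ` {z \<in> Z. z $ i = m} \<subseteq> ?S"
        proof
          fix s assume "s \<in> (\<lambda>z. (z $ j, z $ k)) ` {z \<in> Z. z $ i = m}"
          then obtain z where z: "z \<in> Z" "z $ i = m" "s = (z $ j, z $ k)" by auto
          have "b * (z $ j)\<^sup>2 + c * (z $ k)\<^sup>2 = n" using abc(7)[OF z(1)] z(2) by (simp add: n_def)
          moreover have "\<bar>of_int (z $ r)\<bar> \<le> X" for r
          proof -
            have "1 \<le> z $ r" "of_int (z $ r) \<le> M" using zM[OF z(1)] by auto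
            then show ?thesis using X(3) by auto
          qed
          ultimately show "s \<in> ?S" using z(3) by simp
        qed
      qed (rule finS)
      also have "real (card ?S) \<le> C * X powr \<epsilon>"
        using abc n0 nX X by (intro C(2)) auto
      finally show ?thesis by simp
    qed
    \<comment> \<open>The minimum with \<open>M\<close> keeps the fixed value in the range where
      \<open>one\<close> applies.\<close>
    define V where "V = nat \<lfloor>min U M\<rfloor>"
    have "{z \<in> Z. \<exists>i. of_int (z $ i) \<le> U} \<subseteq> (\<Union>(i, m)\<in>UNIV \<times> {1..int V}. {z \<in> Z. z $ i = m})"
    proof
      fix z assume z: "z \<in> {z \<in> Z. \<exists>i. of_int (z $ i) \<le> U}"
      then obtain i where i: "of_int (z $ i) \<le> U" by auto
      have "1 \<le> z $ i" "of_int (z $ i) \<le> M" using zM z by auto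
      then have "z $ i \<le> int V" using i unfolding V_def by (simp add: le_floor_iff)
      then show "z \<in> (\<Union>(i, m)\<in>UNIV \<times> {1..int V}. {z \<in> Z. z $ i = m})"
        using z \<open>1 \<le> z $ i\<close> by auto
    qed
    then have "card {z \<in> Z. \<exists>i. of_int (z $ i) \<le> U} \<le> card (\<Union>(i, m)\<in>UNIV \<times> {1..int V}. {z \<in> Z. z $ i = m})"
      using fin by (intro card_mono) auto
    also have "\<dots> \<le> (\<Sum>(i, m)\<in>UNIV \<times> {1..int V}. card {z \<in> Z. z $ i = m})"
      using card_UN_le[of "UNIV \<times> {1..int V}" "\<lambda>(i, m). {z \<in> Z. z $ i = m}"] by (simp add: case_prod_beta)
    finally have "real (card {z \<in> Z. \<exists>i. of_int (z $ i) \<le> U}) \<le> (\<Sum>(i, m)\<in>UNIV \<times> {1..int V}. real (card {z \<in> Z. z $ i = m}))"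
      by (simp add: case_prod_beta flip: of_nat_sum)
    also have "\<dots> \<le> (\<Sum>(i, m)\<in>(UNIV :: 4 set) \<times> {1..int V}. C * X powr \<epsilon>)"
    proof (rule sum_mono, clarify)
      fix i :: 4 and m :: int assume m: "m \<in> {1..int V}"
      then have "of_int m \<le> M" unfolding V_def using M U by (auto simp: le_floor_iff)
      then show "real (card {z \<in> Z. z $ i = m}) \<le> C * X powr \<epsilon>" using m by (intro one) auto
    qed
    also have "\<dots> = 4 * real V * (C * X powr \<epsilon>)" by (simp add: case_prod_beta)
    also have "\<dots> \<le> 4 * U * (C * X powr \<epsilon>)"
    proof -
      have "real V \<le> U" unfolding V_def using U M by linarith
      then show ?thesis using C(1) by (intro mult_right_mono mult_left_mono) auto
    qed
    finally show "real (card {z \<in> Z. \<exists>i. of_int (z $ i) \<le> U}) \<le> 4 * C * (T * M ^ 2) powr \<epsilon> * U"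
      by (simp add: X_def mult_ac)
  qed
qed

lemma log_powr_bound:
  fixes \<epsilon> U :: real
  assumes "\<epsilon> > 0" "U \<ge> 1"
  shows "1 + log 2 U \<le> (1 + 1 / (\<epsilon> * ln 2)) * U powr \<epsilon>"
proof -
  have "ln U \<le> U powr \<epsilon> / \<epsilon>" using assms by (intro ln_powr_bound) auto
  then have "ln U / ln 2 \<le> U powr \<epsilon> / \<epsilon> / ln 2" by (intro divide_right_mono) auto
  moreover have "1 \<le> U powr \<epsilon>" using assms by (simp add: ge_one_powr_ge_zero)
  ultimately show ?thesis by (simp add: log_def algebra_simps)
qed

definition bounded_pairs :: "(int ^ 4) set \<Rightarrow> (int ^ 4) set \<Rightarrow> real \<Rightarrow> ((int ^ 4) \<times> (int ^ 4)) set" where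
  "bounded_pairs Z W L = {(z, w) \<in> Z \<times> W. of_int (prod (($) z) UNIV) * of_int (prod (($) w) UNIV) \<le> L}"

lemma prod_UNIV_4:
  fixes z :: "'a::comm_ring_1 ^ 4"
  assumes "distinct [i, j, k, l]"
  shows "prod (($) z) UNIV = z $ i * z $ j * z $ k * z $ l"
  unfolding UNIV_distinct_4[OF assms] using assms by (simp add: mult.assoc)

lemma conic_family_subset: "conic_family T Z \<Longrightarrow> Y \<subseteq> Z \<Longrightarrow> conic_family T Y"
  unfolding conic_family_def by (meson subsetD)

lemma prod_ge_coordinate:
  fixes z :: "int ^ 4"
  assumes "\<And>i. 1 \<le> z $ i"
  shows "z $ i \<le> prod (($) z) UNIV"
proof -
  obtain j k l where d: "distinct [i, j, k, l]" using ex_distinct_4 .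
  have "z $ i * 1 \<le> z $ i * (z $ j * (z $ k * z $ l))"
  proof (rule mult_left_mono)
    have "1 * (1 * 1) \<le> z $ j * (z $ k * z $ l)" using assms[of j] assms[of k] assms[of l] by (intro mult_mono) auto
    then show "1 \<le> z $ j * (z $ k * z $ l)" by simp
    show "0 \<le> z $ i" using assms[of i] by simp
  qed
  then show ?thesis unfolding prod_UNIV_4[OF d] by (simp add: mult.assoc)
qed

text \<open>Positive families may be infinite. As all coordinates are at least 1, the bound for the
  product of the eight coordinates bounds each of them and makes the relevant part finite.\<close>

lemma bounded_pairs_truncate:
  assumes "\<And>z i. z \<in> Z \<Longrightarrow> 1 \<le> z $ i" "\<And>w i. w \<in> W \<Longrightarrow> 1 \<le> w $ i"
  shows "bounded_pairs Z W L \<subseteq> {z \<in> Z. \<forall>i. of_int (z $ i) \<le> L} \<times> {w \<in> W. \<forall>i. of_int (w $ i) \<le> L}"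
proof
  fix s assume s: "s \<in> bounded_pairs Z W L"
  then obtain z w where zw: "s = (z, w)" "z \<in> Z" "w \<in> W"
    "of_int (prod (($) z) UNIV) * of_int (prod (($) w) UNIV) \<le> L" by (auto simp: bounded_pairs_def)
  have z1: "1 \<le> prod (($) z) UNIV" "1 \<le> prod (($) w) UNIV"
    using assms zw by (auto intro!: prod_ge_1)
  have le: "prod (($) z) UNIV \<le> prod (($) z) UNIV * prod (($) w) UNIV"
    "prod (($) w) UNIV \<le> prod (($) z) UNIV * prod (($) w) UNIV"
    using z1 mult_left_mono[of 1 "prod (($) w) UNIV" "prod (($) z) UNIV"]
      mult_right_mono[of 1 "prod (($) z) UNIV" "prod (($) w) UNIV"] by auto
  have zw': "of_int (prod (($) z) UNIV * prod (($) w) UNIV) \<le> L" using zw(4) by simp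
  have "of_int (z $ i) \<le> L" for i
    using prod_ge_coordinate[of z i] assms(1)[OF zw(2)] le(1) zw' by (meson of_int_le_iff order_trans)
  moreover have "of_int (w $ i) \<le> L" for i
    using prod_ge_coordinate[of w i] assms(2)[OF zw(3)] le(2) zw' by (meson of_int_le_iff order_trans)
  ultimately show "s \<in> {z \<in> Z. \<forall>i. of_int (z $ i) \<le> L} \<times> {w \<in> W. \<forall>i. of_int (w $ i) \<le> L}"
    using zw by auto
qed

lemma finite_vec_coords:
  fixes T :: "'a set"
  assumes "finite T"
  shows "finite {v :: 'a ^ 'n. \<forall>i. v $ i \<in> T}" "card {v :: 'a ^ 'n. \<forall>i. v $ i \<in> T} = card T ^ CARD('n)"
proof -
  have b: "bij_betw vec_lambda ((UNIV :: 'n set) \<rightarrow>\<^sub>E T) {v :: 'a ^ 'n. \<forall>i. v $ i \<in> T}"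
    by (rule bij_betwI[of _ _ _ vec_nth]) auto
  show "finite {v :: 'a ^ 'n. \<forall>i. v $ i \<in> T}"
    using bij_betw_finite[OF b] assms by (simp add: finite_PiE)
  show "card {v :: 'a ^ 'n. \<forall>i. v $ i \<in> T} = card T ^ CARD('n)"
    using bij_betw_same_card[OF b] by (simp add: card_PiE)
qed

lemma finite_vec_abs_le [simp]: "finite {v :: int ^ 'n. \<forall>i. \<bar>of_int (v $ i)\<bar> \<le> (M::real)}"
  using finite_vec_coords(1)[OF finite_int_abs_le[of M]] by simp

lemma finite_truncated:
  assumes "\<And>z i. z \<in> Z \<Longrightarrow> 1 \<le> z $ i"
  shows "finite {z \<in> Z. \<forall>i. of_int (z $ i) \<le> (L::real)}"
proof (rule finite_subset)
  show "{z \<in> Z. \<forall>i. of_int (z $ i) \<le> L} \<subseteq> {v. \<forall>i. \<bar>of_int (v $ i)\<bar> \<le> L}"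
  proof clarify
    fix z i assume "z \<in> Z" "\<forall>i. of_int (z $ i) \<le> L"
    moreover from this have "1 \<le> z $ i" using assms by blast
    ultimately show "\<bar>of_int (z $ i)\<bar> \<le> L" by simp
  qed
qed simp

section \<open>Pairs ordered by their smallest or largest coordinates\<close>

definition min_coord :: "int ^ 4 \<Rightarrow> int" where
  "min_coord z = Min (range (($) z))"

lemma min_coord_le: "min_coord z \<le> z $ i"
  by (simp add: min_coord_def)

lemma min_coord_attained: obtains i where "min_coord z = z $ i"
proof -
  have "min_coord z \<in> range (($) z)" unfolding min_coord_def by (rule Min_in) auto
  then show thesis using that by auto
qed

lemma max_abs_attained: obtains i where "max_abs z = \<bar>z $ i\<bar>"
proof -
  have "max_abs z \<in> range (\<lambda>i. \<bar>z $ i\<bar>)" unfolding max_abs_def by (rule Max_in) auto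
  then show thesis using that by auto
qed

lemma max_abs_ge: "\<bar>z $ i\<bar> \<le> max_abs z"
  by (simp add: max_abs_def)

lemma min_coord_power_le:
  assumes "\<And>i. 1 \<le> z $ i"
  shows "min_coord z ^ 4 \<le> prod (($) z) UNIV"
proof -
  have "1 \<le> min_coord z" using assms min_coord_attained[of z] by metis
  then have "(\<Prod>i\<in>(UNIV :: 4 set). min_coord z) \<le> prod (($) z) UNIV"
    by (intro prod_mono) (simp add: min_coord_le)
  then show ?thesis by simp
qed

text \<open>A relation with non-zero integral leading coefficient bounds the square of the largest
  coordinate by T times the sum of two other squares, so at most one coordinate can be
  small.\<close>

lemma max_abs_cube_le:
  assumes pos: "\<And>i. 1 \<le> z $ i" and cf: "conic_family T {z}" and T: "T \<ge> 1"
  shows "of_int (max_abs z) ^ 3 \<le> 2 * T * of_int (prod (($) z) UNIV)"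
proof -
  obtain i where i: "max_abs z = \<bar>z $ i\<bar>" using max_abs_attained .
  define x where "x r = real_of_int (z $ r)" for r
  have x1: "x r \<ge> 1" for r using pos[of r] by (simp add: x_def)
  have m: "of_int (max_abs z) = x i" using pos[of i] by (simp add: i x_def)
  have two: "(x i)\<^sup>2 \<le> T * ((x r)\<^sup>2 + (x s)\<^sup>2)" if d: "distinct [i, r, s]" for r s
  proof -
    obtain a b c where abc: "a \<noteq> 0" "\<bar>of_int b\<bar> \<le> T" "\<bar>of_int c\<bar> \<le> T"
      "a * (z $ i)\<^sup>2 + b * (z $ r)\<^sup>2 + c * (z $ s)\<^sup>2 = 0"
      using cf d unfolding conic_family_def by (metis singletonI)
    have "of_int a * (x i)\<^sup>2 + of_int b * (x r)\<^sup>2 + of_int c * (x s)\<^sup>2 = 0"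
      using arg_cong[OF abc(4), of real_of_int] by (simp add: x_def)
    then have "\<bar>of_int a * (x i)\<^sup>2\<bar> = \<bar>of_int b * (x r)\<^sup>2 + of_int c * (x s)\<^sup>2\<bar>" by linarith
    also have "\<dots> \<le> \<bar>of_int b\<bar> * (x r)\<^sup>2 + \<bar>of_int c\<bar> * (x s)\<^sup>2"
      using abs_triangle_ineq[of "of_int b * (x r)\<^sup>2" "of_int c * (x s)\<^sup>2"] by (simp add: abs_mult)
    also have "\<dots> \<le> T * (x r)\<^sup>2 + T * (x s)\<^sup>2" using abc by (intro add_mono mult_right_mono) auto
    finally have "\<bar>of_int a\<bar> * (x i)\<^sup>2 \<le> T * ((x r)\<^sup>2 + (x s)\<^sup>2)" by (simp add: abs_mult algebra_simps)
    moreover have "1 \<le> \<bar>real_of_int a\<bar>" using abc(1) by linarith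
    then have "1 * (x i)\<^sup>2 \<le> \<bar>of_int a\<bar> * (x i)\<^sup>2" by (intro mult_right_mono) auto
    ultimately show ?thesis by simp
  qed
  obtain j k l where d: "distinct [i, j, k, l]" using ex_distinct_4 .
  have sq: "u\<^sup>2 + v\<^sup>2 \<le> 2 * (u * v * w)" if "1 \<le> u" "1 \<le> v" "u \<le> w" "v \<le> w" for u v w :: real
  proof -
    have "u * u * 1 \<le> u * w * v" "v * v * 1 \<le> v * w * u" using that by (intro mult_mono; simp)+
    then show ?thesis by (simp add: power2_eq_square mult_ac)
  qed
  have "(x i)\<^sup>2 \<le> T * (2 * (x j * x k * x l))"
  proof -
    \<comment> \<open>The relation is chosen to avoid the largest of the remaining three
      coordinates: the sum of the squares of the two smaller ones is at most twice the product of
      all three.\<close>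
    consider "x j \<le> x l" "x k \<le> x l" | "x j \<le> x k" "x l \<le> x k" | "x k \<le> x j" "x l \<le> x j" by linarith
    then show ?thesis
    proof cases
      case 1
      have "(x i)\<^sup>2 \<le> T * ((x j)\<^sup>2 + (x k)\<^sup>2)" using d by (intro two) auto
      also have "\<dots> \<le> T * (2 * (x j * x k * x l))" using sq[OF x1 x1 1] T by (intro mult_left_mono) auto
      finally show ?thesis .
    next
      case 2
      have "(x i)\<^sup>2 \<le> T * ((x j)\<^sup>2 + (x l)\<^sup>2)" using d by (intro two) auto
      also have "\<dots> \<le> T * (2 * (x j * x l * x k))" using sq[OF x1 x1 2] T by (intro mult_left_mono) auto
      finally show ?thesis by (simp add: mult_ac)
    next
      case 3
      have "(x i)\<^sup>2 \<le> T * ((x k)\<^sup>2 + (x l)\<^sup>2)" using d by (intro two) auto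
      also have "\<dots> \<le> T * (2 * (x k * x l * x j))" using sq[OF x1 x1 3] T by (intro mult_left_mono) auto
      finally show ?thesis by (simp add: mult_ac)
    qed
  qed
  then have "x i * (x i)\<^sup>2 \<le> x i * (T * (2 * (x j * x k * x l)))" using x1[of i] by (intro mult_left_mono) auto
  then show ?thesis unfolding m prod_UNIV_4[OF d] by (simp add: x_def power3_eq_cube power2_eq_square mult_ac)
qed

text \<open>The dyadic count with the smallest coordinates as weights and s = 1: the fourth powers
  of the two minima have product at most L.\<close>

lemma card_bounded_pairs_le_fourth_root:
  fixes \<epsilon> :: real
  assumes "\<epsilon> > 0"
  obtains C where "C > 0"
    "\<And>Z W T L. positive_family T Z \<Longrightarrow> positive_family T W \<Longrightarrow> T \<ge> 1 \<Longrightarrow> L \<ge> 1 \<Longrightarrow>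
      real (card (bounded_pairs Z W L)) \<le> C * (T * L) powr \<epsilon> * L powr (1 / 4)"
proof -
  \<comment> \<open>From T * L^2 <= (T * L)^2, the squared constant of the coordinate count costs
    the exponent 4 * \<open>\<eta>\<close>; the logarithm costs one more
    \<open>\<eta>\<close>.\<close>
  define \<eta> where "\<eta> = \<epsilon> / 5"
  have \<eta>: "\<eta> > 0" using assms by (simp add: \<eta>_def)
  obtain C where C: "C > 0" "\<And>Z T M U. conic_family T Z \<Longrightarrow> (\<And>z i. z \<in> Z \<Longrightarrow> 1 \<le> z $ i \<and> of_int (z $ i) \<le> M) \<Longrightarrow> finite Z \<Longrightarrow>
      T \<ge> 1 \<Longrightarrow> M \<ge> 1 \<Longrightarrow> U \<ge> 1 \<Longrightarrow>
      real (card {z \<in> Z. \<exists>i. of_int (z $ i) \<le> U}) \<le> C * (T * M ^ 2) powr \<eta> * U"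
    using card_small_coordinate[OF \<eta>] by blast
  define K where "K = 1 + 1 / (\<eta> * ln 2)"
  have K: "K > 0" using \<eta> by (auto simp: K_def intro!: add_pos_pos)
  show thesis
  proof (rule that[of "C\<^sup>2 * 2 * K"])
    show "C\<^sup>2 * 2 * K > 0" using C K by simp
    fix Z W :: "(int ^ 4) set" and T L :: real
    assume pf: "positive_family T Z" "positive_family T W" and T: "T \<ge> 1" and L: "L \<ge> 1"
    have cf: "conic_family T Z" "conic_family T W"
      and pos: "\<And>z i. z \<in> Z \<Longrightarrow> 1 \<le> z $ i" "\<And>w i. w \<in> W \<Longrightarrow> 1 \<le> w $ i"
      using pf by (auto simp: positive_family_def)
    define Z' where "Z' = {z \<in> Z. \<forall>i. of_int (z $ i) \<le> L}"
    define W' where "W' = {w \<in> W. \<forall>i. of_int (w $ i) \<le> L}"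
    have fin: "finite Z'" "finite W'" unfolding Z'_def W'_def by (intro finite_truncated pos; assumption)+
    have cf': "conic_family T Z'" "conic_family T W'"
      using cf by (auto simp: Z'_def W'_def intro: conic_family_subset)
    define c where "c = C * (T * L ^ 2) powr \<eta>"
    define U where "U = L powr (1 / 4)"
    have U: "U \<ge> 1" using L by (simp add: U_def ge_one_powr_ge_zero)
    define R where "R = {(z, w) \<in> Z' \<times> W'. real_of_int (min_coord z) * real_of_int (min_coord w) \<le> U}"
    have cnt: "real (card {z \<in> V. real_of_int (min_coord z) \<le> t}) \<le> c * t powr 1"
      if V: "V = Z' \<or> V = W'" and t: "t \<ge> 1" for V t
    proof -
      have "card {z \<in> V. real_of_int (min_coord z) \<le> t} \<le> card {z \<in> V. \<exists>i. real_of_int (z $ i) \<le> t}"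
        using V fin by (intro card_mono) (auto, (metis min_coord_attained)+)
      also have "real \<dots> \<le> C * (T * L ^ 2) powr \<eta> * t"
        using V cf' fin pos T L t by (intro C(2)) (auto simp: Z'_def W'_def)
      finally show ?thesis using t by (simp add: c_def)
    qed
    have "bounded_pairs Z W L \<subseteq> R"
    proof
      fix s assume s: "s \<in> bounded_pairs Z W L"
      then have s': "s \<in> Z' \<times> W'"
        using bounded_pairs_truncate[OF pos, where L = L] unfolding Z'_def W'_def by blast
      obtain z w where zw: "s = (z, w)" by (cases s)
      have zp: "\<And>i. 1 \<le> z $ i" "\<And>i. 1 \<le> w $ i" using s' pos zw by (auto simp: Z'_def W'_def)
      have m1: "1 \<le> min_coord z" "1 \<le> min_coord w"
        using zp min_coord_attained[of z] min_coord_attained[of w] by metis+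
      have p0: "0 \<le> prod (($) z) UNIV" using zp by (intro prod_nonneg) (auto intro: order_trans[of 0 1])
      have "min_coord z ^ 4 * min_coord w ^ 4 \<le> prod (($) z) UNIV * prod (($) w) UNIV"
        using min_coord_power_le[OF zp(1)] min_coord_power_le[OF zp(2)] p0 by (intro mult_mono) auto
      then have "real_of_int (min_coord z ^ 4 * min_coord w ^ 4) \<le> real_of_int (prod (($) z) UNIV * prod (($) w) UNIV)"
        by (simp only: of_int_le_iff)
      also have "\<dots> \<le> L" using s by (simp add: zw bounded_pairs_def)
      finally have "(real_of_int (min_coord z) * real_of_int (min_coord w)) ^ 4 \<le> L"
        by (simp add: power_mult_distrib)
      also have "L = U ^ 4" using L by (simp add: U_def powr_power)
      finally have "real_of_int (min_coord z) * real_of_int (min_coord w) \<le> U"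
        using U by (subst (asm) power_mono_iff) (use m1 in auto)
      then show "s \<in> R" using s' by (simp add: R_def zw)
    qed
    moreover have finR: "finite R" unfolding R_def by (rule finite_subset[of _ "Z' \<times> W'"]) (use fin in auto)
    ultimately have "card (bounded_pairs Z W L) \<le> card R" by (intro card_mono)
    also have "real (card R) \<le> c\<^sup>2 * 2 powr 1 * U powr 1 * (1 + log 2 U)"
      unfolding R_def
    proof (rule card_weighted_pairs_le[OF fin])
      show "1 \<le> real_of_int (min_coord z)" if "z \<in> Z'" for z
        using that pos min_coord_attained[of z] by (auto simp: Z'_def) (metis)
      show "1 \<le> real_of_int (min_coord z)" if "z \<in> W'" for z
        using that pos min_coord_attained[of z] by (auto simp: W'_def) (metis)
    qed (use C U cnt in \<open>auto simp: c_def\<close>)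
    also have "\<dots> \<le> c\<^sup>2 * 2 powr 1 * U powr 1 * (K * U powr \<eta>)"
      using log_powr_bound[OF \<eta> U] by (intro mult_left_mono) (auto simp: K_def)
    also have "\<dots> = C\<^sup>2 * 2 * K * (((T * L ^ 2) powr \<eta>)\<^sup>2 * U powr \<eta>) * U"
      using U by (simp add: c_def power_mult_distrib mult_ac)
    also have "\<dots> \<le> C\<^sup>2 * 2 * K * (T * L) powr \<epsilon> * U"
    proof (intro mult_right_mono mult_left_mono)
      have TL: "T * L \<ge> 1" using T L mult_mono[of 1 T 1 L] by simp
      have "T * L ^ 2 \<le> T ^ 2 * L ^ 2" using T self_le_power[of T 2] by (intro mult_right_mono) auto
      then have "(T * L ^ 2) powr \<eta> \<le> ((T * L) ^ 2) powr \<eta>"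
        using \<eta> T L by (intro powr_mono2) (auto simp: power_mult_distrib)
      also have "(T * L) ^ 2 = (T * L) powr 2" using TL by simp
      also have "((T * L) powr 2) powr \<eta> = (T * L) powr (2 * \<eta>)" by (simp only: powr_powr)
      finally have "((T * L ^ 2) powr \<eta>)\<^sup>2 \<le> ((T * L) powr (2 * \<eta>))\<^sup>2" by (intro power_mono) auto
      also have "\<dots> = (T * L) powr (4 * \<eta>)" by (simp add: power2_eq_square flip: powr_add)
      finally have 1: "((T * L ^ 2) powr \<eta>)\<^sup>2 \<le> (T * L) powr (4 * \<eta>)" .
      have "U \<le> L powr 1" unfolding U_def using L by (intro powr_mono) auto
      also have "\<dots> \<le> T * L" using T L by simp
      finally have 2: "U powr \<eta> \<le> (T * L) powr \<eta>" using U \<eta> by (intro powr_mono2) auto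
      have "((T * L ^ 2) powr \<eta>)\<^sup>2 * U powr \<eta> \<le> (T * L) powr (4 * \<eta>) * (T * L) powr \<eta>"
        by (intro mult_mono 1 2) auto
      also have "\<dots> = (T * L) powr \<epsilon>" by (simp add: \<eta>_def flip: powr_add)
      finally show "((T * L ^ 2) powr \<eta>)\<^sup>2 * U powr \<eta> \<le> (T * L) powr \<epsilon>" .
    qed (use C K U in auto)
    finally show "real (card (bounded_pairs Z W L)) \<le> C\<^sup>2 * 2 * K * (T * L) powr \<epsilon> * L powr (1 / 4)"
      by (simp add: U_def)
  qed
qed

text \<open>The bootstrapping step: any bound \<open>count\<close> already known for points of
  bounded height is inserted into the dyadic count with the largest coordinates as weights.
  \<open>U\<close> arises from multiplying \<open>max_abs_cube_le\<close> for the two points of a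
  pair.\<close>

lemma card_bounded_pairs_le_of_count:
  fixes c s T L :: real
  assumes pf: "positive_family T Z" "positive_family T W" and T: "T \<ge> 1" and L: "L \<ge> 1" and c: "c \<ge> 0"
    and count: "\<And>V t. height_family T t V \<Longrightarrow> t \<ge> 1 \<Longrightarrow> real (card V) \<le> c * t powr s"
  defines "U \<equiv> (4 * T\<^sup>2 * L) powr (1 / 3)"
  shows "real (card (bounded_pairs Z W L)) \<le> c\<^sup>2 * 2 powr s * U powr s * (1 + log 2 U)"
proof -
  have cf: "conic_family T Z" "conic_family T W"
    and pos: "\<And>z i. z \<in> Z \<Longrightarrow> 1 \<le> z $ i" "\<And>w i. w \<in> W \<Longrightarrow> 1 \<le> w $ i"
    and cop: "\<And>z. z \<in> Z \<Longrightarrow> coprime_coords z" "\<And>w. w \<in> W \<Longrightarrow> coprime_coords w"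
    using pf by (auto simp: positive_family_def)
  define Z' where "Z' = {z \<in> Z. \<forall>i. of_int (z $ i) \<le> L}"
  define W' where "W' = {w \<in> W. \<forall>i. of_int (w $ i) \<le> L}"
  have fin: "finite Z'" "finite W'" unfolding Z'_def W'_def by (intro finite_truncated pos; assumption)+
  have T2: "T\<^sup>2 \<ge> 1" using T by (rule one_le_power)
  have TL: "4 * T\<^sup>2 * L \<ge> 1" using T2 L mult_mono[of 1 "4 * T\<^sup>2" 1 L] by simp
  then have U: "U \<ge> 1" unfolding U_def by (intro ge_one_powr_ge_zero) auto
  define R where "R = {(z, w) \<in> Z' \<times> W'. real_of_int (max_abs z) * real_of_int (max_abs w) \<le> U}"
  have cnt: "real (card {z \<in> V. real_of_int (max_abs z) \<le> t}) \<le> c * t powr s"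
    if V: "V = Z' \<or> V = W'" and t: "t \<ge> 1" for V t
  proof (rule count[OF _ t])
    have "conic_family T {z \<in> V. real_of_int (max_abs z) \<le> t}"
      using V cf by (auto simp: Z'_def W'_def intro: conic_family_subset)
    moreover have "coprime_coords x" if "x \<in> V" for x using that V cop by (auto simp: Z'_def W'_def)
    moreover have "\<bar>real_of_int (x $ i)\<bar> \<le> t" if "real_of_int (max_abs x) \<le> t" for x i
    proof -
      have "real_of_int \<bar>x $ i\<bar> \<le> real_of_int (max_abs x)" by (simp only: of_int_le_iff max_abs_ge)
      then show ?thesis using that by simp
    qed
    ultimately show "height_family T t {z \<in> V. real_of_int (max_abs z) \<le> t}" by (simp add: height_family_def)
  qed
  have mx1: "1 \<le> max_abs z" if "\<And>i. 1 \<le> z $ i" for z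
    using that[of 1] max_abs_ge[of z 1] by linarith
  have "bounded_pairs Z W L \<subseteq> R"
  proof
    fix s assume s: "s \<in> bounded_pairs Z W L"
    then have s': "s \<in> Z' \<times> W'"
      using bounded_pairs_truncate[OF pos, where L = L] unfolding Z'_def W'_def by blast
    obtain z w where zw: "s = (z, w)" by (cases s)
    have zp: "\<And>i. 1 \<le> z $ i" "\<And>i. 1 \<le> w $ i" using s' pos zw by (auto simp: Z'_def W'_def)
    have cfz: "conic_family T {z}" "conic_family T {w}"
      using s' cf zw by (auto simp: Z'_def W'_def intro: conic_family_subset)
    have p0: "0 \<le> prod (($) z) UNIV" using zp by (intro prod_nonneg) (auto intro: order_trans[of 0 1])
    have m0: "0 \<le> real_of_int (max_abs z)" "0 \<le> real_of_int (max_abs w)" 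
      using mx1[OF zp(1)] mx1[OF zp(2)] by auto
    have "real_of_int (max_abs z) ^ 3 * real_of_int (max_abs w) ^ 3
        \<le> (2 * T * of_int (prod (($) z) UNIV)) * (2 * T * of_int (prod (($) w) UNIV))"
      using m0 T p0 by (intro mult_mono max_abs_cube_le zp cfz) (auto simp del: of_int_prod)
    also have "\<dots> = 4 * T\<^sup>2 * (of_int (prod (($) z) UNIV) * of_int (prod (($) w) UNIV))"
      by (simp add: power2_eq_square mult_ac)
    also have "\<dots> \<le> 4 * T\<^sup>2 * L" using s by (intro mult_left_mono) (auto simp: zw bounded_pairs_def)
    also have "\<dots> = U powr 3" unfolding U_def powr_powr using TL by simp
    also have "\<dots> = U ^ 3" using U by simp
    finally have "(real_of_int (max_abs z) * real_of_int (max_abs w)) ^ 3 \<le> U ^ 3"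
      by (simp add: power_mult_distrib)
    then have "real_of_int (max_abs z) * real_of_int (max_abs w) \<le> U"
      using U by (subst (asm) power_mono_iff) (use m0 in auto)
    then show "s \<in> R" using s' by (simp add: R_def zw)
  qed
  moreover have finR: "finite R" unfolding R_def by (rule finite_subset[of _ "Z' \<times> W'"]) (use fin in auto)
  ultimately have "card (bounded_pairs Z W L) \<le> card R" by (intro card_mono)
  also have "real (card R) \<le> c\<^sup>2 * 2 powr s * U powr s * (1 + log 2 U)"
    unfolding R_def
  proof (rule card_weighted_pairs_le[OF fin])
    show "1 \<le> real_of_int (max_abs z)" if "z \<in> Z'" for z
      using that pos mx1[of z] by (auto simp: Z'_def)
    show "1 \<le> real_of_int (max_abs z)" if "z \<in> W'" for z
      using that pos mx1[of z] by (auto simp: W'_def)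
  qed (use c U cnt in auto)
  finally show ?thesis by simp
qed

section \<open>Counting pairs of points\<close>

text \<open>The Plucker coordinates of the line through the points of squares of x and y.\<close>

definition sqminor :: "int ^ 4 \<Rightarrow> int ^ 4 \<Rightarrow> 4 \<Rightarrow> 4 \<Rightarrow> int" where
  "sqminor x y i j = (x $ i)\<^sup>2 * (y $ j)\<^sup>2 - (x $ j)\<^sup>2 * (y $ i)\<^sup>2"

lemma sqminor_eq: "sqminor x y i j = minor x y i j * perm2 x y i j"
  by (simp add: sqminor_def minor_def perm2_def power2_eq_square algebra_simps)

text \<open>The relation for i, j, l at two points eliminates the square with index i and leaves a
  proportion between the minors ij and il. Such steps, combined with ij = - ji, connect any two
  index pairs with factors that do not depend on the points.\<close>

lemma sqminor_proportional:
  assumes cf: "conic_family T P" and ij: "i \<noteq> j" and kl: "k \<noteq> l"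
  obtains u v where "u \<noteq> 0" "v \<noteq> 0" "\<And>x y. x \<in> P \<Longrightarrow> y \<in> P \<Longrightarrow> u * sqminor x y i j = v * sqminor x y k l"
proof -
  define R where "R i j k l \<longleftrightarrow> (\<exists>u v. u \<noteq> 0 \<and> v \<noteq> 0 \<and> (\<forall>x\<in>P. \<forall>y\<in>P. u * sqminor x y i j = v * sqminor x y k l))"
    for i j k l
  have swap: "R i j j i" for i j
    unfolding R_def by (rule exI[of _ 1], rule exI[of _ "-1"]) (simp add: sqminor_def)
  have refl: "R i j i j" for i j
    unfolding R_def by (rule exI[of _ 1], rule exI[of _ 1]) simp
  have trans: "R i j m n" if tr: "R i j k l" "R k l m n" for i j k l m n
  proof -
    obtain u v where "u \<noteq> 0" "v \<noteq> 0" and uv: "\<forall>x\<in>P. \<forall>y\<in>P. u * sqminor x y i j = v * sqminor x y k l"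
      using tr(1) unfolding R_def by auto
    obtain u' v' where "u' \<noteq> 0" "v' \<noteq> 0" and uv': "\<forall>x\<in>P. \<forall>y\<in>P. u' * sqminor x y k l = v' * sqminor x y m n"
      using tr(2) unfolding R_def by auto
    have "u * u' * sqminor x y i j = v * v' * sqminor x y m n" if xy: "x \<in> P" "y \<in> P" for x y
    proof -
      have "u * u' * sqminor x y i j = u' * (u * sqminor x y i j)" by simp
      also have "\<dots> = v * (u' * sqminor x y k l)" using uv xy by simp
      also have "\<dots> = v * v' * sqminor x y m n" using uv' xy by simp
      finally show ?thesis .
    qed
    moreover have "u * u' \<noteq> 0" "v * v' \<noteq> 0"
      using \<open>u \<noteq> 0\<close> \<open>v \<noteq> 0\<close> \<open>u' \<noteq> 0\<close> \<open>v' \<noteq> 0\<close> by auto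
    ultimately show ?thesis unfolding R_def
      by (intro exI[of _ "u * u'"] exI[of _ "v * v'"] conjI ballI)
  qed
  have step: "R i j i l" if "i \<noteq> j" "i \<noteq> l" for i j l
  proof (cases "j = l")
    case True
    then show ?thesis using refl by simp
  next
    case False
    then have "distinct [i, j, l]" using that by auto
    then obtain a b c where abc: "b \<noteq> 0" "c \<noteq> 0" "\<And>x. x \<in> P \<Longrightarrow> a * (x $ i)\<^sup>2 + b * (x $ j)\<^sup>2 + c * (x $ l)\<^sup>2 = 0"
      using cf unfolding conic_family_def by metis
    have "b * sqminor x y i j = - c * sqminor x y i l" if "x \<in> P" "y \<in> P" for x y
    proof -
      have "b * sqminor x y i j + c * sqminor x y i l = (x $ i)\<^sup>2 * (a * (y $ i)\<^sup>2 + b * (y $ j)\<^sup>2 + c * (y $ l)\<^sup>2)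
          - (y $ i)\<^sup>2 * (a * (x $ i)\<^sup>2 + b * (x $ j)\<^sup>2 + c * (x $ l)\<^sup>2)"
        by (simp add: sqminor_def algebra_simps)
      then show ?thesis by (simp add: abc(3) that)
    qed
    moreover have "- c \<noteq> 0" using abc by simp
    ultimately show ?thesis unfolding R_def using abc(1)
      by (intro exI[of _ b] exI[of _ "- c"] conjI ballI)
  qed
  have "R i j k l"
  proof (cases "i = k")
    case True
    then show ?thesis using step[of i j l] ij kl by simp
  next
    case False
    then have "R i j i k" "R k i k l" using step ij kl by auto
    then show ?thesis using trans[OF trans[OF \<open>R i j i k\<close> swap]] by simp
  qed
  then obtain u v where "u \<noteq> 0" "v \<noteq> 0" and uv: "\<forall>x\<in>P. \<forall>y\<in>P. u * sqminor x y i j = v * sqminor x y k l"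
    unfolding R_def by auto
  then show thesis by (intro that[of u v]) auto
qed

lemma sqminor_zero_imp_all_zero:
  assumes "conic_family T P" "x \<in> P" "y \<in> P" "i \<noteq> j" "sqminor x y i j = 0"
  shows "sqminor x y k l = 0"
proof (cases "k = l")
  case False
  obtain u v where "u \<noteq> 0" "v \<noteq> 0" "u * sqminor x y i j = v * sqminor x y k l"
    using sqminor_proportional[OF assms(1,4) False] assms(2,3) by metis
  then show ?thesis using assms(5) by simp
qed (simp add: sqminor_def)

lemma sqminor_cross_eq:
  assumes "conic_family T P" "x \<in> P" "y \<in> P" "x' \<in> P" "y' \<in> P" "i \<noteq> j" "k \<noteq> l"
  shows "sqminor x y i j * sqminor x' y' k l = sqminor x y k l * sqminor x' y' i j"
proof -
  obtain u v where uv: "u \<noteq> 0" "v \<noteq> 0" "\<And>x y. x \<in> P \<Longrightarrow> y \<in> P \<Longrightarrow> u * sqminor x y i j = v * sqminor x y k l"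
    using sqminor_proportional[OF assms(1,6,7)] by metis
  have "u * v * (sqminor x y i j * sqminor x' y' k l) = (u * sqminor x y i j) * (v * sqminor x' y' k l)" by simp
  also have "\<dots> = (v * sqminor x y k l) * (u * sqminor x' y' i j)" using uv assms by simp
  finally have "u * v * (sqminor x y i j * sqminor x' y' k l) = u * v * (sqminor x y k l * sqminor x' y' i j)" by simp
  then show ?thesis using uv by simp
qed

text \<open>A relation whose coefficients come from two points of the family instead of from the
  curve: for points of height at most B they are at most B^4, and for the reference pair they divide
  \<open>Q\<close>.\<close>

lemma sqminor_three_term:
  assumes "conic_family T P" "x \<in> P" "x' \<in> P" "y' \<in> P" "distinct [i, j, l]"
  shows "sqminor x' y' j l * (x $ i)\<^sup>2 - sqminor x' y' i l * (x $ j)\<^sup>2 + sqminor x' y' i j * (x $ l)\<^sup>2 = 0"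
proof -
  obtain a b c where abc: "a \<noteq> 0" "\<And>x. x \<in> P \<Longrightarrow> a * (x $ i)\<^sup>2 + b * (x $ j)\<^sup>2 + c * (x $ l)\<^sup>2 = 0"
    using assms(1,5) unfolding conic_family_def by metis
  define E where "E x = a * (x $ i)\<^sup>2 + b * (x $ j)\<^sup>2 + c * (x $ l)\<^sup>2" for x :: "int ^ 4"
  \<comment> \<open>The bracket is the determinant of the squares of x, x', y' in the columns i, j,
    l; multiplication by a allows the column i to be replaced by the values of the relation, which
    vanish.\<close>
  have "a * (sqminor x' y' j l * (x $ i)\<^sup>2 - sqminor x' y' i l * (x $ j)\<^sup>2 + sqminor x' y' i j * (x $ l)\<^sup>2) =
      E x * sqminor x' y' j l - E x' * sqminor x y' j l + E y' * sqminor x x' j l"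
    by (simp add: E_def sqminor_def algebra_simps)
  also have "\<dots> = 0" using abc(2) assms by (simp add: E_def)
  finally show ?thesis using abc(1) by simp
qed

lemma abs_eq_of_sqminor_zero:
  assumes "coprime_coords x" "coprime_coords y" "\<And>i j. sqminor x y i j = 0"
  shows "\<bar>x $ i\<bar> = \<bar>y $ i\<bar>"
proof -
  have *: "\<bar>x $ i * y $ j\<bar> = \<bar>y $ i * x $ j\<bar>" for i j
  proof -
    have "(x $ i * y $ j)\<^sup>2 = (y $ i * x $ j)\<^sup>2"
      using assms(3)[of i j] by (simp add: sqminor_def power_mult_distrib)
    then show ?thesis by (simp add: power2_eq_iff) (metis abs_minus_cancel)
  qed
  have "x $ i dvd Gcd (range (\<lambda>j. y $ i * x $ j))"
  proof (rule Gcd_greatest)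
    fix t assume "t \<in> range (\<lambda>j. y $ i * x $ j)"
    then obtain j where "t = y $ i * x $ j" by auto
    then have "\<bar>t\<bar> = \<bar>x $ i * y $ j\<bar>" using *[of i j] by simp
    then show "x $ i dvd t" by (metis dvd_abs_iff dvd_triv_left)
  qed
  then have 1: "x $ i dvd y $ i" using Gcd_range_scale[OF assms(1), of "y $ i"] by simp
  have "y $ i dvd Gcd (range (\<lambda>j. x $ i * y $ j))"
  proof (rule Gcd_greatest)
    fix t assume "t \<in> range (\<lambda>j. x $ i * y $ j)"
    then obtain j where "t = x $ i * y $ j" by auto
    then have "\<bar>t\<bar> = \<bar>y $ i * x $ j\<bar>" using *[of i j] by simp
    then show "y $ i dvd t" by (metis dvd_abs_iff dvd_triv_left)
  qed
  then have "y $ i dvd x $ i" using Gcd_range_scale[OF assms(2), of "x $ i"] by simp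
  with 1 show ?thesis by (rule zdvd_antisym_abs)
qed

lemma card_same_abs_le:
  fixes c :: "int ^ 4"
  shows "finite {v :: int ^ 4. \<forall>i. \<bar>v $ i\<bar> = \<bar>c $ i\<bar>}" "card {v :: int ^ 4. \<forall>i. \<bar>v $ i\<bar> = \<bar>c $ i\<bar>} \<le> 16"
proof -
  let ?S = "{v :: int ^ 4. \<forall>i. \<bar>v $ i\<bar> = \<bar>c $ i\<bar>}"
  let ?f = "\<lambda>v :: int ^ 4. (\<chi> i. v $ i = c $ i) :: bool ^ 4"
  have inj: "inj_on ?f ?S"
  proof (rule inj_onI)
    fix u v assume uv: "u \<in> ?S" "v \<in> ?S" "?f u = ?f v"
    have "u $ i = v $ i" for i
    proof -
      have "(u $ i = c $ i) = (v $ i = c $ i)" using uv(3) by (simp add: vec_eq_iff)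
      moreover have "\<bar>u $ i\<bar> = \<bar>c $ i\<bar>" "\<bar>v $ i\<bar> = \<bar>c $ i\<bar>" using uv by auto
      ultimately show ?thesis by (auto simp: abs_eq_iff)
    qed
    then show "u = v" by (simp add: vec_eq_iff)
  qed
  have b: "finite {v :: bool ^ 4. \<forall>i. v $ i \<in> UNIV}" "card {v :: bool ^ 4. \<forall>i. v $ i \<in> UNIV} = 16"
    using finite_vec_coords[of "UNIV :: bool set", where 'n = 4] by simp_all
  show "finite ?S" by (rule inj_on_finite[OF inj _ b(1)]) auto
  show "card ?S \<le> 16" using card_inj_on_le[OF inj _ b(1)] b(2) by simp
qed

text \<open>A prime outside \<open>Q\<close> divides no minor of the reference pair, so by
  proportionality all minors of x, y have the same valuation. If it divided two coordinates of one
  point, the three-term relation would make it divide all of them, against primitivity. If it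
  divides the minors and a coordinate of x, it divides the same coordinate of y, so a single
  exceptional index m serves both points.\<close>

lemma compat_pair_of_family:
  assumes cf: "conic_family T P" and P: "x0 \<in> P" "y0 \<in> P" "x \<in> P" "y \<in> P"
    and cop: "coprime_coords x" "coprime_coords y"
    and nz: "sqminor x0 y0 1 2 \<noteq> 0" "sqminor x y 1 2 \<noteq> 0"
    and Q: "even Q" "\<And>i j. i \<noteq> j \<Longrightarrow> nat \<bar>sqminor x0 y0 i j\<bar> dvd Q"
  shows "compat_pair Q x y"
proof -
  have nz0: "sqminor x0 y0 i j \<noteq> 0" and nz1: "sqminor x y i j \<noteq> 0" if "i \<noteq> j" for i j
    using sqminor_zero_imp_all_zero[OF cf] P nz that by metis+
  have "\<exists>e. (\<forall>i j. i \<noteq> j \<longrightarrow> multiplicity p (nat \<bar>minor x y i j\<bar>) + multiplicity p (nat \<bar>perm2 x y i j\<bar>) = e) \<and>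
        (e > 0 \<longrightarrow> (\<exists>m. \<forall>i. i \<noteq> m \<longrightarrow> \<not> int p dvd x $ i \<and> \<not> int p dvd y $ i))"
    if p: "prime p" "\<not> p dvd Q" for p
  proof -
    have ip: "prime (int p)" using p by simp
    have p0: "\<not> int p dvd sqminor x0 y0 i j" if "i \<noteq> j" for i j
    proof
      assume "int p dvd sqminor x0 y0 i j"
      then have "p dvd nat \<bar>sqminor x0 y0 i j\<bar>" by (simp add: dvd_nat_abs_iff)
      then show False using Q(2)[OF that] p(2) by (meson dvd_trans)
    qed
    define v where "v n = multiplicity p (nat \<bar>n\<bar>)" for n :: int
    have v_mult: "v (a * b) = v a + v b" if "a \<noteq> 0" "b \<noteq> 0" for a b
      using that p by (simp add: v_def abs_mult nat_mult_distrib prime_elem_multiplicity_mult_distrib)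
    have v0: "v n = 0" if "\<not> int p dvd n" for n
      using that unfolding v_def by (intro not_dvd_imp_multiplicity_0) (simp add: dvd_nat_abs_iff)
    have vk: "v (sqminor x y i j) = v (sqminor x y 1 2)" if "i \<noteq> j" for i j
    proof -
      have "v (sqminor x y i j * sqminor x0 y0 1 2) = v (sqminor x y 1 2 * sqminor x0 y0 i j)"
        using sqminor_cross_eq[OF cf P(3,4,1,2) that, of 1 2] by simp
      then show ?thesis using that by (simp add: v_mult nz0 nz1 v0 p0)
    qed
    have vs: "v (minor x y i j) + v (perm2 x y i j) = v (sqminor x y 1 2)" if "i \<noteq> j" for i j
      using vk[OF that] nz1[OF that] by (simp add: sqminor_eq v_mult)
    have atmost: "i = j" if u: "u \<in> P" "coprime_coords u" "int p dvd u $ i" "int p dvd u $ j" for u i j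
    proof (rule ccontr)
      assume ij: "i \<noteq> j"
      have "int p dvd u $ l" for l
      proof (cases "l = i \<or> l = j")
        case False
        then have d: "distinct [i, j, l]" using ij by auto
        have "sqminor x0 y0 i j * (u $ l)\<^sup>2 = sqminor x0 y0 i l * (u $ j)\<^sup>2 - sqminor x0 y0 j l * (u $ i)\<^sup>2"
          using sqminor_three_term[OF cf u(1) P(1,2) d] by linarith
        moreover have "int p dvd \<dots>" using u by (simp add: power2_eq_square)
        ultimately have "int p dvd sqminor x0 y0 i j * (u $ l)\<^sup>2" by simp
        then show ?thesis using p0[OF ij] ip by (auto simp: prime_dvd_mult_iff prime_dvd_power_iff)
      qed (use u in auto)
      then have "int p dvd Gcd (range (($) u))" by (intro Gcd_greatest) auto
      then show False using u(2) ip by (simp add: coprime_coords_def)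
    qed
    have "\<exists>m. \<forall>i. i \<noteq> m \<longrightarrow> \<not> int p dvd x $ i \<and> \<not> int p dvd y $ i" if e: "v (sqminor x y 1 2) > 0"
    proof -
      have pk: "int p dvd sqminor x y i j" if "i \<noteq> j" for i j
        using v0[of "sqminor x y i j"] vk[OF that] e by auto
      show ?thesis
      proof (cases "\<exists>m. int p dvd x $ m")
        case True
        then obtain m where m: "int p dvd x $ m" by auto
        obtain j where j: "j \<noteq> m" by (metis one_neq_zero)
        have xj: "\<not> int p dvd x $ j" using atmost[OF P(3) cop(1) m, of j] j by auto
        have "int p dvd sqminor x y m j" using pk j by auto
        then have "int p dvd (x $ m)\<^sup>2 * (y $ j)\<^sup>2 - sqminor x y m j" using m by (simp add: power2_eq_square)
        then have "int p dvd (x $ j)\<^sup>2 * (y $ m)\<^sup>2" by (simp add: sqminor_def)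
        then have ym: "int p dvd y $ m" using xj ip by (auto simp: prime_dvd_mult_iff prime_dvd_power_iff)
        show ?thesis using atmost[OF P(3) cop(1) m] atmost[OF P(4) cop(2) ym] by metis
      next
        case False
        show ?thesis
        proof (cases "\<exists>m. int p dvd y $ m")
          case True
          then obtain m where m: "int p dvd y $ m" by auto
          show ?thesis using False atmost[OF P(4) cop(2) m] by metis
        next
          case ny: False
          then show ?thesis using False by auto
        qed
      qed
    qed
    then show ?thesis using vs unfolding v_def by (intro exI[of _ "multiplicity p (nat \<bar>sqminor x y 1 2\<bar>)"]) auto
  qed
  then show ?thesis unfolding compat_pair_def using Q(1) nz1 by (auto simp: sqminor_eq)
qed

section \<open>Half points and the curves that carry them\<close>

lemma ex_two_more:
  fixes i j :: 4
  assumes "i \<noteq> j"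
  obtains k l where "distinct [i, j, k, l]"
proof -
  have "card (UNIV - {i, j}) = 2" using assms by (simp add: card_Diff_subset)
  then obtain k l where "UNIV - {i, j} = {k, l}" "k \<noteq> l" by (auto simp: card_2_iff)
  then show thesis using assms by (intro that[of k l]) auto
qed

text \<open>The signed bad parts of the minors. Diagonal entries get the default value 0, for which
  \<open>smooth_ints\<close> makes room.\<close>

definition minor_coeffs :: "nat \<Rightarrow> int ^ 4 \<Rightarrow> int ^ 4 \<Rightarrow> int ^ 4 ^ 4" where
  "minor_coeffs Q x y = (\<chi> i j. if i = j then 0 else minor x y i j div int (gminor Q x y i j))"

definition perm_coeffs :: "nat \<Rightarrow> int ^ 4 \<Rightarrow> int ^ 4 \<Rightarrow> int ^ 4 ^ 4" where
  "perm_coeffs Q x y = (\<chi> i j. if i = j then 0 else perm2 x y i j div int (gperm Q x y i j))"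

lemma int_div_good_part:
  fixes n :: int
  assumes "n \<noteq> 0"
  shows "n = n div int (good_part Q (nat \<bar>n\<bar>)) * int (good_part Q (nat \<bar>n\<bar>))"
    "nat \<bar>n div int (good_part Q (nat \<bar>n\<bar>))\<bar> = bad_part Q (nat \<bar>n\<bar>)"
proof -
  let ?g = "good_part Q (nat \<bar>n\<bar>)"
  have e: "bad_part Q (nat \<bar>n\<bar>) * ?g = nat \<bar>n\<bar>" using assms by (intro bad_part_times_good_part) simp
  then have "?g dvd nat \<bar>n\<bar>" by (metis dvd_triv_right)
  then have "int ?g dvd n" by (simp add: dvd_nat_abs_iff)
  then show 1: "n = n div int ?g * int ?g" by simp
  have "nat \<bar>n div int ?g\<bar> * ?g = nat \<bar>n div int ?g * int ?g\<bar>" by (simp add: abs_mult nat_mult_distrib)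
  also have "\<dots> = bad_part Q (nat \<bar>n\<bar>) * ?g" using 1 e by simp
  finally have "nat \<bar>n div int ?g\<bar> * ?g = bad_part Q (nat \<bar>n\<bar>) * ?g" .
  then show "nat \<bar>n div int ?g\<bar> = bad_part Q (nat \<bar>n\<bar>)"
    using good_part_pos[of Q "nat \<bar>n\<bar>"] by (metis less_irrefl mult_cancel2)
qed

lemma bad_part_smooth:
  assumes "n > 0" "real n \<le> X" "Q > 0"
  shows "bad_part Q n \<in> smooth_upto (prime_factors Q) X"
proof -
  have e: "bad_part Q n * good_part Q n = n" using assms by (intro bad_part_times_good_part)
  then have pos: "bad_part Q n > 0" using assms(1) by (cases "bad_part Q n") auto
  have "bad_part Q n \<le> n" using e assms(1) by (metis dvd_imp_le dvd_triv_left)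
  moreover have "prime_factorization (bad_part Q n) = filter_mset (\<lambda>p. p dvd Q) (prime_factorization n)"
    unfolding bad_part_def by (rule prime_factorization_prod_mset_primes) auto
  then have "prime_factors (bad_part Q n) \<subseteq> prime_factors Q"
    using assms(3) by (auto simp: in_prime_factors_iff)
  ultimately show ?thesis using pos assms(2) by (simp add: smooth_upto_def)
qed

text \<open>The coefficients involve bad parts only, so that all pairs with the same bad parts have
  their half points on the same curve. Coprimality of the first two coordinates is a convenient form
  of primitivity.\<close>

definition half_family :: "int ^ 4 ^ 4 \<Rightarrow> int ^ 4 ^ 4 \<Rightarrow> (int ^ 4) set" where
  "half_family A B = {z. (\<forall>i. 1 \<le> z $ i) \<and> coprime (z $ 1) (z $ 2) \<and>
     (\<forall>i j k l. distinct [i, j, k, l] \<longrightarrow>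
       B $ i $ j * A $ k $ l * (z $ j)\<^sup>2 + B $ i $ k * A $ l $ j * (z $ k)\<^sup>2 + B $ i $ l * A $ j $ k * (z $ l)\<^sup>2 = 0)}"

definition half_point :: "nat \<Rightarrow> int ^ 4 \<Rightarrow> int ^ 4 \<Rightarrow> int ^ 4" where
  "half_point Q x y = (\<chi> i. int (half_coord Q x y i))"

lemma minor_coeffs_times_gminor:
  assumes "compat_pair Q x y" "i \<noteq> j"
  shows "minor x y i j = minor_coeffs Q x y $ i $ j * int (gminor Q x y i j)"
    "perm2 x y i j = perm_coeffs Q x y $ i $ j * int (gperm Q x y i j)"
proof -
  have "minor x y i j \<noteq> 0" "perm2 x y i j \<noteq> 0" using assms by (auto simp: compat_pair_def)
  then show "minor x y i j = minor_coeffs Q x y $ i $ j * int (gminor Q x y i j)"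
    "perm2 x y i j = perm_coeffs Q x y $ i $ j * int (gperm Q x y i j)"
    using int_div_good_part(1) assms(2) by (simp_all add: minor_coeffs_def perm_coeffs_def gminor_def gperm_def)
qed

text \<open>By the factor identities each term of a three-term identity between minors and
  \<open>perm2\<close> is divisible by (z i)^2 * W; division leaves bad parts times single
  squares.\<close>

lemma half_point_in_half_family:
  assumes c: "compat_pair Q x y"
  shows "half_point Q x y \<in> half_family (minor_coeffs Q x y) (perm_coeffs Q x y)"
proof -
  define z where "z = half_coord Q x y"
  define W where "W = int (half_coord Q x (flip1 y) 1 * half_coord Q x (flip1 y) 2 * half_coord Q x (flip1 y) 3 * half_coord Q x (flip1 y) 4)"
  have W: "W \<noteq> 0" by (simp add: W_def)
  have "perm_coeffs Q x y $ i $ j * minor_coeffs Q x y $ k $ l * (int (z j))\<^sup>2 + perm_coeffs Q x y $ i $ k * minor_coeffs Q x y $ l $ j * (int (z k))\<^sup>2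
      + perm_coeffs Q x y $ i $ l * minor_coeffs Q x y $ j $ k * (int (z l))\<^sup>2 = 0" if d: "distinct [i, j, k, l]" for i j k l
  proof -
    have d1: "distinct [i, j, k, l]" and d2: "distinct [i, k, l, j]" and d3: "distinct [i, l, j, k]"
      using d by auto
    have g: "perm2 x y i r * minor x y s t = (int (z i))\<^sup>2 * W * (perm_coeffs Q x y $ i $ r * minor_coeffs Q x y $ s $ t * (int (z r))\<^sup>2)"
      if d': "distinct [i, r, s, t]" for r s t
    proof -
      have "int (gperm Q x y i r * gminor Q x y s t) = (int (z i))\<^sup>2 * (int (z r))\<^sup>2 * W"
        unfolding factor_identities(1)[OF c d'] by (simp add: W_def z_def)
      moreover have "perm2 x y i r = perm_coeffs Q x y $ i $ r * int (gperm Q x y i r)"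
        "minor x y s t = minor_coeffs Q x y $ s $ t * int (gminor Q x y s t)"
        using d' by (intro minor_coeffs_times_gminor c; simp)+
      then have "perm2 x y i r * minor x y s t = perm_coeffs Q x y $ i $ r * minor_coeffs Q x y $ s $ t * int (gperm Q x y i r * gminor Q x y s t)"
        by simp
      ultimately show ?thesis by simp
    qed
    \<comment> \<open>The factors of x i and y i on the left are 3 by 3 determinants with a repeated
      row.\<close>
    have "perm2 x y i j * minor x y k l + perm2 x y i k * minor x y l j + perm2 x y i l * minor x y j k = 0"
      by (simp add: minor_def perm2_def algebra_simps)
    then have "(int (z i))\<^sup>2 * W * (perm_coeffs Q x y $ i $ j * minor_coeffs Q x y $ k $ l * (int (z j))\<^sup>2 + perm_coeffs Q x y $ i $ k * minor_coeffs Q x y $ l $ j * (int (z k))\<^sup>2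
      + perm_coeffs Q x y $ i $ l * minor_coeffs Q x y $ j $ k * (int (z l))\<^sup>2) = 0"
      using g[OF d1] g[OF d2] g[OF d3] by (simp add: distrib_left)
    moreover have "z i \<noteq> 0" unfolding z_def using half_coord_pos[of Q x y i] by simp
    ultimately show ?thesis using W by simp
  qed
  moreover have "1 \<le> int (half_coord Q x y i)" for i using half_coord_pos[of Q x y i] by linarith
  ultimately show ?thesis
    using factor_identities(3)[OF c] by (simp add: half_family_def half_point_def z_def)
qed

lemma coprime_coords_half_family:
  assumes "z \<in> half_family A B"
  shows "coprime_coords z"
proof -
  have "Gcd (range (($) z)) dvd gcd (z $ 1) (z $ 2)" by (intro gcd_greatest Gcd_dvd) auto
  also have "gcd (z $ 1) (z $ 2) = 1" using assms by (simp add: half_family_def)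
  finally have "is_unit (Gcd (range (($) z)))" .
  then show ?thesis unfolding coprime_coords_def using Gcd_int_greater_eq_0[of "range (($) z)"] by simp
qed

lemma positive_half_family:
  assumes "\<And>i j. i \<noteq> j \<Longrightarrow> A $ i $ j \<noteq> 0 \<and> \<bar>of_int (A $ i $ j)\<bar> \<le> D"
    and "\<And>i j. i \<noteq> j \<Longrightarrow> B $ i $ j \<noteq> 0 \<and> \<bar>of_int (B $ i $ j)\<bar> \<le> D"
  shows "positive_family (D\<^sup>2) (half_family A B)"
proof -
  have "conic_family (D\<^sup>2) (half_family A B)"
    unfolding conic_family_def
  proof (intro allI impI)
    fix i j k :: 4 assume d: "distinct [i, j, k]"
    then obtain l where l: "distinct [l, i, j, k]" by (rule ex_fourth)
    have bd: "B $ r $ s * A $ t $ u \<noteq> 0 \<and> \<bar>of_int (B $ r $ s * A $ t $ u)\<bar> \<le> D\<^sup>2" if "r \<noteq> s" "t \<noteq> u" for r s t u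
    proof -
      have "\<bar>real_of_int (B $ r $ s)\<bar> * \<bar>real_of_int (A $ t $ u)\<bar> \<le> D * D"
        using assms(1)[OF that(2)] assms(2)[OF that(1)] by (intro mult_mono) auto
      then show ?thesis using assms(1)[OF that(2)] assms(2)[OF that(1)] by (simp add: abs_mult power2_eq_square)
    qed
    have "\<forall>z\<in>half_family A B. B $ l $ i * A $ j $ k * (z $ i)\<^sup>2 + B $ l $ j * A $ k $ i * (z $ j)\<^sup>2 + B $ l $ k * A $ i $ j * (z $ k)\<^sup>2 = 0"
      using l by (auto simp: half_family_def)
    then show "\<exists>a b c. a \<noteq> 0 \<and> b \<noteq> 0 \<and> c \<noteq> 0 \<and> \<bar>of_int a\<bar> \<le> D\<^sup>2 \<and> \<bar>of_int b\<bar> \<le> D\<^sup>2 \<and> \<bar>of_int c\<bar> \<le> D\<^sup>2 \<and>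
        (\<forall>x\<in>half_family A B. a * (x $ i)\<^sup>2 + b * (x $ j)\<^sup>2 + c * (x $ k)\<^sup>2 = 0)"
      using bd[of l i j k] bd[of l j k i] bd[of l k i j] l d by (metis distinct_length_2_or_more)
  qed
  then show ?thesis using coprime_coords_half_family by (auto simp: positive_family_def half_family_def)
qed

text \<open>For f = F k l, h = F 1 j and m = G 1 j, the identities for y, for \<open>flip1 y\<close>
  and for a single index pair give the products m * f, h * f and h * m in terms of the half points,
  and f^2 * (h * m) = (m * f) * (h * f) then determines f. The index 1 is special because the flip
  exchanges minors and \<open>perm2\<close> exactly for the pairs containing it.\<close>

lemma gminor_gperm_determined:
  assumes c: "compat_pair Q x y" "compat_pair Q x' y'"
    and z: "half_point Q x y = half_point Q x' y'" and w: "half_point Q x (flip1 y) = half_point Q x' (flip1 y')"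
    and ij: "i \<noteq> j"
  shows "gminor Q x y i j = gminor Q x' y' i j \<and> gperm Q x y i j = gperm Q x' y' i j"
proof -
  have half_coord: "half_coord Q x' y' = half_coord Q x y" "half_coord Q x' (flip1 y') = half_coord Q x (flip1 y)"
    using z w by (auto simp: half_point_def vec_eq_iff fun_eq_iff)
  note I = factor_identities(1)[OF c(1)] factor_identities(1)[OF c(2), unfolded half_coord]
  note J = factor_identities(2)[OF c(1)] factor_identities(2)[OF c(2), unfolded half_coord]
  note I' = factor_identities(1)[OF compat_pair_flip1[OF c(1)]] factor_identities(1)[OF compat_pair_flip1[OF c(2)], unfolded half_coord]
  have main: "gminor Q x y k l = gminor Q x' y' k l \<and> gperm Q x y k l = gperm Q x' y' k l \<and>
      gminor Q x y 1 j = gminor Q x' y' 1 j \<and> gperm Q x y 1 j = gperm Q x' y' 1 j" if d: "distinct [1, j, k, l]" for j k l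
  proof -
    define f f' h h' m m' g g' where
      "f = gminor Q x y k l" and "f' = gminor Q x' y' k l" and "h = gminor Q x y 1 j" and "h' = gminor Q x' y' 1 j"
      and "m = gperm Q x y 1 j" and "m' = gperm Q x' y' 1 j" and "g = gperm Q x y k l" and "g' = gperm Q x' y' k l"
    have pos: "f > 0" "f' > 0" "h > 0" "h' > 0" "m > 0" "m' > 0" "g > 0" "g' > 0"
      by (simp_all add: f_def f'_def h_def h'_def m_def m'_def g_def g'_def)
    have 1: "m * f = m' * f'" unfolding m_def f_def m'_def f'_def using I[OF d] by simp
    have 2: "h * f = h' * f'" unfolding h_def f_def h'_def f'_def
      using I'[OF d] d by (simp add: gminor_flip1 gperm_flip1 half_coord)
    have 3: "h * m = h' * m'" unfolding h_def m_def h'_def m'_def using J[of 1 j] d by simp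
    have 4: "f * g = f' * g'" unfolding f_def g_def f'_def g'_def using J[of k l] d by simp
    have "(h * m) * f\<^sup>2 = (m * f) * (h * f)" by (simp add: power2_eq_square)
    also have "\<dots> = (h' * m') * f'\<^sup>2" unfolding 1 2 by (simp add: power2_eq_square)
    finally have "f\<^sup>2 = f'\<^sup>2" unfolding 3 using pos by simp
    then have f: "f = f'" by simp
    then have "m = m'" "h = h'" "g = g'" using 1 2 4 pos by auto
    with f show ?thesis by (simp add: f_def f'_def h_def h'_def m_def m'_def g_def g'_def)
  qed
  have sym: "gminor Q u v j i = gminor Q u v i j \<and> gperm Q u v j i = gperm Q u v i j" for u v i j
    using gminor_commute gperm_commute by blast
  show ?thesis
  proof (cases "i = 1 \<or> j = 1")
    case True
    then obtain r where r: "r \<noteq> 1" "(i = 1 \<and> j = r) \<or> (i = r \<and> j = 1)" using ij by auto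
    obtain k l where "distinct [1, r, k, l]" using ex_two_more[of 1 r] r(1) by metis
    then show ?thesis using main[of r k l] r(2) sym by metis
  next
    case False
    then have "distinct [1, i, j]" using ij by auto
    then obtain r where "distinct [r, 1, i, j]" by (rule ex_fourth)
    then have "distinct [1, r, i, j]" by auto
    then show ?thesis using main by blast
  qed
qed

lemma minor_perm2_determined:
  assumes c: "compat_pair Q x y" "compat_pair Q x' y'"
    and key: "minor_coeffs Q x y = minor_coeffs Q x' y'" "perm_coeffs Q x y = perm_coeffs Q x' y'"
    and z: "half_point Q x y = half_point Q x' y'" and w: "half_point Q x (flip1 y) = half_point Q x' (flip1 y')"
    and ij: "i \<noteq> j"
  shows "x $ i * y $ j = x' $ i * y' $ j"
proof -
  have "minor x y i j = minor x' y' i j" "perm2 x y i j = perm2 x' y' i j"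
    using minor_coeffs_times_gminor[OF c(1) ij] minor_coeffs_times_gminor[OF c(2) ij] gminor_gperm_determined[OF c z w ij] key by auto
  then have "2 * (x $ i * y $ j) = 2 * (x' $ i * y' $ j)" by (simp add: minor_def perm2_def)
  then show ?thesis by simp
qed

lemma compat_pair_nonzero:
  assumes "compat_pair Q x y" "i \<noteq> j"
  shows "x $ i \<noteq> 0 \<or> x $ j \<noteq> 0" "y $ i \<noteq> 0 \<or> y $ j \<noteq> 0"
proof -
  have "minor x y i j \<noteq> 0" using assms by (simp add: compat_pair_def)
  then show "x $ i \<noteq> 0 \<or> x $ j \<noteq> 0" "y $ i \<noteq> 0 \<or> y $ j \<noteq> 0" by (auto simp: minor_def)
qed

text \<open>Products are known for distinct indices only. For an index a at which neither y nor y'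
  vanishes, they show that x and x' have proportional entries at two indices b and c other than a;
  so one minor of squares vanishes, and then all of them do.\<close>

lemma abs_eq_of_products_eq:
  assumes cf: "conic_family T P" and P: "x \<in> P" "x' \<in> P" and cop: "coprime_coords x" "coprime_coords x'"
    and nz: "\<And>i j. i \<noteq> j \<Longrightarrow> y $ i \<noteq> 0 \<or> y $ j \<noteq> 0" "\<And>i j. i \<noteq> j \<Longrightarrow> y' $ i \<noteq> 0 \<or> y' $ j \<noteq> 0"
    and eq: "\<And>i j. i \<noteq> j \<Longrightarrow> x $ i * y $ j = x' $ i * y' $ j"
  shows "\<bar>x $ i\<bar> = \<bar>x' $ i\<bar>"
proof -
  have zero: "\<exists>i. \<forall>j. j \<noteq> i \<longrightarrow> v $ j \<noteq> 0" if "\<And>i j. i \<noteq> j \<Longrightarrow> v $ i \<noteq> 0 \<or> v $ j \<noteq> 0" for v :: "int ^ 4"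
    using that by metis
  obtain r s where r: "\<And>j. j \<noteq> r \<Longrightarrow> y $ j \<noteq> 0" and s: "\<And>j. j \<noteq> s \<Longrightarrow> y' $ j \<noteq> 0"
    using zero[of y] zero[of y'] nz by metis
  obtain a where "a \<noteq> r" "a \<noteq> s"
  proof -
    obtain j k l where "distinct [r, j, k, l]" using ex_distinct_4 .
    then show thesis using that[of j] that[of k] by (cases "j = s") auto
  qed
  then have a: "y $ a \<noteq> 0" "y' $ a \<noteq> 0" using r s by auto
  obtain b c d where d: "distinct [a, b, c, d]" using ex_distinct_4 .
  have "(x $ b * y $ a) * (x' $ c * y' $ a) = (x' $ b * y' $ a) * (x $ c * y $ a)"
  proof -
    have e: "x $ b * y $ a = x' $ b * y' $ a" "x $ c * y $ a = x' $ c * y' $ a"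
      using d by (intro eq; auto)+
    show ?thesis by (simp only: e)
  qed
  then have "(y $ a * y' $ a) * (x $ b * x' $ c) = (y $ a * y' $ a) * (x $ c * x' $ b)" by (simp only: mult_ac)
  then have "x $ b * x' $ c = x $ c * x' $ b" using a by simp
  then have "sqminor x x' b c = 0" by (simp add: sqminor_def flip: power_mult_distrib)
  then have "sqminor x x' i j = 0" for i j using sqminor_zero_imp_all_zero[OF cf P, of b c] d by auto
  then show ?thesis by (intro abs_eq_of_sqminor_zero cop)
qed

lemma abs_sqminor_le:
  fixes B :: real
  assumes "\<And>i. \<bar>of_int (x $ i)\<bar> \<le> B" "\<And>i. \<bar>of_int (y $ i)\<bar> \<le> B"
  shows "\<bar>of_int (sqminor x y i j)\<bar> \<le> B ^ 4"
proof -
  have B: "B \<ge> 0" using assms(1)[of 1] by linarith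
  have sq: "0 \<le> (real_of_int u)\<^sup>2 \<and> (real_of_int u)\<^sup>2 \<le> B\<^sup>2" if "\<bar>of_int u\<bar> \<le> B" for u
    using that B by (simp add: abs_le_square_iff[symmetric])
  have "0 \<le> (real_of_int u)\<^sup>2 * (real_of_int v)\<^sup>2 \<and> (real_of_int u)\<^sup>2 * (real_of_int v)\<^sup>2 \<le> B ^ 4"
    if "\<bar>of_int u\<bar> \<le> B" "\<bar>of_int v\<bar> \<le> B" for u v
  proof -
    have "(real_of_int u)\<^sup>2 * (real_of_int v)\<^sup>2 \<le> B\<^sup>2 * B\<^sup>2"
      using sq[OF that(1)] sq[OF that(2)] by (intro mult_mono) auto
    then show ?thesis by (simp flip: power_add)
  qed
  note 1 = this[OF assms(1)[of i] assms(2)[of j]] and 2 = this[OF assms(1)[of j] assms(2)[of i]]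
  have "\<bar>u - v\<bar> \<le> c" if "0 \<le> u \<and> u \<le> c" "0 \<le> v \<and> v \<le> c" for u v c :: real
    using that by linarith
  from this[OF 1 2] show ?thesis by (simp add: sqminor_def)
qed

lemma abs_minor_perm2_le:
  fixes B :: real
  assumes "\<And>i. \<bar>of_int (x $ i)\<bar> \<le> B" "\<And>i. \<bar>of_int (y $ i)\<bar> \<le> B"
  shows "\<bar>of_int (minor x y i j)\<bar> \<le> 2 * B ^ 2" "\<bar>of_int (perm2 x y i j)\<bar> \<le> 2 * B ^ 2"
proof -
  have B: "B \<ge> 0" using assms(1)[of 1] by linarith
  have "\<bar>real_of_int (x $ i) * real_of_int (y $ j)\<bar> \<le> B ^ 2" for i j
    unfolding abs_mult power2_eq_square using assms B by (intro mult_mono) auto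
  from this[of i j] this[of j i]
  show "\<bar>of_int (minor x y i j)\<bar> \<le> 2 * B ^ 2" "\<bar>of_int (perm2 x y i j)\<bar> \<le> 2 * B ^ 2"
    by (auto simp: minor_def perm2_def abs_le_iff)
qed

definition smooth_ints :: "nat \<Rightarrow> real \<Rightarrow> int set" where
  "smooth_ints Q X = {t. t = 0 \<or> nat \<bar>t\<bar> \<in> smooth_upto (prime_factors Q) X}"

lemma card_smooth_ints:
  "finite (smooth_ints Q X)" "card (smooth_ints Q X) \<le> 1 + 2 * card (smooth_upto (prime_factors Q) X)"
proof -
  let ?S = "smooth_upto (prime_factors Q) X"
  have sub: "smooth_ints Q X \<subseteq> {0} \<union> (int ` ?S \<union> (\<lambda>n. - int n) ` ?S)"
  proof
    fix t assume "t \<in> smooth_ints Q X"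
    then consider "t = 0" | "nat \<bar>t\<bar> \<in> ?S" by (auto simp: smooth_ints_def)
    then show "t \<in> {0} \<union> (int ` ?S \<union> (\<lambda>n. - int n) ` ?S)"
    proof cases
      case 2
      have "t = int (nat \<bar>t\<bar>) \<or> t = - int (nat \<bar>t\<bar>)" by auto
      then show ?thesis using 2 by (metis UnI1 UnI2 image_eqI)
    qed simp
  qed
  then show "finite (smooth_ints Q X)" by (rule finite_subset) auto
  have "card (smooth_ints Q X) \<le> card ({0} \<union> (int ` ?S \<union> (\<lambda>n. - int n) ` ?S))"
    using sub by (intro card_mono) auto
  also have "\<dots> \<le> card {0::int} + (card (int ` ?S) + card ((\<lambda>n. - int n) ` ?S))"
    by (meson card_Un_le add_left_mono order_trans)
  also have "\<dots> \<le> 1 + (card ?S + card ?S)" by (intro add_mono card_image_le) auto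
  finally show "card (smooth_ints Q X) \<le> 1 + 2 * card ?S" by simp
qed

lemma minor_coeffs_perm_coeffs_smooth:
  fixes B :: real
  assumes c: "compat_pair Q x y" and Q: "Q > 0"
    and B: "\<And>i. \<bar>of_int (x $ i)\<bar> \<le> B" "\<And>i. \<bar>of_int (y $ i)\<bar> \<le> B"
  shows "minor_coeffs Q x y $ i $ j \<in> smooth_ints Q (2 * B ^ 2)" "perm_coeffs Q x y $ i $ j \<in> smooth_ints Q (2 * B ^ 2)"
proof -
  have *: "nat \<bar>n div int (good_part Q (nat \<bar>n\<bar>))\<bar> \<in> smooth_upto (prime_factors Q) (2 * B ^ 2)"
    if "n \<noteq> 0" "\<bar>of_int n\<bar> \<le> 2 * B ^ 2" for n
    unfolding int_div_good_part(2)[OF that(1)] using that Q by (intro bad_part_smooth) auto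
  show "minor_coeffs Q x y $ i $ j \<in> smooth_ints Q (2 * B ^ 2)"
    using *[of "minor x y i j"] c abs_minor_perm2_le(1)[OF B, of i j]
    by (auto simp: smooth_ints_def minor_coeffs_def gminor_def compat_pair_def)
  show "perm_coeffs Q x y $ i $ j \<in> smooth_ints Q (2 * B ^ 2)"
    using *[of "perm2 x y i j"] c abs_minor_perm2_le(2)[OF B, of i j]
    by (auto simp: smooth_ints_def perm_coeffs_def gperm_def compat_pair_def)
qed

lemma half_point_ge_1: "1 \<le> half_point Q x y $ i"
  using half_coord_pos[of Q x y i] by (simp add: half_point_def Suc_le_eq)

lemma minor_coeffs_perm_coeffs_sqminor:
  assumes c: "compat_pair Q x y" and ij: "i \<noteq> j"
  shows "\<bar>minor_coeffs Q x y $ i $ j * perm_coeffs Q x y $ i $ j\<bar> *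
    (prod (($) (half_point Q x y)) UNIV * prod (($) (half_point Q x (flip1 y))) UNIV) = \<bar>sqminor x y i j\<bar>"
proof -
  have d: "distinct [1, 2, 3, 4 :: 4]" by simp
  have "prod (($) (half_point Q x y)) UNIV * prod (($) (half_point Q x (flip1 y))) UNIV = int (gminor Q x y i j * gperm Q x y i j)"
    unfolding factor_identities(2)[OF c ij] prod_UNIV_4[OF d] by (simp add: half_point_def)
  moreover have "\<bar>sqminor x y i j\<bar> = \<bar>minor_coeffs Q x y $ i $ j * perm_coeffs Q x y $ i $ j\<bar> * int (gminor Q x y i j * gperm Q x y i j)"
    unfolding sqminor_eq minor_coeffs_times_gminor[OF c ij] by (simp add: abs_mult)
  ultimately show ?thesis by simp
qed

lemma abs_sqminor_flip1: "\<bar>sqminor x (flip1 y) i j\<bar> = \<bar>sqminor x y i j\<bar>"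
  by (simp add: sqminor_def flip1_def)

text \<open>Pairs with vanishing minors differ by signs only and give the term 16 *
  \<open>card P\<close>. Every other pair is keyed by its bad parts; within a fibre it is determined
  by its two half points up to 16 * 16 choices of signs.\<close>

lemma pair_count:
  fixes \<epsilon> :: real
  assumes "\<epsilon> > 0"
  obtains C where "C > 0"
    "\<And>T P B \<Xi>. height_family T B P \<Longrightarrow> B \<ge> 1 \<Longrightarrow> \<Xi> \<ge> 0 \<Longrightarrow>
      (\<And>D Z W. 1 \<le> D \<Longrightarrow> D \<le> B ^ 4 \<Longrightarrow> positive_family (D\<^sup>2) Z \<Longrightarrow> positive_family (D\<^sup>2) W \<Longrightarrow>
         real (card (bounded_pairs Z W (B ^ 4 / D))) \<le> \<Xi>) \<Longrightarrow>
      (real (card P))\<^sup>2 \<le> 16 * real (card P) + C * B powr \<epsilon> * \<Xi>"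
proof -
  \<comment> \<open>The key consists of four matrices, hence 64 entries, each with about B powr (50
    * \<open>\<eta>\<close>) possible values; 64 * 50 = 3200.\<close>
  define \<eta> where "\<eta> = \<epsilon> / 3200"
  have \<eta>: "\<eta> > 0" using assms by (simp add: \<eta>_def)
  obtain C0 where C0: "C0 > 0"
    "\<And>Q X. Q > 0 \<Longrightarrow> X > 0 \<Longrightarrow> real (card (smooth_upto (prime_factors Q) X)) \<le> C0 * (X * real Q) powr \<eta>"
    using smooth_count[OF \<eta>] by blast
  define C1 where "C1 = 1 + 2 * C0 * 4 powr \<eta>"
  have C1: "C1 > 0" unfolding C1_def using C0(1) by (intro add_pos_pos mult_pos_pos) auto
  show thesis
  proof (rule that[of "C1 ^ 64 * 256"])
    show "C1 ^ 64 * 256 > 0" using C1 by simp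
    fix T :: real and P :: "(int ^ 4) set" and B \<Xi> :: real
    assume hf: "height_family T B P" and B: "B \<ge> 1" and \<Xi>: "\<Xi> \<ge> 0"
      and bound: "\<And>D Z W. 1 \<le> D \<Longrightarrow> D \<le> B ^ 4 \<Longrightarrow> positive_family (D\<^sup>2) Z \<Longrightarrow> positive_family (D\<^sup>2) W \<Longrightarrow>
         real (card (bounded_pairs Z W (B ^ 4 / D))) \<le> \<Xi>"
    have cf: "conic_family T P" and cop: "\<And>x. x \<in> P \<Longrightarrow> coprime_coords x"
      and PB: "\<And>x i. x \<in> P \<Longrightarrow> \<bar>of_int (x $ i)\<bar> \<le> B"
      using hf by (auto simp: height_family_def)
    have finP: "finite P"
      by (rule finite_subset[of _ "{v. \<forall>i. \<bar>of_int (v $ i)\<bar> \<le> B}"]) (use PB in auto)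
    define G where "G = {(x, y) \<in> P \<times> P. sqminor x y 1 2 \<noteq> 0}"
    define N where "N = {(x, y) \<in> P \<times> P. sqminor x y 1 2 = 0}"
    have finG: "finite G" and finN: "finite N"
      unfolding G_def N_def by (rule finite_subset[of _ "P \<times> P"], use finP in auto)+
    have "real (card N) \<le> real (card P) * 16"
    proof (rule card_le_card_keys[OF finN, of fst P])
      fix x assume x: "x \<in> P"
      have "{s \<in> N. fst s = x} \<subseteq> {x} \<times> {v. \<forall>i. \<bar>v $ i\<bar> = \<bar>x $ i\<bar>}"
      proof
        fix s assume s: "s \<in> {s \<in> N. fst s = x}"
        then obtain y where y: "s = (x, y)" "y \<in> P" "sqminor x y 1 2 = 0" by (auto simp: N_def)
        then have "sqminor x y i j = 0" for i j using sqminor_zero_imp_all_zero[OF cf x y(2), of 1 2] by auto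
        then have "\<bar>x $ i\<bar> = \<bar>y $ i\<bar>" for i using abs_eq_of_sqminor_zero cop x y(2) by blast
        then show "s \<in> {x} \<times> {v. \<forall>i. \<bar>v $ i\<bar> = \<bar>x $ i\<bar>}" using y(1) by auto
      qed
      then have "card {s \<in> N. fst s = x} \<le> card ({x} \<times> {v. \<forall>i. \<bar>v $ i\<bar> = \<bar>x $ i\<bar>})"
        by (intro card_mono finite_cartesian_product card_same_abs_le) auto
      also have "\<dots> \<le> 16" using card_same_abs_le(2)[of x] by (simp add: card_cartesian_product)
      finally show "real (card {s \<in> N. fst s = x}) \<le> 16" by simp
    qed (use finP in \<open>auto simp: N_def\<close>)
    moreover have "card G + card N = card P * card P"
    proof -
      have "G \<union> N = P \<times> P" "G \<inter> N = {}" by (auto simp: G_def N_def)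
      then show ?thesis using card_Un_disjoint[OF finG finN] by (simp add: card_cartesian_product)
    qed
    then have "real (card G) + real (card N) = (real (card P))\<^sup>2"
      by (simp add: power2_eq_square flip: of_nat_add of_nat_mult)
    moreover have "real (card G) \<le> C1 ^ 64 * 256 * B powr \<epsilon> * \<Xi>"
    proof (cases "G = {}")
      case True
      then show ?thesis using C1 \<Xi> by simp
    next
      case False
      then obtain x0 y0 where xy0: "x0 \<in> P" "y0 \<in> P" "sqminor x0 y0 1 2 \<noteq> 0" by (auto simp: G_def)
      have nz0: "sqminor x0 y0 i j \<noteq> 0" if "i \<noteq> j" for i j
        using sqminor_zero_imp_all_zero[OF cf xy0(1,2)] xy0(3) that by metis
      define I where "I = {p :: 4 \<times> 4. fst p \<noteq> snd p}"
      have cardI: "card I = 12"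
      proof -
        have "I = UNIV - (\<lambda>i. (i, i)) ` UNIV" by (auto simp: I_def)
        moreover have "card ((\<lambda>i. (i, i)) ` (UNIV :: 4 set)) = 4"
          by (subst card_image) (auto simp: inj_on_def)
        ultimately show ?thesis by (simp add: card_Diff_subset)
      qed
      \<comment> \<open>The factor 2 makes \<open>Q\<close> even. With 12 ordered index pairs,
        \<open>Q\<close> is at most 2 * B^48; together with the size 2 * B^2 of the entries this is
        the origin of the exponent 50.\<close>
      define Q where "Q = 2 * (\<Prod>(i, j)\<in>I. nat \<bar>sqminor x0 y0 i j\<bar>)"
      have Qdvd: "nat \<bar>sqminor x0 y0 i j\<bar> dvd Q" if "i \<noteq> j" for i j
      proof -
        have "(case (i, j) of (i, j) \<Rightarrow> nat \<bar>sqminor x0 y0 i j\<bar>) dvd (\<Prod>(i, j)\<in>I. nat \<bar>sqminor x0 y0 i j\<bar>)"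
          using that by (intro dvd_prodI) (auto simp: I_def)
        then show ?thesis by (simp add: Q_def)
      qed
      have Q0: "Q > 0" unfolding Q_def using nz0 by (auto simp: I_def intro!: prod_pos)
      have QB: "real Q \<le> 2 * (B ^ 4) ^ 12"
      proof -
        have "real (\<Prod>(i, j)\<in>I. nat \<bar>sqminor x0 y0 i j\<bar>) = (\<Prod>(i, j)\<in>I. real (nat \<bar>sqminor x0 y0 i j\<bar>))"
          by (simp add: case_prod_beta)
        also have "\<dots> \<le> (\<Prod>(i, j)\<in>I. B ^ 4)"
        proof (rule prod_mono, clarify)
          fix i j
          have "\<bar>of_int (sqminor x0 y0 i j)\<bar> \<le> B ^ 4" using PB xy0 by (intro abs_sqminor_le) auto
          then show "0 \<le> real (nat \<bar>sqminor x0 y0 i j\<bar>) \<and> real (nat \<bar>sqminor x0 y0 i j\<bar>) \<le> B ^ 4" by simp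
        qed
        also have "\<dots> = (B ^ 4) ^ 12" by (simp add: case_prod_beta cardI)
        finally show ?thesis by (simp add: Q_def)
      qed
      have compat: "compat_pair Q x y" if "(x, y) \<in> G" for x y
        using that by (intro compat_pair_of_family[OF cf xy0(1,2)] Qdvd xy0 cop) (auto simp: G_def Q_def)
      define t where "t = C1 * B powr (50 * \<eta>)"
      define S where "S = smooth_ints Q (2 * B ^ 2)"
      have S: "finite S" "real (card S) \<le> t"
      proof -
        show "finite S" by (simp add: S_def card_smooth_ints)
        have "2 * B ^ 2 * real Q \<le> 2 * B ^ 2 * (2 * (B ^ 4) ^ 12)" using QB B by (intro mult_left_mono) auto
        also have "\<dots> = 4 * B ^ 50" by (simp flip: power_mult power_add)
        finally have XQ: "2 * B ^ 2 * real Q \<le> 4 * B ^ 50" .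
        have "real (card (smooth_upto (prime_factors Q) (2 * B ^ 2))) \<le> C0 * (2 * B ^ 2 * real Q) powr \<eta>"
          using Q0 B by (intro C0(2)) auto
        also have "\<dots> \<le> C0 * (4 * B ^ 50) powr \<eta>"
          using XQ B C0(1) \<eta> by (intro mult_left_mono powr_mono2) auto
        also have "(4 * B ^ 50) powr \<eta> = 4 powr \<eta> * (B ^ 50) powr \<eta>" using B by (subst powr_mult) auto
        also have "(B ^ 50) powr \<eta> = B powr (50 * \<eta>)"
        proof -
          have "B ^ 50 = B powr 50" using B by simp
          then show ?thesis by (simp only: powr_powr)
        qed
        finally have "real (card (smooth_upto (prime_factors Q) (2 * B ^ 2))) \<le> C0 * (4 powr \<eta> * B powr (50 * \<eta>))" .
        moreover have "real (card S) \<le> 1 + 2 * real (card (smooth_upto (prime_factors Q) (2 * B ^ 2)))"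
          unfolding S_def using card_smooth_ints(2)[of Q "2 * B ^ 2"] by (simp flip: of_nat_Suc)
        moreover have "1 \<le> B powr (50 * \<eta>)" using B \<eta> by (simp add: ge_one_powr_ge_zero)
        ultimately show "real (card S) \<le> t" by (simp add: t_def C1_def algebra_simps)
      qed
      define V where "V = {v :: int ^ 4. \<forall>j. v $ j \<in> S}"
      have V: "finite V" "card V = card S ^ 4"
        unfolding V_def using finite_vec_coords[OF S(1), where 'n = 4] by simp_all
      define M where "M = {m :: int ^ 4 ^ 4. \<forall>i. m $ i \<in> V}"
      have M: "finite M" "card M = card S ^ 16"
        unfolding M_def using finite_vec_coords[OF V(1), where 'n = 4] V(2)
        by (simp_all flip: power_mult)
      define key where "key = (\<lambda>(x, y). (minor_coeffs Q x y, perm_coeffs Q x y, minor_coeffs Q x (flip1 y), perm_coeffs Q x (flip1 y)))"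
      have "real (card G) \<le> real (card (M \<times> M \<times> M \<times> M)) * (256 * \<Xi>)"
      proof (rule card_le_card_keys[OF finG])
        show "key ` G \<subseteq> M \<times> M \<times> M \<times> M"
        proof
          fix k assume "k \<in> key ` G"
          then obtain x y where xy: "(x, y) \<in> G" "k = key (x, y)" by auto
          have b: "\<And>i. \<bar>of_int (x $ i)\<bar> \<le> B" "\<And>i. \<bar>of_int (y $ i)\<bar> \<le> B" using xy PB by (auto simp: G_def)
          then have b': "\<bar>of_int (flip1 y $ i)\<bar> \<le> B" for i by (simp add: flip1_def)
          show "k \<in> M \<times> M \<times> M \<times> M"
            using minor_coeffs_perm_coeffs_smooth[OF compat[OF xy(1)] Q0 b]
              minor_coeffs_perm_coeffs_smooth[OF compat_pair_flip1[OF compat[OF xy(1)]] Q0 b(1) b']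
            by (simp add: xy(2) key_def M_def V_def S_def)
        qed
        show "finite (M \<times> M \<times> M \<times> M)" using M by auto
        fix k
        let ?F = "{s \<in> G. key s = k}"
        show "real (card ?F) \<le> 256 * \<Xi>"
        proof (cases "?F = {}")
          case True
          then show ?thesis unfolding True using \<Xi> by simp
        next
          case False
          then obtain x1 y1 where s1: "(x1, y1) \<in> G" "key (x1, y1) = k" by auto
          define A1 A2 B1 B2 where "A1 = minor_coeffs Q x1 y1" and "A2 = perm_coeffs Q x1 y1"
            and "B1 = minor_coeffs Q x1 (flip1 y1)" and "B2 = perm_coeffs Q x1 (flip1 y1)"
          have same: "minor_coeffs Q x y = A1" "perm_coeffs Q x y = A2" "minor_coeffs Q x (flip1 y) = B1" "perm_coeffs Q x (flip1 y) = B2"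
            if "(x, y) \<in> ?F" for x y
            using that s1 by (auto simp: key_def A1_def A2_def B1_def B2_def)
          \<comment> \<open>The largest bad part of a minor of squares. It bounds all entries of the
            matrices, and the minor attaining it bounds the product of the coordinates of the half
            points by B^4 / d.\<close>
          define d where "d = Max ((\<lambda>(i, j). \<bar>A1 $ i $ j * A2 $ i $ j\<bar>) ` I)"
          have d_ge: "\<bar>A1 $ i $ j * A2 $ i $ j\<bar> \<le> d" if "i \<noteq> j" for i j
            unfolding d_def using that by (intro Max_ge) (auto simp: I_def image_iff)
          have "I \<noteq> {}" using cardI by auto
          then have "d \<in> (\<lambda>(i, j). \<bar>A1 $ i $ j * A2 $ i $ j\<bar>) ` I"
            unfolding d_def by (intro Max_in) auto
          then obtain r q where rs: "r \<noteq> q" "d = \<bar>A1 $ r $ q * A2 $ r $ q\<bar>" by (auto simp: I_def)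
          have c1: "compat_pair Q x1 y1" and c1': "compat_pair Q x1 (flip1 y1)"
            using compat[OF s1(1)] compat_pair_flip1 by auto
          have zp: "1 \<le> prod (($) (half_point Q x y)) UNIV" for x y
            by (intro prod_ge_1) (simp add: half_point_ge_1)
          have nzk: "sqminor x1 y1 i j \<noteq> 0" if "i \<noteq> j" for i j
            using c1 that by (auto simp: compat_pair_def sqminor_eq)
          \<comment> \<open>The flip leaves the absolute values of the minors of squares and the two
            half points unchanged, apart from the order of the latter; hence the same
            \<open>d\<close> serves both curves.\<close>
          have eqAB: "\<bar>B1 $ i $ j * B2 $ i $ j\<bar> = \<bar>A1 $ i $ j * A2 $ i $ j\<bar>" if ij: "i \<noteq> j" for i j
          proof -
            define \<pi> where "\<pi> = prod (($) (half_point Q x1 y1)) UNIV * prod (($) (half_point Q x1 (flip1 y1))) UNIV"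
            have "half_point Q u v $ i \<noteq> 0" for u v i using half_point_ge_1[of Q u v i] by linarith
            then have "\<pi> \<noteq> 0" by (simp add: \<pi>_def)
            moreover have "\<bar>A1 $ i $ j * A2 $ i $ j\<bar> * \<pi> = \<bar>sqminor x1 y1 i j\<bar>"
              using minor_coeffs_perm_coeffs_sqminor[OF c1 ij] by (simp add: A1_def A2_def \<pi>_def)
            moreover have "\<bar>B1 $ i $ j * B2 $ i $ j\<bar> * \<pi> = \<bar>sqminor x1 y1 i j\<bar>"
              using minor_coeffs_perm_coeffs_sqminor[OF c1' ij] by (simp add: B1_def B2_def \<pi>_def abs_sqminor_flip1 mult.commute)
            ultimately show ?thesis by (metis mult_right_cancel)
          qed
          have A_nz: "A1 $ i $ j * A2 $ i $ j \<noteq> 0" if ij: "i \<noteq> j" for i j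
            using minor_coeffs_perm_coeffs_sqminor[OF c1 ij] nzk[OF ij] by (auto simp: A1_def A2_def)
          have B_nz: "B1 $ i $ j * B2 $ i $ j \<noteq> 0" if ij: "i \<noteq> j" for i j
            using eqAB[OF ij] A_nz[OF ij] by linarith
          have fac_le: "\<bar>u\<bar> \<le> d \<and> \<bar>v\<bar> \<le> d" if "\<bar>u * v\<bar> \<le> d" "u * v \<noteq> 0" for u v :: int
          proof -
            have "1 \<le> \<bar>u\<bar>" "1 \<le> \<bar>v\<bar>" using that(2) by auto
            then have "\<bar>u\<bar> * 1 \<le> \<bar>u\<bar> * \<bar>v\<bar>" "1 * \<bar>v\<bar> \<le> \<bar>u\<bar> * \<bar>v\<bar>"
              by (intro mult_left_mono mult_right_mono; simp)+
            then show ?thesis using that(1) by (simp add: abs_mult)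
          qed
          define D where "D = real_of_int d"
          have "1 \<le> d" using A_nz[OF rs(1)] rs(2) by linarith
          then have D1: "1 \<le> D" by (simp add: D_def)
          have cfA: "positive_family (D\<^sup>2) (half_family A1 A2)"
          proof (rule positive_half_family)
            fix i j :: 4 assume ij: "i \<noteq> j"
            have "\<bar>A1 $ i $ j\<bar> \<le> d \<and> \<bar>A2 $ i $ j\<bar> \<le> d" using fac_le d_ge[OF ij] A_nz[OF ij] by blast
            then show "A1 $ i $ j \<noteq> 0 \<and> \<bar>real_of_int (A1 $ i $ j)\<bar> \<le> D" "A2 $ i $ j \<noteq> 0 \<and> \<bar>real_of_int (A2 $ i $ j)\<bar> \<le> D"
              using A_nz[OF ij] unfolding D_def by (auto simp flip: of_int_abs)
          qed
          have cfB: "positive_family (D\<^sup>2) (half_family B1 B2)"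
          proof (rule positive_half_family)
            fix i j :: 4 assume ij: "i \<noteq> j"
            have "\<bar>B1 $ i $ j\<bar> \<le> d \<and> \<bar>B2 $ i $ j\<bar> \<le> d" using fac_le d_ge[OF ij] B_nz[OF ij] eqAB[OF ij] by metis
            then show "B1 $ i $ j \<noteq> 0 \<and> \<bar>real_of_int (B1 $ i $ j)\<bar> \<le> D" "B2 $ i $ j \<noteq> 0 \<and> \<bar>real_of_int (B2 $ i $ j)\<bar> \<le> D"
              using B_nz[OF ij] unfolding D_def by (auto simp flip: of_int_abs)
          qed
          define g where "g = (\<lambda>(x, y). (half_point Q x y, half_point Q x (flip1 y)))"
          have in_bp: "g s \<in> bounded_pairs (half_family A1 A2) (half_family B1 B2) (B ^ 4 / D)"
            and dle: "D \<le> B ^ 4" if s: "s \<in> ?F" for s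
          proof -
            obtain x y where xy: "s = (x, y)" by (cases s)
            have G: "(x, y) \<in> G" using s xy by auto
            define \<pi> where "\<pi> = prod (($) (half_point Q x y)) UNIV * prod (($) (half_point Q x (flip1 y))) UNIV"
            have "1 * 1 \<le> \<pi>" unfolding \<pi>_def using zp[of x y] zp[of x "flip1 y"] by (intro mult_mono) auto
            have "d * \<pi> = \<bar>sqminor x y r q\<bar>"
              using minor_coeffs_perm_coeffs_sqminor[OF compat[OF G] rs(1)] same[of x y] s xy by (simp add: \<pi>_def rs(2))
            moreover have "\<bar>of_int (sqminor x y r q)\<bar> \<le> B ^ 4" using G PB by (intro abs_sqminor_le) (auto simp: G_def)
            ultimately have "real_of_int (d * \<pi>) \<le> B ^ 4" by (metis of_int_abs)
            then have DP: "D * real_of_int \<pi> \<le> B ^ 4" by (simp add: D_def)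
            have "D * 1 \<le> D * real_of_int \<pi>" using \<open>1 * 1 \<le> \<pi>\<close> D1 by (intro mult_left_mono) auto
            then show "D \<le> B ^ 4" using DP by simp
            have "real_of_int \<pi> \<le> B ^ 4 / D" using DP D1 by (simp add: field_simps)
            then show "g s \<in> bounded_pairs (half_family A1 A2) (half_family B1 B2) (B ^ 4 / D)"
              using half_point_in_half_family[OF compat[OF G]] half_point_in_half_family[OF compat_pair_flip1[OF compat[OF G]]] same[of x y] s xy
              by (simp add: bounded_pairs_def g_def \<pi>_def)
          qed
          have pos: "1 \<le> z $ i" if "z \<in> half_family E1 E2" for z E1 E2 i using that by (simp add: half_family_def)
          have finb: "finite (bounded_pairs (half_family A1 A2) (half_family B1 B2) (B ^ 4 / D))"
            by (rule finite_subset[OF bounded_pairs_truncate])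
              (auto intro: pos intro!: finite_truncated)
          have "real (card ?F) \<le> real (card (bounded_pairs (half_family A1 A2) (half_family B1 B2) (B ^ 4 / D))) * 256"
          proof (rule card_le_card_keys[OF _ _ finb])
            show "finite ?F" using finG by simp
            show "g ` ?F \<subseteq> bounded_pairs (half_family A1 A2) (half_family B1 B2) (B ^ 4 / D)" using in_bp by blast
            fix zw
            let ?H = "{s \<in> ?F. g s = zw}"
            show "real (card ?H) \<le> 256"
            proof (cases "?H = {}")
              case True
              then show ?thesis unfolding True by simp
            next
              case False
              then obtain x y where xy: "(x, y) \<in> ?F" "g (x, y) = zw" by auto
              have "?H \<subseteq> {v. \<forall>i. \<bar>v $ i\<bar> = \<bar>x $ i\<bar>} \<times> {v. \<forall>i. \<bar>v $ i\<bar> = \<bar>y $ i\<bar>}"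
              proof
                fix s assume "s \<in> ?H"
                then obtain x' y' where xy': "s = (x', y')" "(x', y') \<in> ?F" "g (x', y') = zw" by (cases s) auto
                have G: "(x', y') \<in> G" "(x, y) \<in> G" using xy xy' by auto
                have inP: "x' \<in> P" "x \<in> P" "y' \<in> P" "y \<in> P" using G by (auto simp: G_def)
                have cc: "compat_pair Q x' y'" "compat_pair Q x y" using compat G by auto
                have eq: "x' $ i * y' $ j = x $ i * y $ j" if "i \<noteq> j" for i j
                  using same[OF xy(1)] same[OF xy'(2)] xy(2) xy'(3) that
                  by (intro minor_perm2_determined[OF cc]) (auto simp: g_def)
                have nz: "x $ i \<noteq> 0 \<or> x $ j \<noteq> 0" "y $ i \<noteq> 0 \<or> y $ j \<noteq> 0"
                  "x' $ i \<noteq> 0 \<or> x' $ j \<noteq> 0" "y' $ i \<noteq> 0 \<or> y' $ j \<noteq> 0" if "i \<noteq> j" for i j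
                  using compat_pair_nonzero[OF cc(1) that] compat_pair_nonzero[OF cc(2) that] by auto
                have "\<bar>x' $ i\<bar> = \<bar>x $ i\<bar>" for i
                  by (rule abs_eq_of_products_eq[OF cf inP(1,2) cop[OF inP(1)] cop[OF inP(2)] nz(4,2) eq])
                moreover have "\<bar>y' $ i\<bar> = \<bar>y $ i\<bar>" for i
                proof (rule abs_eq_of_products_eq[OF cf inP(3,4) cop[OF inP(3)] cop[OF inP(4)] nz(3,1)])
                  show "y' $ i * x' $ j = y $ i * x $ j" if "i \<noteq> j" for i j
                    using eq[of j i] that by (simp add: mult.commute)
                qed
                ultimately show "s \<in> {v. \<forall>i. \<bar>v $ i\<bar> = \<bar>x $ i\<bar>} \<times> {v. \<forall>i. \<bar>v $ i\<bar> = \<bar>y $ i\<bar>}"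
                  by (simp add: xy'(1))
              qed
              then have "card ?H \<le> card ({v. \<forall>i. \<bar>v $ i\<bar> = \<bar>x $ i\<bar>} \<times> {v. \<forall>i. \<bar>v $ i\<bar> = \<bar>y $ i\<bar>})"
                by (intro card_mono finite_cartesian_product card_same_abs_le)
              also have "\<dots> \<le> 16 * 16"
                unfolding card_cartesian_product by (intro mult_mono card_same_abs_le) auto
              finally show ?thesis by simp
            qed
          qed
          also have "\<dots> \<le> \<Xi> * 256"
          proof (rule mult_right_mono)
            show "real (card (bounded_pairs (half_family A1 A2) (half_family B1 B2) (B ^ 4 / D))) \<le> \<Xi>"
              using False dle by (intro bound D1 cfA cfB) auto
          qed simp
          finally show ?thesis by simp
        qed
      qed
      also have "real (card (M \<times> M \<times> M \<times> M)) = real (card S) ^ 64"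
        by (simp add: card_cartesian_product M(2) flip: power_add)
      also have "\<dots> * (256 * \<Xi>) \<le> t ^ 64 * (256 * \<Xi>)"
        using S(2) \<Xi> by (intro mult_right_mono power_mono) auto
      also have "t ^ 64 = C1 ^ 64 * B powr \<epsilon>"
      proof -
        have "(B powr (50 * \<eta>)) ^ 64 = (B powr (50 * \<eta>)) powr 64" using B by simp
        also have "\<dots> = B powr \<epsilon>" unfolding powr_powr by (simp add: \<eta>_def)
        finally show ?thesis by (simp add: t_def power_mult_distrib)
      qed
      finally show ?thesis by (simp add: mult_ac)
    qed
    ultimately show "(real (card P))\<^sup>2 \<le> 16 * real (card P) + C1 ^ 64 * 256 * B powr \<epsilon> * \<Xi>" by linarith
  qed
qed

section \<open>The bound for the number of rational points\<close>

lemma le_of_square_le: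
  fixes n X :: real
  assumes "n\<^sup>2 \<le> 16 * n + X" "X \<ge> 0" "n \<ge> 0"
  shows "n \<le> 16 + sqrt X"
proof (rule ccontr)
  assume "\<not> n \<le> 16 + sqrt X"
  then have n: "n - 16 > sqrt X" "n > sqrt X" "sqrt X \<ge> 0" using assms by auto
  then have "sqrt X * sqrt X < n * (n - 16)" using assms by (intro mult_strict_mono') auto
  then show False using assms by (simp add: algebra_simps power2_eq_square)
qed

text \<open>Taking the square root of \<open>pair_count\<close> halves the exponent
  \<open>\<theta>\<close>; the loss there is set to 2 * \<open>\<epsilon>\<close> to leave
  \<open>\<epsilon>\<close>.\<close>

lemma family_count_of_pair_count:
  fixes \<epsilon> \<theta> K :: real
  assumes "\<epsilon> > 0" "\<theta> \<ge> 0" and K: "K \<ge> 0"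
    and pairs: "\<And>B D Z W. B \<ge> 1 \<Longrightarrow> 1 \<le> D \<Longrightarrow> D \<le> B ^ 4 \<Longrightarrow> positive_family (D\<^sup>2) Z \<Longrightarrow>
      positive_family (D\<^sup>2) W \<Longrightarrow> real (card (bounded_pairs Z W (B ^ 4 / D))) \<le> K * B powr \<theta>"
  obtains C where "C > 0"
    "\<And>T P B. height_family T B P \<Longrightarrow> B \<ge> 1 \<Longrightarrow> real (card P) \<le> C * B powr (\<theta> / 2 + \<epsilon>)"
proof -
  have e2: "2 * \<epsilon> > 0" using assms(1) by simp
  obtain C where C: "C > 0"
    "\<And>T P B \<Xi>. height_family T B P \<Longrightarrow> B \<ge> 1 \<Longrightarrow> \<Xi> \<ge> 0 \<Longrightarrow>
      (\<And>D Z W. 1 \<le> D \<Longrightarrow> D \<le> B ^ 4 \<Longrightarrow> positive_family (D\<^sup>2) Z \<Longrightarrow> positive_family (D\<^sup>2) W \<Longrightarrow>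
         real (card (bounded_pairs Z W (B ^ 4 / D))) \<le> \<Xi>) \<Longrightarrow>
      (real (card P))\<^sup>2 \<le> 16 * real (card P) + C * B powr (2 * \<epsilon>) * \<Xi>"
    using pair_count[OF e2] by blast
  show thesis
  proof (rule that[of "16 + sqrt (C * K)"])
    show "16 + sqrt (C * K) > 0" using C(1) K by (intro add_pos_nonneg) auto
    fix T :: real and P :: "(int ^ 4) set" and B :: real
    assume P: "height_family T B P" and B: "B \<ge> 1"
    have "(real (card P))\<^sup>2 \<le> 16 * real (card P) + C * B powr (2 * \<epsilon>) * (K * B powr \<theta>)"
      by (rule C(2)[OF P B _ pairs[OF B]]) (use K in auto)
    then have "real (card P) \<le> 16 + sqrt (C * B powr (2 * \<epsilon>) * (K * B powr \<theta>))"
      using C(1) K by (intro le_of_square_le) auto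
    also have "C * B powr (2 * \<epsilon>) * (K * B powr \<theta>) = (C * K) * (B powr (\<theta> / 2 + \<epsilon>))\<^sup>2"
    proof -
      have "B powr (2 * \<epsilon>) * B powr \<theta> = B powr (\<theta> / 2 + \<epsilon>) * B powr (\<theta> / 2 + \<epsilon>)"
        unfolding powr_add[symmetric] by (simp add: algebra_simps)
      then show ?thesis by (simp add: power2_eq_square)
    qed
    also have "sqrt ((C * K) * (B powr (\<theta> / 2 + \<epsilon>))\<^sup>2) = sqrt (C * K) * B powr (\<theta> / 2 + \<epsilon>)"
      by (simp add: real_sqrt_mult)
    also have "(16::real) \<le> 16 * B powr (\<theta> / 2 + \<epsilon>)"
      using ge_one_powr_ge_zero[of B "\<theta> / 2 + \<epsilon>"] B assms by simp
    finally show "real (card P) \<le> (16 + sqrt (C * K)) * B powr (\<theta> / 2 + \<epsilon>)"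
      by (simp add: distrib_right)
  qed
qed

text \<open>With T = D^2 and L = B^4 / D one has T * L = D * B^4 <= B^8.\<close>

lemma bounded_pairs_count:
  fixes \<epsilon> :: real
  assumes "\<epsilon> > 0"
  obtains C where "C > 0"
    "\<And>B D Z W. B \<ge> 1 \<Longrightarrow> 1 \<le> D \<Longrightarrow> D \<le> B ^ 4 \<Longrightarrow> positive_family (D\<^sup>2) Z \<Longrightarrow>
      positive_family (D\<^sup>2) W \<Longrightarrow>
      real (card (bounded_pairs Z W (B ^ 4 / D))) \<le> C * B powr (8 * \<epsilon>) * (B ^ 4 / D) powr (1 / 4)"
proof -
  obtain C where C: "C > 0"
    "\<And>Z W T L. positive_family T Z \<Longrightarrow> positive_family T W \<Longrightarrow> T \<ge> 1 \<Longrightarrow> L \<ge> 1 \<Longrightarrow>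
      real (card (bounded_pairs Z W L)) \<le> C * (T * L) powr \<epsilon> * L powr (1 / 4)"
    using card_bounded_pairs_le_fourth_root[OF assms] by blast
  show thesis
  proof (rule that[OF C(1)])
    fix B D :: real and Z W :: "(int ^ 4) set"
    assume B: "B \<ge> 1" and D: "1 \<le> D" "D \<le> B ^ 4"
      and pf: "positive_family (D\<^sup>2) Z" "positive_family (D\<^sup>2) W"
    have "real (card (bounded_pairs Z W (B ^ 4 / D))) \<le> C * (D\<^sup>2 * (B ^ 4 / D)) powr \<epsilon> * (B ^ 4 / D) powr (1 / 4)"
      using D pf by (intro C(2)) auto
    also have "\<dots> \<le> C * (B powr 8) powr \<epsilon> * (B ^ 4 / D) powr (1 / 4)"
    proof (intro mult_right_mono mult_left_mono powr_mono2)
      have "D\<^sup>2 * (B ^ 4 / D) = D * B ^ 4" using D by (simp add: power2_eq_square)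
      also have "\<dots> \<le> B ^ 4 * B ^ 4" using D B by (intro mult_right_mono) auto
      also have "\<dots> = B powr 8" using B by (simp flip: power_add)
      finally show "D\<^sup>2 * (B ^ 4 / D) \<le> B powr 8" .
    qed (use C(1) D B assms in auto)
    also have "(B powr 8) powr \<epsilon> = B powr (8 * \<epsilon>)" by (rule powr_powr)
    finally show "real (card (bounded_pairs Z W (B ^ 4 / D))) \<le> C * B powr (8 * \<epsilon>) * (B ^ 4 / D) powr (1 / 4)" .
  qed
qed

lemma family_count_half:
  fixes \<epsilon> :: real
  assumes "\<epsilon> > 0"
  obtains C where "C > 0"
    "\<And>T P B. height_family T B P \<Longrightarrow> B \<ge> 1 \<Longrightarrow> real (card P) \<le> C * B powr (1 / 2 + \<epsilon>)"
proof -
  \<comment> \<open>(1 + 8 * \<open>\<eta>\<close>) / 2 + \<open>\<eta>\<close> = 1 / 2 + 5 *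
    \<open>\<eta>\<close>.\<close>
  define \<eta> where "\<eta> = \<epsilon> / 5"
  have \<eta>: "\<eta> > 0" using assms by (simp add: \<eta>_def)
  obtain K where K: "K > 0" "\<And>B D Z W. B \<ge> 1 \<Longrightarrow> 1 \<le> D \<Longrightarrow> D \<le> B ^ 4 \<Longrightarrow> positive_family (D\<^sup>2) Z \<Longrightarrow>
      positive_family (D\<^sup>2) W \<Longrightarrow>
      real (card (bounded_pairs Z W (B ^ 4 / D))) \<le> K * B powr (8 * \<eta>) * (B ^ 4 / D) powr (1 / 4)"
    using bounded_pairs_count[OF \<eta>] by blast
  have pairs: "real (card (bounded_pairs Z W (B ^ 4 / D))) \<le> K * B powr (1 + 8 * \<eta>)"
    if B: "B \<ge> 1" and D: "1 \<le> D" "D \<le> B ^ 4" and pf: "positive_family (D\<^sup>2) Z" "positive_family (D\<^sup>2) W" for B D Z W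
  proof -
    have "B ^ 4 / D \<le> B ^ 4 / 1" using D B by (intro divide_left_mono) auto
    also have "\<dots> = B powr 4" using B by simp
    finally have "(B ^ 4 / D) powr (1 / 4) \<le> (B powr 4) powr (1 / 4)" using D B by (intro powr_mono2) auto
    also have "\<dots> = B powr 1" unfolding powr_powr by simp
    finally have "K * B powr (8 * \<eta>) * (B ^ 4 / D) powr (1 / 4) \<le> K * B powr (8 * \<eta>) * B powr 1"
      using K(1) by (intro mult_left_mono) auto
    also have "\<dots> = K * B powr (1 + 8 * \<eta>)" unfolding powr_add by (simp only: mult_ac)
    finally show ?thesis using K(2)[OF that] by linarith
  qed
  obtain C where C: "C > 0" "\<And>T P B. height_family T B P \<Longrightarrow> B \<ge> 1 \<Longrightarrow> real (card P) \<le> C * B powr ((1 + 8 * \<eta>) / 2 + \<eta>)"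
    using family_count_of_pair_count[of \<eta> "1 + 8 * \<eta>" K] \<eta> K(1) pairs by auto
  have "(1 + 8 * \<eta>) / 2 + \<eta> = 1 / 2 + \<epsilon>" by (simp add: \<eta>_def add_divide_distrib)
  then show thesis using that C by simp
qed

lemma family_count:
  fixes \<epsilon> :: real
  assumes "\<epsilon> > 0"
  obtains C where "C > 0"
    "\<And>T P B. height_family T B P \<Longrightarrow> B \<ge> 1 \<Longrightarrow> real (card P) \<le> C * B powr (4 / 9 + \<epsilon>)"
proof -
  \<comment> \<open>(8 / 9 + 12 * \<open>\<eta>\<close>) / 2 + \<open>\<eta>\<close> = 4 / 9 + 7 *
    \<open>\<eta>\<close>.\<close>
  define \<eta> where "\<eta> = \<epsilon> / 7"
  have \<eta>: "\<eta> > 0" using assms by (simp add: \<eta>_def)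
  obtain C1 where C1: "C1 > 0" "\<And>B D Z W. B \<ge> 1 \<Longrightarrow> 1 \<le> D \<Longrightarrow> D \<le> B ^ 4 \<Longrightarrow> positive_family (D\<^sup>2) Z \<Longrightarrow>
      positive_family (D\<^sup>2) W \<Longrightarrow>
      real (card (bounded_pairs Z W (B ^ 4 / D))) \<le> C1 * B powr (8 * \<eta>) * (B ^ 4 / D) powr (1 / 4)"
    using bounded_pairs_count[OF \<eta>] by blast
  obtain C3 where C3: "C3 > 0"
    "\<And>T P B. height_family T B P \<Longrightarrow> B \<ge> 1 \<Longrightarrow> real (card P) \<le> C3 * B powr (1 / 2 + \<eta>)"
    using family_count_half[OF \<eta>] by blast
  define s where "s = 1 / 2 + \<eta>"
  define K where "K = 1 + 1 / (\<eta> * ln 2)"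
  have K: "K > 0" using \<eta> by (auto simp: K_def intro!: add_pos_pos)
  define C4 where "C4 = C3\<^sup>2 * 2 powr s * K * 4 powr (1 / 2 + 2 * \<eta>)"
  have C4: "C4 > 0" using C3(1) K by (simp add: C4_def)
  define A where "A = C1 + C4"
  have A: "A > 0" "C1 \<le> A" "C4 \<le> A" using C1(1) C4 by (auto simp: A_def)
  have pairs: "real (card (bounded_pairs Z W (B ^ 4 / D))) \<le> A * B powr (8 / 9 + 12 * \<eta>)"
    if B: "B \<ge> 1" and D: "1 \<le> D" "D \<le> B ^ 4" and pf: "positive_family (D\<^sup>2) Z" "positive_family (D\<^sup>2) W" for B D Z W
  proof -
    define n where "n = real (card (bounded_pairs Z W (B ^ 4 / D)))"
    have B4: "B ^ 4 = B powr 4" using B by simp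
    have D4: "D \<le> B powr 4" using D(2) unfolding B4 .
    \<comment> \<open>The two bounds meet at D = B powr (4 / 9), where both (4 - 4 / 9) / 4 and (4 /
      9 + 4 / 3) / 2 equal 8 / 9.\<close>
    show ?thesis
    proof (cases "D \<ge> B powr (4 / 9)")
      case True
      have "B ^ 4 / D \<le> B powr 4 / B powr (4 / 9)" unfolding B4 using True D B by (intro divide_left_mono) auto
      also have "\<dots> = B powr (32 / 9)" by (simp flip: powr_diff)
      finally have "(B ^ 4 / D) powr (1 / 4) \<le> (B powr (32 / 9)) powr (1 / 4)" using D B by (intro powr_mono2) auto
      also have "\<dots> = B powr (8 / 9)" unfolding powr_powr by simp
      finally have "C1 * B powr (8 * \<eta>) * (B ^ 4 / D) powr (1 / 4) \<le> C1 * B powr (8 * \<eta>) * B powr (8 / 9)"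
        using C1(1) by (intro mult_left_mono) auto
      also have "\<dots> = C1 * B powr (8 / 9 + 8 * \<eta>)" unfolding powr_add by (simp only: mult_ac)
      also have "\<dots> \<le> A * B powr (8 / 9 + 12 * \<eta>)"
        using A B C1(1) \<eta> by (intro mult_mono powr_mono) auto
      finally show ?thesis using C1(2)[OF that] by linarith
    next
      case False
      define L where "L = B ^ 4 / D"
      define U where "U = (4 * (D\<^sup>2)\<^sup>2 * L) powr (1 / 3)"
      have L: "L \<ge> 1" using D by (simp add: L_def)
      have D2: "D\<^sup>2 \<ge> 1" using D(1) by (rule one_le_power)
      have e: "4 * (D\<^sup>2)\<^sup>2 * L = 4 * (D ^ 3 * B ^ 4)" using D
        by (simp add: L_def power2_eq_square power3_eq_cube)
      have Ue: "U = (4 * (D ^ 3 * B ^ 4)) powr (1 / 3)" unfolding U_def e ..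
      have cube: "(B powr y) ^ 3 = B powr (3 * y)" for y
      proof -
        have "(B powr y) ^ 3 = (B powr y) powr 3" using B by simp
        then show ?thesis by (simp only: powr_powr mult.commute)
      qed
      have DB: "1 \<le> D ^ 3 * B ^ 4" using D B mult_mono[of 1 "D ^ 3" 1 "B ^ 4"] by simp
      then have U1: "U \<ge> 1" unfolding Ue by (intro ge_one_powr_ge_zero) auto
      have U_le: "U \<le> 4 * B powr y" if "D \<le> B powr x" "y = x + 4 / 3" "x \<ge> 0" for x y
      proof -
        have "D ^ 3 \<le> (B powr x) ^ 3" using that(1) D by (intro power_mono) auto
        also have "\<dots> = B powr (3 * x)" by (rule cube)
        finally have "D ^ 3 * B ^ 4 \<le> B powr (3 * x) * B powr 4" unfolding B4 by (intro mult_right_mono) auto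
        also have "\<dots> = B powr (3 * y)" using that(2) by (simp add: algebra_simps flip: powr_add)
        finally have "4 * (D ^ 3 * B ^ 4) \<le> 4 ^ 3 * B powr (3 * y)"
          using DB by (intro mult_mono) auto
        also have "\<dots> = (4 * B powr y) ^ 3" unfolding power_mult_distrib cube ..
        finally have le: "4 * (D ^ 3 * B ^ 4) \<le> (4 * B powr y) ^ 3" .
        have "U \<le> ((4 * B powr y) ^ 3) powr (1 / 3)" unfolding Ue
          by (rule powr_mono2[OF _ _ le]) (use DB in auto)
        also have "(4 * B powr y) ^ 3 = (4 * B powr y) powr 3" using B by simp
        also have "\<dots> powr (1 / 3) = 4 * B powr y" unfolding powr_powr using B by simp
        finally show ?thesis .
      qed
      have "n \<le> C3\<^sup>2 * 2 powr s * U powr s * (1 + log 2 U)"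
        unfolding n_def U_def L_def[symmetric]
      proof (rule card_bounded_pairs_le_of_count[OF pf D2 L])
        show "0 \<le> C3" using C3(1) by simp
        show "real (card V) \<le> C3 * t powr s" if "height_family (D\<^sup>2) t V" "t \<ge> 1" for V t
          unfolding s_def using that by (rule C3(2))
      qed
      also have "\<dots> \<le> C3\<^sup>2 * 2 powr s * U powr s * (K * U powr \<eta>)"
        unfolding K_def by (intro mult_left_mono log_powr_bound \<eta> U1) auto
      also have "\<dots> = C3\<^sup>2 * 2 powr s * K * (U powr (1 / 2) * U powr (2 * \<eta>))"
      proof -
        have e: "U powr s * U powr \<eta> = U powr (1 / 2) * U powr (2 * \<eta>)"
          unfolding powr_add[symmetric] by (simp add: s_def add.commute)
        show ?thesis unfolding e[symmetric] by (simp only: mult_ac)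
      qed
      \<comment> \<open>The main factor uses the bound for \<open>U\<close> of the present case. The
        small power uses the one from D <= B^4; it costs the exponent 32 / 3 *
        \<open>\<eta>\<close>, within the 12 * \<open>\<eta>\<close> allowed.\<close>
      also have "\<dots> \<le> C3\<^sup>2 * 2 powr s * K * ((4 * B powr (16 / 9)) powr (1 / 2) * (4 * B powr (16 / 3)) powr (2 * \<eta>))"
      proof (intro mult_left_mono mult_mono powr_mono2)
        show "U \<le> 4 * B powr (16 / 9)" using False by (intro U_le[of "4 / 9"]) auto
        show "U \<le> 4 * B powr (16 / 3)" using D4 by (intro U_le[of 4]) auto
      qed (use K U1 \<eta> in auto)
      also have "\<dots> = C4 * (B powr (8 / 9) * B powr (16 / 3 * (2 * \<eta>)))"
      proof -
        have e1: "(4 * B powr (16 / 9)) powr (1 / 2) = 4 powr (1 / 2) * (B powr (16 / 9)) powr (1 / 2)"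
          "(4 * B powr (16 / 3)) powr (2 * \<eta>) = 4 powr (2 * \<eta>) * (B powr (16 / 3)) powr (2 * \<eta>)"
          by (rule powr_mult; simp)+
        have e2: "(B powr (16 / 9)) powr (1 / 2) = B powr (8 / 9)" unfolding powr_powr by simp
        have e3: "(B powr (16 / 3)) powr (2 * \<eta>) = B powr (16 / 3 * (2 * \<eta>))" by (rule powr_powr)
        have e4: "C4 = C3\<^sup>2 * 2 powr s * K * (4 powr (1 / 2) * 4 powr (2 * \<eta>))"
          unfolding C4_def powr_add ..
        show ?thesis unfolding e1 e2 e3 e4 by (simp only: mult_ac)
      qed
      also have "\<dots> \<le> A * B powr (8 / 9 + 12 * \<eta>)"
        unfolding powr_add[symmetric] using A B C4 \<eta> by (intro mult_mono powr_mono) auto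
      finally show ?thesis by (simp add: n_def)
    qed
  qed
  obtain C where C: "C > 0" "\<And>T P B. height_family T B P \<Longrightarrow> B \<ge> 1 \<Longrightarrow> real (card P) \<le> C * B powr ((8 / 9 + 12 * \<eta>) / 2 + \<eta>)"
    using family_count_of_pair_count[of \<eta> "8 / 9 + 12 * \<eta>" A] \<eta> A(1) pairs by auto
  have "(8 / 9 + 12 * \<eta>) / 2 + \<eta> = 4 / 9 + \<epsilon>" by (simp add: \<eta>_def add_divide_distrib)
  then show thesis using that C by simp
qed

text \<open>If the minor vanished, the restrictions of the two forms to the coordinates i, j would
  have dependent coefficients and hence a common zero there. At this point both gradients are
  supported on i, j and dependent, so the Jacobian has rank at most 1.\<close>

lemma minors_nonzero:
  assumes ns: "nonsingular_complete_intersection (diag_form a) (diag_form b)" and ij: "i \<noteq> j"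
  shows "a $ i * b $ j - a $ j * b $ i \<noteq> 0"
proof
  assume m: "a $ i * b $ j - a $ j * b $ i = 0"
  have "\<exists>p q :: int. (p \<noteq> 0 \<or> q \<noteq> 0) \<and> a $ i * p + a $ j * q = 0 \<and> b $ i * p + b $ j * q = 0"
  proof (cases "a $ i = 0 \<and> a $ j = 0")
    case True
    show ?thesis
    proof (cases "b $ i = 0 \<and> b $ j = 0")
      case b0: True
      with True show ?thesis by (intro exI[of _ 1] exI[of _ 0]) simp
    next
      case False
      then show ?thesis using True by (intro exI[of _ "b $ j"] exI[of _ "- b $ i"]) auto
    qed
  next
    case False
    then show ?thesis using m by (intro exI[of _ "a $ j"] exI[of _ "- a $ i"]) (auto simp: algebra_simps)
  qed
  then obtain p q :: int where pq: "p \<noteq> 0 \<or> q \<noteq> 0" "a $ i * p + a $ j * q = 0" "b $ i * p + b $ j * q = 0"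
    by blast
  \<comment> \<open>\<open>p\<close> and \<open>q\<close> are the prescribed squares of the two
    coordinates; complex square roots exist whatever their signs are.\<close>
  define x :: "complex ^ 4" where
    "x = (\<chi> k. if k = i then csqrt (of_int p) else if k = j then csqrt (of_int q) else 0)"
  have df: "diag_form c x = of_int (c $ i * p + c $ j * q)" for c :: "int ^ 4"
  proof -
    have "diag_form c x = (\<Sum>k\<in>{i, j}. of_int (c $ k) * (x $ k)\<^sup>2)"
      unfolding diag_form_def by (rule sum.mono_neutral_right) (auto simp: x_def)
    then show ?thesis using ij by (simp add: x_def)
  qed
  have "x \<noteq> 0"
  proof
    assume "x = 0"
    then have "x $ i = 0" "x $ j = 0" by auto
    then show False using pq(1) ij by (simp add: x_def)
  qed
  moreover have "diag_form a x = 0" "diag_form b x = 0" unfolding df pq(2,3) by simp_all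
  ultimately have "rank (jacobian_matrix (diag_form a) (diag_form b) x) = 2"
    using ns unfolding nonsingular_complete_intersection_def by simp
  moreover define r where "r c = (\<chi> k. 2 * of_int (c $ k) * x $ k)" for c :: "int ^ 4"
  have rows: "rows (jacobian_matrix (diag_form a) (diag_form b) x) = {r a, r b}"
  proof -
    have "row 1 (jacobian_matrix (diag_form a) (diag_form b) x) = r a"
      by (simp add: row_def jacobian_matrix_def partial_deriv_diag_form r_def vec_eq_iff)
    moreover have "row 2 (jacobian_matrix (diag_form a) (diag_form b) x) = r b"
      by (simp add: row_def jacobian_matrix_def partial_deriv_diag_form r_def vec_eq_iff)
    moreover have "rows M = (\<lambda>i. row i M) ` UNIV" for M :: "complex ^ 4 ^ 2" by (auto simp: rows_def)
    ultimately show ?thesis by (simp add: UNIV_2)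
  qed
  have "\<exists>u. {r a, r b} \<subseteq> vec.span {u}"
  proof -
    have m': "of_int (a $ i) * of_int (b $ j) = (of_int (a $ j) * of_int (b $ i) :: complex)"
      using m by (simp flip: of_int_mult)
    consider "a $ i = 0" "a $ j = 0" | "a $ i \<noteq> 0" | "a $ i = 0" "a $ j \<noteq> 0" by blast
    then show ?thesis
    proof cases
      case 1
      then have "r a = 0" by (simp add: r_def x_def vec_eq_iff)
      then show ?thesis by (intro exI[of _ "r b"]) (simp add: vec.span_zero vec.span_base)
    next
      case 2
      have "r b = (of_int (b $ i) / of_int (a $ i)) *s r a"
        using 2 m' ij by (auto simp: r_def x_def vec_eq_iff field_simps)
      then have "r b \<in> vec.span {r a}" by (simp add: vec.span_base vec.span_scale)
      then show ?thesis by (intro exI[of _ "r a"]) (simp add: vec.span_base)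
    next
      case 3
      then have "b $ i = 0" using m by simp
      then have "r b = (of_int (b $ j) / of_int (a $ j)) *s r a"
        using 3 ij by (auto simp: r_def x_def vec_eq_iff field_simps)
      then have "r b \<in> vec.span {r a}" by (simp add: vec.span_base vec.span_scale)
      then show ?thesis by (intro exI[of _ "r a"]) (simp add: vec.span_base)
    qed
  qed
  then obtain u where "{r a, r b} \<subseteq> vec.span {u}" by blast
  then have "vec.dim {r a, r b} \<le> card {u}" by (intro vec.dim_le_card) auto
  ultimately show False by (simp add: row_rank_def_gen rows)
qed

text \<open>Eliminating the fourth coordinate l leaves minors as coefficients. \<open>T\<close>
  depends on the curve, while the constant of \<open>family_count\<close> is chosen before
  \<open>T\<close>.\<close>

lemma conic_family_diag_forms:
  fixes a b :: "int ^ 4"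
  assumes "\<And>i j. i \<noteq> j \<Longrightarrow> a $ i * b $ j - a $ j * b $ i \<noteq> 0"
  obtains T where "conic_family T {x. diag_form a x = 0 \<and> diag_form b x = 0}"
proof -
  define m where "m i j = a $ i * b $ j - a $ j * b $ i" for i j
  define T where "T = real_of_int (\<Sum>(i, j)\<in>UNIV. \<bar>m i j\<bar>)"
  have le: "\<bar>of_int (m i j)\<bar> \<le> T" for i j
  proof -
    have "(case (i, j) of (i, j) \<Rightarrow> \<bar>m i j\<bar>) \<le> (\<Sum>(i, j)\<in>UNIV. \<bar>m i j\<bar>)"
      by (rule member_le_sum) auto
    then have "real_of_int \<bar>m i j\<bar> \<le> T" unfolding T_def by (simp only: of_int_le_iff prod.case)
    then show ?thesis by simp
  qed
  have "conic_family T {x. diag_form a x = 0 \<and> diag_form b x = 0}"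
    unfolding conic_family_def
  proof (intro allI impI)
    fix i j k :: 4 assume d: "distinct [i, j, k]"
    then obtain l where l: "distinct [l, i, j, k]" by (rule ex_fourth)
    have "m i l * (x $ i)\<^sup>2 + m j l * (x $ j)\<^sup>2 + m k l * (x $ k)\<^sup>2 = 0"
      if x: "x \<in> {x. diag_form a x = 0 \<and> diag_form b x = 0}" for x
    proof -
      have df: "diag_form c x = c $ l * (x $ l)\<^sup>2 + c $ i * (x $ i)\<^sup>2 + c $ j * (x $ j)\<^sup>2 + c $ k * (x $ k)\<^sup>2" for c
        unfolding diag_form_def UNIV_distinct_4[OF l] using l by simp
      have "m i l * (x $ i)\<^sup>2 + m j l * (x $ j)\<^sup>2 + m k l * (x $ k)\<^sup>2 = b $ l * diag_form a x - a $ l * diag_form b x"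
        unfolding df m_def by (simp add: algebra_simps)
      then show ?thesis using x by simp
    qed
    moreover have "m i l \<noteq> 0" "m j l \<noteq> 0" "m k l \<noteq> 0" unfolding m_def using l by (intro assms; auto)+
    ultimately show "\<exists>u v w. u \<noteq> 0 \<and> v \<noteq> 0 \<and> w \<noteq> 0 \<and> \<bar>of_int u\<bar> \<le> T \<and> \<bar>of_int v\<bar> \<le> T \<and> \<bar>of_int w\<bar> \<le> T \<and>
      (\<forall>x\<in>{x. diag_form a x = 0 \<and> diag_form b x = 0}. u * (x $ i)\<^sup>2 + v * (x $ j)\<^sup>2 + w * (x $ k)\<^sup>2 = 0)"
      using le by blast
  qed
  then show thesis by (rule that)
qed

lemma num_points_le_card:
  "num_points a b B \<le> card {x :: int ^ 4. coprime_coords x \<and> (\<forall>i. \<bar>of_int (x $ i)\<bar> \<le> B) \<and> diag_form a x = 0 \<and> diag_form b x = 0}"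
proof -
  let ?S = "{x :: int ^ 4. coprime_coords x \<and> (\<forall>i. \<bar>of_int (x $ i)\<bar> \<le> B) \<and> diag_form a x = 0 \<and> diag_form b x = 0}"
  have fin: "finite ?S" by (rule finite_subset[of _ "{v. \<forall>i. \<bar>of_int (v $ i)\<bar> \<le> B}"]) auto
  have "{P \<in> rational_points a b. of_int (height P) \<le> B} \<subseteq> (\<lambda>x. proj_point (rat_vec x)) ` ?S"
  proof
    fix P assume "P \<in> {P \<in> rational_points a b. of_int (height P) \<le> B}"
    then have P: "P \<in> proj_space" "\<And>x. x \<in> P \<Longrightarrow> diag_form a x = 0 \<and> diag_form b x = 0" "of_int (height P) \<le> B"
      by (auto simp: rational_points_def)
    obtain x where x: "coprime_coords x" "P = proj_point (rat_vec x)" using ex_coprime_coords[OF P(1)] .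
    have "rat_vec x \<in> P"
      using coprime_coords_nonzero[OF x(1)] unfolding x(2) proj_point_def proj_rel_def
      by (auto intro: exI[of _ 1])
    then have "diag_form a (rat_vec x) = 0" "diag_form b (rat_vec x) = 0" using P(2) by auto
    moreover have "diag_form c (rat_vec x) = of_int (diag_form c x)" for c
      by (simp add: diag_form_def rat_vec_def)
    ultimately have "diag_form a x = 0" "diag_form b x = 0" by simp_all
    moreover have "\<bar>of_int (x $ i)\<bar> \<le> B" for i
    proof -
      have "real_of_int \<bar>x $ i\<bar> \<le> real_of_int (max_abs x)" by (simp only: of_int_le_iff max_abs_ge)
      then show ?thesis using P(3) height_proj_point[OF x(1)] x(2) by simp
    qed
    ultimately show "P \<in> (\<lambda>x. proj_point (rat_vec x)) ` ?S" using x by blast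
  qed
  then have "num_points a b B \<le> card ((\<lambda>x. proj_point (rat_vec x)) ` ?S)"
    unfolding num_points_def using fin by (intro card_mono) auto
  also have "\<dots> \<le> card ?S" using fin by (rule card_image_le)
  finally show ?thesis .
qed

theorem theorem1p3:
  fixes \<delta> :: real
  assumes "\<delta> < 3 / 392"
  shows "\<exists>K::real. \<forall>a b :: int ^ 4.
           nonsingular_complete_intersection (diag_form a) (diag_form b) \<longrightarrow>
           (\<forall>B::real. B \<ge> 1 \<longrightarrow> real (num_points a b B) \<le> K * B powr (1 / 2 - \<delta>))"
proof -
  \<comment> \<open>4 / 9 + 1 / 100 = 409 / 900 is below 1 / 2 - 3 / 392 = 193 / 392.\<close>
  have "(1 / 100 :: real) > 0" by simp
  then obtain C where C: "C > 0"
    "\<And>T P B. height_family T B P \<Longrightarrow> B \<ge> 1 \<Longrightarrow> real (card P) \<le> C * B powr (4 / 9 + 1 / 100)"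
    using family_count by blast
  show ?thesis
  proof (intro exI[of _ C] allI impI)
    fix a b :: "int ^ 4" and B :: real
    assume ns: "nonsingular_complete_intersection (diag_form a) (diag_form b)" and B: "B \<ge> 1"
    obtain T where T: "conic_family T {x. diag_form a x = 0 \<and> diag_form b x = 0}"
      using conic_family_diag_forms[OF minors_nonzero[OF ns]] by blast
    let ?S = "{x :: int ^ 4. coprime_coords x \<and> (\<forall>i. \<bar>of_int (x $ i)\<bar> \<le> B) \<and> diag_form a x = 0 \<and> diag_form b x = 0}"
    have "conic_family T ?S" using T by (rule conic_family_subset) auto
    then have "height_family T B ?S" by (simp add: height_family_def)
    then have "real (card ?S) \<le> C * B powr (4 / 9 + 1 / 100)" using B by (rule C(2))
    also have "\<dots> \<le> C * B powr (1 / 2 - \<delta>)"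
      using C(1) B assms by (intro mult_left_mono powr_mono) auto
    finally show "real (num_points a b B) \<le> C * B powr (1 / 2 - \<delta>)"
      using num_points_le_card[of a b B] by linarith
  qed
qed

end
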